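(* Let $k$ be an algebraically closed field of characteristic zero, $n\ge2$, $V$ a $k$-vector space of finite dimension $N$, $g\in\mathrm{GL}(V)$ semisimple with $\dim\mathrm{Ker}(g-1)=k_1$, $c\in k^\times$, and $\lambda\in k^\times\setminus\{1\}$. Write $E:=\mathrm{spec}(g)\setminus\{1\}$, $m_\nu:=\dim\mathrm{Ker}(g-\nu I)$, and $\ell:=\dim\mathrm{Ker}(\lambda g^n-I_N)$. Let $\rho=\rho_{g,c}$ be the representation of $F_n\rtimes B_n$ on $V$ with $\rho(x_j)=g$ for all $j$ and $\rho(\sigma_i)=cI_N$ for all $i$, and consider the resulting KLM representation $\rho^{\mathrm{KLM}}_\lambda$ on $V^{\oplus n}/(K+L)$. Set $p_\nu(T):=(T-c)(T+c\nu)$ if $\nu\ne-1$ and $p_{\nu}(T):=(T-c)^2$ if $\nu=-1$. Then: (i) $\dim V^{\oplus n}/(K+L)=n(N-k_1)-\ell$. (ii) If $E\subseteq\{\mu\}$ with $\mu\in k^\times\setminus\{1,-1\}$, then for every $\lambda\in k^\times\setminus\{1\}$, $$\bigl(\rho^{\mathrm{KLM}}_\lambda(\sigma_i)-c\bigr)\bigl(\rho^{\mathrm{KLM}}_\lambda(\sigma_i)+c\mu\bigr)=0,\qquad i=1,\dots,n-1,$$ so that $\sigma_i\mapsto c^{-1}\rho^{\mathrm{KLM}}_\lambda(\sigma_i)$ defines a representation of the Iwahori--Hecke algebra $H_n(\mu)$ of dimension $n\,m_\mu-\ell$. If moreover $m_\mu\ne0$, the operators $\rho^{\mathrm{KLM}}_\lambda(\sigma_i)$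 are semisimple with eigenvalue set contained in $\{c,-c\mu\}$; both eigenvalues occur if and only if $(n-1)m_\mu>\ell$, that is, unless $n=2$ and $\lambda=\mu^{-2}$. (iii) Suppose $n\ge3$ and $E\ne\emptyset$. Then, for every $\lambda\in k^\times\setminus\{1\}$, the minimal polynomial of $\rho^{\mathrm{KLM}}_\lambda(\sigma_i)$ equals $\mathrm{lcm}_{\nu\in E}\,p_\nu$. In particular, it is quadratic with two distinct roots if and only if $E=\{\mu\}$ with $\mu\ne-1$, in which case the roots are $c$ and $-c\mu$. (iv) Suppose $n=2$ and $E\ne\emptyset$, and partition $E=R_\lambda\sqcup U_\lambda$ with $R_\lambda:=\{\nu\in E:\lambda\nu^2=1\}$. Then the minimal polynomial of $\rho^{\mathrm{KLM}}_\lambda(\sigma_1)$ equals $$\mathrm{lcm}\bigl(\{T+c\nu:\nu\in R_\lambda\}\cup\{p_\nu:\nu\in U_\lambda\}\bigr).$$ It is quadratic with two distinct roots if and only if either (a) $E=\{\mu\}$ with $\mu\ne-1$ and $\lambda\mu^2\ne1$, the roots being $c$ and $-c\mu$; or (b) $E=\{\nu,-\nu\}$ and $\lambda=\nu^{-2}$, the roots being $\pm c\nu$. In this case $\widetilde T_1:=(c\nu)^{-1}\rho^{\mathrm{KLM}}_\lambda(\sigma_1)$ satisfies $(\widetilde T_1-1)(\widetilde T_1+1)=0$, so that this additional normalization exhibits an $H_2(1)$-module. (v) If $E=\{-1\}$, the minimal polynomial of $\rho^{\mathrm{KLM}}_\lambda(\sigma_i)$ is $(T-c)^2$: the representation $\sigma_i\mapsto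 c^{-1}\rho^{\mathrm{KLM}}_\lambda(\sigma_i)$ factors through the repeated-root specialization $H_n(-1)$, but the operators $\rho^{\mathrm{KLM}}_\lambda(\sigma_i)$ satisfy no Hecke relation $(T-a)(T-b)=0$ with two distinct parameters $a\ne b$. If $n=2$, $E=\{\mu\}$ and $\lambda\mu^2=1$, then $\rho^{\mathrm{KLM}}_\lambda(\sigma_1)$ is the scalar $-c\mu$, with linear minimal polynomial; it still satisfies $(T-c)(T+c\mu)=0$ and defines an $H_2(\mu)$-module.
   Context: $B_n$ is the Artin braid group with standard generators $\sigma_1,\dots,\sigma_{n-1}$; $F_n$ is the free group on $x_1,\dots,x_n$. The Artin action $\theta\colon B_n\to\mathrm{Aut}(F_n)$ is $\theta_{\sigma_i}(x_i)=x_{i+1}$, $\theta_{\sigma_i}(x_{i+1})=x_{i+1}^{-1}x_ix_{i+1}$, $\theta_{\sigma_i}(x_j)=x_j$ for $j\ne i,i+1$. $F_n\rtimes B_n$ is the corresponding semidirect product, in which $\sigma x\sigma^{-1}=\theta_\sigma(x)$. For a representation $\rho\colon F_n\rtimes B_n\to\mathrm{GL}(V)$, $N=\dim V$, write $g_i:=\rho(x_i)$, $s_i:=\rho(\sigma_i)$. Twisted Long--Moody construction: for $\lambda\in k^\times$, $\rho^{\mathrm{LM}}_\lambda\colon F_n\rtimes B_n\to\mathrm{GL}(V^{\oplus n})$ is the representation given on generators as follows, in $n\times n$ block form with $N\times N$ blocks. $\rho^{\mathrm{LM}}_\lambda(x_i)$ is the identity matrix except in the $i$-th block row, which equals $(\lambda(g_1-1),\dots,\lambda(g_{i-1}-1),\lambda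 g_i,g_{i+1}-1,\dots,g_n-1)$. $\rho^{\mathrm{LM}}_\lambda(\sigma_i)=s_i^{\oplus n}\cdot\mathrm{diag}(I_{N(i-1)},R_i,I_{N(n-i-1)})$ with $R_i=\begin{pmatrix}O&g_i\\ I_N&I_N-g_{i+1}\end{pmatrix}$ in block rows and columns $i,i+1$. Katz--Long--Moody (KLM) construction: let $K=\{(w_1,\dots,w_n)^T: w_j\in\mathrm{Ker}(g_j-1)\}$ and $L=\bigcap_{j=1}^n\mathrm{Ker}(\rho^{\mathrm{LM}}_\lambda(x_j)-I)$. The subspace $K+L$ is $\rho^{\mathrm{LM}}_\lambda$-invariant, and $\rho^{\mathrm{KLM}}_\lambda$ is the induced representation of $F_n\rtimes B_n$ on $V^{\oplus n}/(K+L)$. For $q\in k^\times$, $H_n(q)$ is the $k$-algebra with generators $T_1,\dots,T_{n-1}$, the braid relations, and $(T_i-1)(T_i+q)=0$. $\mathrm{spec}(g)$ denotes the set of eigenvalues of $g$; $\mathrm{lcm}$ is the monic least common multiple of monic polynomials. *)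

theory Defs
  imports
    "Jordan_Normal_Form.VS_Connect"
    "HOL-Algebra.Bij"
    "HOL-Algebra.QuotRing"
begin

section \<open>Groups: free groups, braid groups, semidirect products\<close>

text \<open>A letter \<open>(x, True)\<close> is the generator \<open>x\<close> and \<open>(x, False)\<close> its formal inverse.\<close>

type_synonym 'a gword = "('a \<times> bool) list"

definition gwords :: "'a set \<Rightarrow> 'a gword set" where
  "gwords X = lists (X \<times> UNIV)"

inductive_set presentation_rel ::
    "'a set \<Rightarrow> ('a gword \<times> 'a gword) set \<Rightarrow> ('a gword \<times> 'a gword) set"
  for X :: "'a set" and R :: "('a gword \<times> 'a gword) set" where
  refl: "w \<in> gwords X \<Longrightarrow> (w, w) \<in> presentation_rel X R"
| sym: "(v, w) \<in> presentation_rel X R \<Longrightarrow> (w, v) \<in> presentation_rel X R"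
| trans: "(u, v) \<in> presentation_rel X R \<Longrightarrow> (v, w) \<in> presentation_rel X R
    \<Longrightarrow> (u, w) \<in> presentation_rel X R"
| cancel: "u \<in> gwords X \<Longrightarrow> v \<in> gwords X \<Longrightarrow> x \<in> X
    \<Longrightarrow> (u @ [(x, s), (x, \<not> s)] @ v, u @ v) \<in> presentation_rel X R"
| relator: "u \<in> gwords X \<Longrightarrow> v \<in> gwords X \<Longrightarrow> (r, r') \<in> R
    \<Longrightarrow> (u @ r @ v, u @ r' @ v) \<in> presentation_rel X R"

text \<open>The group with generators \<open>X\<close> and relations \<open>r = r'\<close> for \<open>(r, r') \<in> R\<close>, where \<open>R\<close> is meant
  to be a set of pairs of words over \<open>X\<close>.\<close>

definition presented_group ::
    "'a set \<Rightarrow> ('a gword \<times> 'a gword) set \<Rightarrow> 'a gword set monoid" where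
  "presented_group X R =
    \<lparr>carrier = gwords X // presentation_rel X R,
     mult = \<lambda>A B. \<Union>a\<in>A. \<Union>b\<in>B. presentation_rel X R `` {a @ b},
     one = presentation_rel X R `` {[]}\<rparr>"

definition group_gen :: "'a set \<Rightarrow> ('a gword \<times> 'a gword) set \<Rightarrow> 'a \<Rightarrow> 'a gword set" where
  "group_gen X R x = presentation_rel X R `` {[(x, True)]}"

definition free_group :: "nat \<Rightarrow> nat gword set monoid" where
  "free_group n = presented_group {1..n} {}"

definition free_gen :: "nat \<Rightarrow> nat \<Rightarrow> nat gword set" where
  "free_gen n = group_gen {1..n} {}"

definition braid_relations :: "nat \<Rightarrow> (nat gword \<times> nat gword) set" where
  "braid_relations n =
     {([(i, True), (j, True)], [(j, True), (i, True)]) | i j.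
        i \<in> {1..<n} \<and> j \<in> {1..<n} \<and> i + 2 \<le> j}
   \<union> {([(i, True), (i + 1, True), (i, True)], [(i + 1, True), (i, True), (i + 1, True)]) | i.
        i \<in> {1..<n} \<and> i + 1 \<in> {1..<n}}"

definition braid_group :: "nat \<Rightarrow> nat gword set monoid" where
  "braid_group n = presented_group {1..<n} (braid_relations n)"

definition braid_gen :: "nat \<Rightarrow> nat \<Rightarrow> nat gword set" where
  "braid_gen n = group_gen {1..<n} (braid_relations n)"

definition artin_action :: "nat \<Rightarrow> nat gword set \<Rightarrow> nat gword set \<Rightarrow> nat gword set" where
  "artin_action n = (THE \<theta>.
     \<theta> \<in> hom (braid_group n) (AutoGroup (free_group n)) \<inter> extensional (carrier (braid_group n)) \<and>
     (\<forall>i\<in>{1..<n}.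
        \<theta> (braid_gen n i) (free_gen n i) = free_gen n (i + 1) \<and>
        \<theta> (braid_gen n i) (free_gen n (i + 1)) =
          inv\<^bsub>free_group n\<^esub> (free_gen n (i + 1)) \<otimes>\<^bsub>free_group n\<^esub> free_gen n i
            \<otimes>\<^bsub>free_group n\<^esub> free_gen n (i + 1) \<and>
        (\<forall>j\<in>{1..n} - {i, i + 1}. \<theta> (braid_gen n i) (free_gen n j) = free_gen n j)))"

text \<open>With this multiplication \<open>(\<one>, h) (x, \<one>) (\<one>, h)\<inverse> = (\<theta> h x, \<one>)\<close>.\<close>

definition semidirect_product ::
    "('a, 'c) monoid_scheme \<Rightarrow> ('b, 'd) monoid_scheme \<Rightarrow> ('b \<Rightarrow> 'a \<Rightarrow> 'a) \<Rightarrow> ('a \<times> 'b) monoid" where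
  "semidirect_product N H \<theta> =
    \<lparr>carrier = carrier N \<times> carrier H,
     mult = \<lambda>(a, h) (b, k). (a \<otimes>\<^bsub>N\<^esub> \<theta> h b, h \<otimes>\<^bsub>H\<^esub> k),
     one = (\<one>\<^bsub>N\<^esub>, \<one>\<^bsub>H\<^esub>)\<rparr>"

type_synonym fb_elt = "nat gword set \<times> nat gword set"

definition FB :: "nat \<Rightarrow> fb_elt monoid" where
  "FB n = semidirect_product (free_group n) (braid_group n) (artin_action n)"

definition fb_x :: "nat \<Rightarrow> nat \<Rightarrow> fb_elt" where
  "fb_x n j = (free_gen n j, \<one>\<^bsub>braid_group n\<^esub>)"

definition fb_sigma :: "nat \<Rightarrow> nat \<Rightarrow> fb_elt" where
  "fb_sigma n i = (\<one>\<^bsub>free_group n\<^esub>, braid_gen n i)"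


section \<open>Linear algebra\<close>

text \<open>Vector spaces over the field type \<open>'k\<close> are module records \<open>V\<close> with
  \<open>vectorspace class_ring V\<close>. Endomorphisms are extensional, so that equality of linear
  operators is equality in HOL.\<close>

definition End :: "('k::field, 'v, 'm) module_scheme \<Rightarrow> ('k, 'v \<Rightarrow> 'v) module" where
  "End V =
    \<lparr>carrier = LinearCombinations.module_hom class_ring V V \<inter> extensional (carrier V),
     mult = compose (carrier V),
     one = \<lambda>v\<in>carrier V. v,
     zero = \<lambda>v\<in>carrier V. \<zero>\<^bsub>V\<^esub>,
     add = \<lambda>f h. \<lambda>v\<in>carrier V. f v \<oplus>\<^bsub>V\<^esub> h v,
     smult = \<lambda>a f. \<lambda>v\<in>carrier V. a \<odot>\<^bsub>V\<^esub> f v\<rparr>"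

definition GL :: "('k::field, 'v, 'm) module_scheme \<Rightarrow> ('v \<Rightarrow> 'v) monoid" where
  "GL V = units_of (End V)"

definition scalar_op :: "('k::field, 'v, 'm) module_scheme \<Rightarrow> 'k \<Rightarrow> 'v \<Rightarrow> 'v" where
  "scalar_op V a = a \<odot>\<^bsub>End V\<^esub> \<one>\<^bsub>End V\<^esub>"

definition Ker :: "('k::field, 'v, 'm) module_scheme \<Rightarrow> ('v \<Rightarrow> 'v) \<Rightarrow> 'v set" where
  "Ker V f = a_kernel V V f"

definition vdim :: "('k::field, 'v, 'm) module_scheme \<Rightarrow> nat" where
  "vdim V = vectorspace.dim class_ring V"

definition subspace_dim :: "('k::field, 'v, 'm) module_scheme \<Rightarrow> 'v set \<Rightarrow> nat" where
  "subspace_dim V U = vdim (V\<lparr>carrier := U\<rparr>)"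

definition spec :: "('k::field, 'v, 'm) module_scheme \<Rightarrow> ('v \<Rightarrow> 'v) \<Rightarrow> 'k set" where
  "spec V f = {\<nu>. \<exists>v\<in>carrier V. v \<noteq> \<zero>\<^bsub>V\<^esub> \<and> f v = \<nu> \<odot>\<^bsub>V\<^esub> v}"

definition semisimple :: "('k::field, 'v, 'm) module_scheme \<Rightarrow> ('v \<Rightarrow> 'v) \<Rightarrow> bool" where
  "semisimple V f \<longleftrightarrow>
    (\<forall>U. VectorSpace.subspace class_ring U V \<and> f ` U \<subseteq> U \<longrightarrow>
      (\<exists>U'. VectorSpace.subspace class_ring U' V \<and> f ` U' \<subseteq> U' \<and>
            U \<inter> U' = {\<zero>\<^bsub>V\<^esub>} \<and> U <+>\<^bsub>V\<^esub> U' = carrier V))"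

text \<open>The direct sum of \<open>n\<close> copies of \<open>V\<close>: families indexed by \<open>{1..n}\<close>. The ring fields
  \<open>mult\<close> and \<open>one\<close> of the record play no role.\<close>

definition vpow :: "nat \<Rightarrow> ('k, 'v, 'm) module_scheme \<Rightarrow> ('k, nat \<Rightarrow> 'v) module" where
  "vpow n V =
    \<lparr>carrier = {1..n} \<rightarrow>\<^sub>E carrier V,
     mult = undefined,
     one = undefined,
     zero = \<lambda>j\<in>{1..n}. \<zero>\<^bsub>V\<^esub>,
     add = \<lambda>v w. \<lambda>j\<in>{1..n}. v j \<oplus>\<^bsub>V\<^esub> w j,
     smult = \<lambda>a v. \<lambda>j\<in>{1..n}. a \<odot>\<^bsub>V\<^esub> v j\<rparr>"

text \<open>The operator on \<open>vpow n V\<close> whose block in block row \<open>i\<close> and block column \<open>j\<close> is \<open>B i j\<close>,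
  acting on columns.\<close>

definition block_op ::
    "nat \<Rightarrow> ('k, 'v, 'm) module_scheme \<Rightarrow> (nat \<Rightarrow> nat \<Rightarrow> 'v \<Rightarrow> 'v) \<Rightarrow> (nat \<Rightarrow> 'v) \<Rightarrow> nat \<Rightarrow> 'v" where
  "block_op n V B = (\<lambda>w\<in>carrier (vpow n V). \<lambda>i\<in>{1..n}. \<Oplus>\<^bsub>V\<^esub>j\<in>{1..n}. B i j (w j))"

text \<open>Quotient of a module, or of an algebra when \<open>U\<close> is a two-sided ideal: the factor ring of the
  library (cosets of \<open>U\<close>) with the induced scalar multiplication.\<close>

definition quotient_space ::
    "('k, 'v, 'm) module_scheme \<Rightarrow> 'v set \<Rightarrow> ('k, 'v set) module" where
  "quotient_space W U =
    ring.extend (W Quot U) (Module.module.fields (\<lambda>a C. \<Union>w\<in>C. U +>\<^bsub>W\<^esub> (a \<odot>\<^bsub>W\<^esub> w)))"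

definition induced_op ::
    "('k, 'v, 'm) module_scheme \<Rightarrow> 'v set \<Rightarrow> ('v \<Rightarrow> 'v) \<Rightarrow> 'v set \<Rightarrow> 'v set" where
  "induced_op W U f = (\<lambda>C\<in>carrier (quotient_space W U). \<Union>w\<in>C. U +>\<^bsub>W\<^esub> f w)"


section \<open>Polynomials\<close>

definition op_poly :: "('k::field, 'v, 'm) module_scheme \<Rightarrow> 'k poly \<Rightarrow> ('v \<Rightarrow> 'v) \<Rightarrow> 'v \<Rightarrow> 'v" where
  "op_poly V p f =
    (\<Oplus>\<^bsub>End V\<^esub>i\<in>{..degree p}. coeff p i \<odot>\<^bsub>End V\<^esub> (f [^]\<^bsub>End V\<^esub> i))"

definition is_minimal_polynomial ::
    "('k::field, 'v, 'm) module_scheme \<Rightarrow> ('v \<Rightarrow> 'v) \<Rightarrow> 'k poly \<Rightarrow> bool" where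
  "is_minimal_polynomial V f p \<longleftrightarrow>
     lead_coeff p = 1 \<and> op_poly V p f = \<zero>\<^bsub>End V\<^esub> \<and>
     (\<forall>q. op_poly V q f = \<zero>\<^bsub>End V\<^esub> \<longrightarrow> p dvd q)"

definition minimal_polynomial ::
    "('k::field, 'v, 'm) module_scheme \<Rightarrow> ('v \<Rightarrow> 'v) \<Rightarrow> 'k poly" where
  "minimal_polynomial V f = (THE p. is_minimal_polynomial V f p)"

definition is_monic_lcm :: "'k::field poly set \<Rightarrow> 'k poly \<Rightarrow> bool" where
  "is_monic_lcm S m \<longleftrightarrow>
     lead_coeff m = 1 \<and> (\<forall>p\<in>S. p dvd m) \<and> (\<forall>q. (\<forall>p\<in>S. p dvd q) \<longrightarrow> m dvd q)"

text \<open>The constants \<^const>\<open>lcm\<close> and \<^const>\<open>Lcm\<close> of the library are not available for polynomials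
  over an arbitrary type of class \<^class>\<open>field\<close>.\<close>

definition monic_lcm :: "'k::field poly set \<Rightarrow> 'k poly" where
  "monic_lcm S = (THE m. is_monic_lcm S m)"

lemma monic_dvd_antisym:
  fixes p q :: "'k::field poly"
  assumes "lead_coeff p = 1" "lead_coeff q = 1" "p dvd q" "q dvd p"
  shows "p = q"
proof -
  obtain r where r: "q = p * r"
    using assms(3) by (elim dvdE)
  have nz: "p \<noteq> 0" "q \<noteq> 0"
    using assms by auto
  then have "degree p = degree q"
    using assms by (auto intro: antisym dvd_imp_degree_le)
  then have "degree r = 0"
    using nz r by (auto simp: degree_mult_eq)
  then obtain a where "r = [:a:]"
    by (elim degree_eq_zeroE)
  then show ?thesis
    using assms r by (auto split: if_splits)
qed

lemma minimal_polynomial_eqI: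
  "is_minimal_polynomial V f p \<Longrightarrow> minimal_polynomial V f = p"
  unfolding minimal_polynomial_def
  by (rule the_equality) (auto simp: is_minimal_polynomial_def intro: monic_dvd_antisym)

lemma monic_lcm_eqI: "is_monic_lcm S m \<Longrightarrow> monic_lcm S = m"
  unfolding monic_lcm_def
  by (rule the_equality) (auto simp: is_monic_lcm_def intro: monic_dvd_antisym)

lemma is_monic_lcm_monic_lcm:
  fixes S :: "'k::field poly set"
  assumes "finite S" "0 \<notin> S"
  shows "is_monic_lcm S (monic_lcm S)"
proof -
  define P where "P = (\<lambda>m. m \<noteq> 0 \<and> (\<forall>p\<in>S. p dvd m))"
  have "P (\<Prod>S)"
    using assms by (auto simp: P_def intro: dvd_prodI)
  then obtain m where m: "P m" and least: "\<And>q. P q \<Longrightarrow> degree m \<le> degree q"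
    using ex_has_least_nat[of P _ degree] by metis
  have dvd: "m dvd q" if "\<forall>p\<in>S. p dvd q" for q
  proof (rule ccontr)
    assume "\<not> m dvd q"
    then have nz: "q mod m \<noteq> 0"
      by (simp add: dvd_eq_mod_eq_0)
    moreover have "\<forall>p\<in>S. p dvd q mod m"
      using that m by (auto simp: P_def dvd_mod)
    ultimately have "degree m \<le> degree (q mod m)"
      by (intro least) (simp add: P_def)
    moreover have "degree (q mod m) < degree m"
      using nz m degree_mod_less[of m q] by (auto simp: P_def)
    ultimately show False
      by simp
  qed
  let ?m = "Polynomial.smult (inverse (lead_coeff m)) m"
  have "is_monic_lcm S ?m"
    using m dvd by (auto simp: is_monic_lcm_def P_def intro: dvd_smult smult_dvd)
  then show ?thesis
    using monic_lcm_eqI by fastforce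
qed

definition quadratic_with_distinct_roots :: "'k::field poly \<Rightarrow> bool" where
  "quadratic_with_distinct_roots p \<longleftrightarrow> degree p = 2 \<and> card {t. poly p t = 0} = 2"

definition hecke_poly :: "'k::field \<Rightarrow> 'k \<Rightarrow> 'k poly" where
  "hecke_poly c \<nu> = (if \<nu> = -1 then [:-c, 1:] ^ 2 else [:-c, 1:] * [:c * \<nu>, 1:])"


section \<open>Iwahori--Hecke algebras\<close>

text \<open>The free associative algebra on \<open>T\<^sub>1, \<dots>, T\<^bsub>n-1\<^esub>\<close>: finitely supported functions on
  words in the letters \<open>{1..<n}\<close>, multiplied by convolution over all factorisations of a word.\<close>

definition free_algebra :: "nat \<Rightarrow> ('k::field, nat list \<Rightarrow> 'k) module" where
  "free_algebra n =
    \<lparr>carrier = {f. finite {w. f w \<noteq> 0} \<and> {w. f w \<noteq> 0} \<subseteq> lists {1..<n}},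
     mult = \<lambda>f h w. \<Sum>i\<le>length w. f (take i w) * h (drop i w),
     one = \<lambda>w. if w = [] then 1 else 0,
     zero = \<lambda>w. 0,
     add = \<lambda>f h w. f w + h w,
     smult = \<lambda>a f w. a * f w\<rparr>"

definition monomial :: "nat list \<Rightarrow> nat list \<Rightarrow> 'k::field" where
  "monomial u = (\<lambda>w. if w = u then 1 else 0)"

definition hecke_relators :: "nat \<Rightarrow> 'k::field \<Rightarrow> (nat list \<Rightarrow> 'k) set" where
  "hecke_relators n q =
     {monomial [i, j] \<ominus>\<^bsub>free_algebra n\<^esub> monomial [j, i] | i j.
        i \<in> {1..<n} \<and> j \<in> {1..<n} \<and> i + 2 \<le> j}
   \<union> {monomial [i, i + 1, i] \<ominus>\<^bsub>free_algebra n\<^esub> monomial [i + 1, i, i + 1] | i.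
        i \<in> {1..<n} \<and> i + 1 \<in> {1..<n}}
   \<union> {(monomial [i] \<ominus>\<^bsub>free_algebra n\<^esub> \<one>\<^bsub>free_algebra n\<^esub>) \<otimes>\<^bsub>free_algebra n\<^esub>
        (monomial [i] \<oplus>\<^bsub>free_algebra n\<^esub> q \<odot>\<^bsub>free_algebra n\<^esub> \<one>\<^bsub>free_algebra n\<^esub>) | i.
        i \<in> {1..<n}}"

definition hecke_ideal :: "nat \<Rightarrow> 'k::field \<Rightarrow> (nat list \<Rightarrow> 'k) set" where
  "hecke_ideal n q = genideal (free_algebra n) (hecke_relators n q)"

definition hecke_algebra :: "nat \<Rightarrow> 'k::field \<Rightarrow> ('k, (nat list \<Rightarrow> 'k) set) module" where
  "hecke_algebra n q = quotient_space (free_algebra n) (hecke_ideal n q)"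

definition hecke_gen :: "nat \<Rightarrow> 'k::field \<Rightarrow> nat \<Rightarrow> (nat list \<Rightarrow> 'k) set" where
  "hecke_gen n q i = hecke_ideal n q +>\<^bsub>free_algebra n\<^esub> monomial [i]"

text \<open>The assignment \<open>T\<^sub>i \<mapsto> A i\<close> extends to a representation of \<open>H\<^sub>n(q)\<close> on \<open>W\<close>.\<close>

definition defines_hecke_rep ::
    "nat \<Rightarrow> 'k::field \<Rightarrow> ('k, 'w, 'm) module_scheme \<Rightarrow> (nat \<Rightarrow> 'w \<Rightarrow> 'w) \<Rightarrow> bool" where
  "defines_hecke_rep n q W A \<longleftrightarrow>
    (\<exists>\<phi>. \<phi> \<in> Ring.ring_hom (hecke_algebra n q) (End W) \<inter> LinearCombinations.module_hom class_ring (hecke_algebra n q) (End W)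
       \<and> (\<forall>i\<in>{1..<n}. \<phi> (hecke_gen n q i) = A i))"


section \<open>The Long--Moody and Katz--Long--Moody constructions\<close>

text \<open>The representation of \<open>F\<^sub>n \<rtimes> B\<^sub>n\<close> on \<open>W\<close> with \<open>x\<^sub>j \<mapsto> X j\<close> and
  \<open>\<sigma>\<^sub>i \<mapsto> S i\<close>; a homomorphism that is \<^const>\<open>undefined\<close> off the carrier is determined by these
  values.\<close>

definition rep_on_gens ::
    "nat \<Rightarrow> ('k::field, 'w, 'm) module_scheme \<Rightarrow> (nat \<Rightarrow> 'w \<Rightarrow> 'w) \<Rightarrow> (nat \<Rightarrow> 'w \<Rightarrow> 'w)
      \<Rightarrow> fb_elt \<Rightarrow> 'w \<Rightarrow> 'w" where
  "rep_on_gens n W X S = (THE \<rho>.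
     \<rho> \<in> hom (FB n) (GL W) \<inter> extensional (carrier (FB n)) \<and>
     (\<forall>j\<in>{1..n}. \<rho> (fb_x n j) = X j) \<and>
     (\<forall>i\<in>{1..<n}. \<rho> (fb_sigma n i) = S i))"

definition rho_gc ::
    "nat \<Rightarrow> ('k::field, 'v, 'm) module_scheme \<Rightarrow> ('v \<Rightarrow> 'v) \<Rightarrow> 'k \<Rightarrow> fb_elt \<Rightarrow> 'v \<Rightarrow> 'v" where
  "rho_gc n V g c = rep_on_gens n V (\<lambda>j. g) (\<lambda>i. scalar_op V c)"

definition LM_x ::
    "nat \<Rightarrow> ('k::field, 'v, 'm) module_scheme \<Rightarrow> 'k \<Rightarrow> (nat \<Rightarrow> 'v \<Rightarrow> 'v) \<Rightarrow> nat
      \<Rightarrow> (nat \<Rightarrow> 'v) \<Rightarrow> nat \<Rightarrow> 'v" where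
  "LM_x n V lam g i = block_op n V (\<lambda>r s.
     if r \<noteq> i then (if r = s then \<one>\<^bsub>End V\<^esub> else \<zero>\<^bsub>End V\<^esub>)
     else if s < i then lam \<odot>\<^bsub>End V\<^esub> (g s \<ominus>\<^bsub>End V\<^esub> \<one>\<^bsub>End V\<^esub>)
     else if s = i then lam \<odot>\<^bsub>End V\<^esub> g i
     else g s \<ominus>\<^bsub>End V\<^esub> \<one>\<^bsub>End V\<^esub>)"

definition LM_sigma ::
    "nat \<Rightarrow> ('k::field, 'v, 'm) module_scheme \<Rightarrow> (nat \<Rightarrow> 'v \<Rightarrow> 'v) \<Rightarrow> (nat \<Rightarrow> 'v \<Rightarrow> 'v) \<Rightarrow> nat
      \<Rightarrow> (nat \<Rightarrow> 'v) \<Rightarrow> nat \<Rightarrow> 'v" where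
  "LM_sigma n V g s i =
     block_op n V (\<lambda>r t. if r = t then s i else \<zero>\<^bsub>End V\<^esub>)
     \<otimes>\<^bsub>End (vpow n V)\<^esub>
     block_op n V (\<lambda>r t.
       if r = i \<and> t = i then \<zero>\<^bsub>End V\<^esub>
       else if r = i \<and> t = i + 1 then g i
       else if r = i + 1 \<and> t = i then \<one>\<^bsub>End V\<^esub>
       else if r = i + 1 \<and> t = i + 1 then \<one>\<^bsub>End V\<^esub> \<ominus>\<^bsub>End V\<^esub> g (i + 1)
       else if r = t then \<one>\<^bsub>End V\<^esub> else \<zero>\<^bsub>End V\<^esub>)"

definition LM_rep ::
    "nat \<Rightarrow> ('k::field, 'v, 'm) module_scheme \<Rightarrow> 'k \<Rightarrow> (fb_elt \<Rightarrow> 'v \<Rightarrow> 'v)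
      \<Rightarrow> fb_elt \<Rightarrow> (nat \<Rightarrow> 'v) \<Rightarrow> nat \<Rightarrow> 'v" where
  "LM_rep n V lam \<rho> = rep_on_gens n (vpow n V)
     (LM_x n V lam (\<lambda>j. \<rho> (fb_x n j)))
     (LM_sigma n V (\<lambda>j. \<rho> (fb_x n j)) (\<lambda>i. \<rho> (fb_sigma n i)))"

definition KLM_K ::
    "nat \<Rightarrow> ('k::field, 'v, 'm) module_scheme \<Rightarrow> (fb_elt \<Rightarrow> 'v \<Rightarrow> 'v) \<Rightarrow> (nat \<Rightarrow> 'v) set" where
  "KLM_K n V \<rho> =
     {w \<in> carrier (vpow n V). \<forall>j\<in>{1..n}. w j \<in> Ker V (\<rho> (fb_x n j) \<ominus>\<^bsub>End V\<^esub> \<one>\<^bsub>End V\<^esub>)}"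

definition KLM_L ::
    "nat \<Rightarrow> ('k::field, 'v, 'm) module_scheme \<Rightarrow> 'k \<Rightarrow> (fb_elt \<Rightarrow> 'v \<Rightarrow> 'v) \<Rightarrow> (nat \<Rightarrow> 'v) set" where
  "KLM_L n V lam \<rho> =
     (\<Inter>j\<in>{1..n}. Ker (vpow n V)
        (LM_rep n V lam \<rho> (fb_x n j) \<ominus>\<^bsub>End (vpow n V)\<^esub> \<one>\<^bsub>End (vpow n V)\<^esub>))"

definition KLM_space ::
    "nat \<Rightarrow> ('k::field, 'v, 'm) module_scheme \<Rightarrow> 'k \<Rightarrow> (fb_elt \<Rightarrow> 'v \<Rightarrow> 'v)
      \<Rightarrow> ('k, (nat \<Rightarrow> 'v) set) module" where
  "KLM_space n V lam \<rho> =
     quotient_space (vpow n V) (KLM_K n V \<rho> <+>\<^bsub>vpow n V\<^esub> KLM_L n V lam \<rho>)"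

definition KLM_rep ::
    "nat \<Rightarrow> ('k::field, 'v, 'm) module_scheme \<Rightarrow> 'k \<Rightarrow> (fb_elt \<Rightarrow> 'v \<Rightarrow> 'v)
      \<Rightarrow> fb_elt \<Rightarrow> (nat \<Rightarrow> 'v) set \<Rightarrow> (nat \<Rightarrow> 'v) set" where
  "KLM_rep n V lam \<rho> = (\<lambda>\<gamma>\<in>carrier (FB n).
     induced_op (vpow n V) (KLM_K n V \<rho> <+>\<^bsub>vpow n V\<^esub> KLM_L n V lam \<rho>) (LM_rep n V lam \<rho> \<gamma>))"

end

theory Submission
  imports Defs
begin

text \<open>
A semisimple operator \<open>g\<close> over an algebraically closed field has a basis of eigenvectors
(\<open>semisimple_eigenbasis\<close>). Since \<open>x\<^sub>j\<close> acts by \<open>g\<close> for all \<open>j\<close> and \<open>\<sigma>\<^sub>i\<close> by a scalar, all operators of the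
Long--Moody representation on \<open>V\<^sup>n\<close> respect the eigenbasis: for a basis vector \<open>b\<close> with eigenvalue \<open>\<nu>\<close>, the
\<open>b\<close>-th coordinates of the components \<open>w\<^sub>1, \<dots>, w\<^sub>n\<close> form a scalar sequence, and the operators transform this
sequence by the Long--Moody matrices with \<open>\<nu>\<close> in place of \<open>g\<close> (\<open>LM_x_acts\<close>, \<open>LM_sigma_acts\<close>). So everything reduces
to scalar sequences of length \<open>n\<close>. There \<open>\<sigma>\<^sub>i\<close> is \<open>c\<close> times the Burau matrix with the block
\<open>(0 \<nu>; 1 1-\<nu>)\<close> in places \<open>i, i + 1\<close>, which satisfies \<open>(\<beta> - 1) (\<beta> + \<nu>) = 0\<close>.

The subspace \<open>K\<close> consists of all sequences at \<open>\<nu> = 1\<close> and of none but zero at \<open>\<nu> \<noteq> 1\<close>. As \<open>\<lambda> \<noteq> 1\<close>, a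
sequence is fixed by all \<open>x\<^sub>i\<close> if and only if it is geometric, \<open>y\<^sub>j = u \<nu>\<^bsup>n-j\<^esup>\<close>, with \<open>u = 0\<close> or \<open>\<lambda> \<nu>\<^sup>n = 1\<close> (\<open>lm_fixed_iff\<close>). Hence the
quotient by \<open>K + L\<close> loses all \<open>n\<close> dimensions at \<open>\<nu> = 1\<close>, and one dimension at every basis vector with
\<open>\<lambda> \<nu>\<^sup>n = 1\<close>; this gives the dimension formula (\<open>vdim_Q\<close>), and explicit coordinates on the quotient.

For a polynomial \<open>q = (T - c) r + q(c)\<close>, the quadratic relation shows that \<open>q(\<sigma>\<^sub>i)\<close> acts at \<open>\<nu>\<close> as
\<open>q(c) + r(-c\<nu>) (c\<beta> - c)\<close> (\<open>seq_op_poly\<close>). It vanishes on the quotient if and only if all images lie in \<open>K + L\<close>. The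
image of the \<open>i\<close>-th unit sequence is supported in \<open>{i, i + 1}\<close>, whereas a nonzero geometric sequence has no zero
entry. So for \<open>n \<ge> 3\<close> both \<open>q(c)\<close> and \<open>r(-c\<nu>)\<close> must vanish, which says that \<open>p\<^sub>\<nu> = (T - c) (T + c\<nu>)\<close> divides \<open>q\<close>. The
same holds for \<open>n = 2\<close> unless \<open>\<lambda> \<nu>\<^sup>2 = 1\<close>; then the quotient at \<open>b\<close> is a line on which \<open>\<sigma>\<^sub>1\<close> is \<open>-c\<nu>\<close>. The
criterion \<open>op_poly_Sop_eq_zero_iff\<close> collects this over all \<open>\<nu> \<in> E\<close>. It identifies the minimal polynomial as a
least common multiple; a quadratic relation holds if and only if the quadratic polynomial is divisible by all local
minimal polynomials; and the assertions on distinct roots are comparisons of monic polynomials of degree two.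

Three general facts connect this computation with the objects of the theorem. The Artin action and the
representations are given by their values on generators, so existence and uniqueness come from the universal
property of presented groups and of the semidirect product (\<open>artin_action\<close>, \<open>exists_unique_hom\<close>). Operators that
satisfy the braid and quadratic relations define a representation of the Hecke algebra because evaluation of
noncommutative polynomials kills its defining ideal (\<open>defines_hecke_rep\<close>). An operator that is annihilated by a
quadratic polynomial with two distinct roots is semisimple because its eigenvectors span (\<open>quadratic_semisimple\<close>).
\<close>

section \<open>Groups given by generators and relations\<close>

definition letter_val :: "('g, 'm) monoid_scheme \<Rightarrow> ('a \<Rightarrow> 'g) \<Rightarrow> 'a \<times> bool \<Rightarrow> 'g" where
  "letter_val G f l = (if snd l then f (fst l) else inv\<^bsub>G\<^esub> f (fst l))"

definition word_val :: "('g, 'm) monoid_scheme \<Rightarrow> ('a \<Rightarrow> 'g) \<Rightarrow> 'a gword \<Rightarrow> 'g" where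
  "word_val G f w = foldr (\<lambda>l g. letter_val G f l \<otimes>\<^bsub>G\<^esub> g) w \<one>\<^bsub>G\<^esub>"

text \<open>The value at a class is read off from an arbitrary representative; \<open>word_val_cong\<close> makes this
  independent of the choice as soon as \<open>f\<close> respects the relations.\<close>

definition presented_lift :: "('g, 'm) monoid_scheme \<Rightarrow> ('a \<Rightarrow> 'g) \<Rightarrow> 'a gword set \<Rightarrow> 'g" where
  "presented_lift G f A = word_val G f (SOME w. w \<in> A)"

definition inverse_word :: "'a gword \<Rightarrow> 'a gword" where
  "inverse_word w = rev (map (\<lambda>(x, s). (x, \<not> s)) w)"

locale presentation =
  fixes X :: "'a set" and R :: "('a gword \<times> 'a gword) set"
  assumes relators: "R \<subseteq> gwords X \<times> gwords X"
begin

abbreviation "P \<equiv> presented_group X R"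
abbreviation "gen \<equiv> group_gen X R"

definition word_class :: "'a gword \<Rightarrow> 'a gword set" where
  "word_class w = presentation_rel X R `` {w}"

lemma gwords_append [simp]: "u @ v \<in> gwords X \<longleftrightarrow> u \<in> gwords X \<and> v \<in> gwords X"
  by (auto simp: gwords_def)

lemma gwords_simps [simp]: "[] \<in> gwords X" "(x, s) # w \<in> gwords X \<longleftrightarrow> x \<in> X \<and> w \<in> gwords X"
  by (auto simp: gwords_def)

lemma inverse_word_in [simp]: "w \<in> gwords X \<Longrightarrow> inverse_word w \<in> gwords X"
  by (auto simp: gwords_def inverse_word_def)

lemma rel_gwords: "(u, v) \<in> presentation_rel X R \<Longrightarrow> u \<in> gwords X \<and> v \<in> gwords X"
  by (induction rule: presentation_rel.induct) (use relators in auto)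

lemma rel_context:
  assumes "(u, v) \<in> presentation_rel X R" "a \<in> gwords X" "b \<in> gwords X"
  shows "(a @ u @ b, a @ v @ b) \<in> presentation_rel X R"
  using assms
proof (induction rule: presentation_rel.induct)
  case (refl w)
  then show ?case by (intro presentation_rel.refl) auto
next
  case (sym v w)
  then show ?case by (blast intro: presentation_rel.sym)
next
  case (trans u v w)
  then show ?case by (blast intro: presentation_rel.trans)
next
  case (cancel u v x s)
  then show ?case using presentation_rel.cancel[where u = "a @ u" and v = "v @ b"] by simp
next
  case (relator u v r r')
  then show ?case using presentation_rel.relator[where u = "a @ u" and v = "v @ b"] by simp
qed

lemma equiv_rel: "equiv (gwords X) (presentation_rel X R)"
proof (rule equivI)
  show "presentation_rel X R \<subseteq> gwords X \<times> gwords X"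
    using rel_gwords by auto
  show "refl_on (gwords X) (presentation_rel X R)"
    by (auto intro: refl_onI presentation_rel.refl)
  show "sym_on UNIV (presentation_rel X R)"
    by (auto intro: symI presentation_rel.sym)
  show "trans_on UNIV (presentation_rel X R)"
    by (auto intro: transI presentation_rel.trans)
qed

lemma word_class_eq_iff:
  "u \<in> gwords X \<Longrightarrow> v \<in> gwords X \<Longrightarrow> word_class u = word_class v \<longleftrightarrow> (u, v) \<in> presentation_rel X R"
  unfolding word_class_def by (rule eq_equiv_class_iff[OF equiv_rel])

lemma word_class_self: "w \<in> gwords X \<Longrightarrow> w \<in> word_class w"
  by (auto simp: word_class_def intro: presentation_rel.refl)

lemma word_class_memD: "v \<in> word_class w \<Longrightarrow> v \<in> gwords X \<and> (w, v) \<in> presentation_rel X R"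
  using rel_gwords by (auto simp: word_class_def)

lemma carrier_P: "carrier P = word_class ` gwords X"
  by (auto simp: presented_group_def quotient_def word_class_def)

lemma word_class_in [simp]: "w \<in> gwords X \<Longrightarrow> word_class w \<in> carrier P"
  by (simp add: carrier_P)

lemma one_P: "\<one>\<^bsub>P\<^esub> = word_class []"
  by (simp add: presented_group_def word_class_def)

lemma gen_P: "gen x = word_class [(x, True)]"
  by (simp add: group_gen_def word_class_def)

lemma mult_P:
  assumes "u \<in> gwords X" "v \<in> gwords X"
  shows "word_class u \<otimes>\<^bsub>P\<^esub> word_class v = word_class (u @ v)"
proof -
  have "word_class (a @ b) = word_class (u @ v)"
    if "a \<in> word_class u" "b \<in> word_class v" for a b
  proof -
    have ab: "a \<in> gwords X" "b \<in> gwords X" "(u, a) \<in> presentation_rel X R" "(v, b) \<in> presentation_rel X R"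
      using that word_class_memD by auto
    have "(u @ v, a @ v) \<in> presentation_rel X R"
      using rel_context[OF ab(3), of "[]" v] assms by simp
    moreover have "(a @ v, a @ b) \<in> presentation_rel X R"
      using rel_context[OF ab(4), of a "[]"] ab by simp
    ultimately have "(u @ v, a @ b) \<in> presentation_rel X R"
      by (rule presentation_rel.trans)
    then show ?thesis
      using assms ab by (subst eq_commute) (simp add: word_class_eq_iff)
  qed
  then have "(\<Union>a\<in>word_class u. \<Union>b\<in>word_class v. word_class (a @ b)) = word_class (u @ v)"
    using word_class_self[OF assms(1)] word_class_self[OF assms(2)] by blast
  then show ?thesis
    by (simp add: presented_group_def word_class_def)
qed

text \<open>The last letter of the inverse word and the first letter of the word cancel in the middle, so the
  existence of inverses follows by induction on the length.\<close>

lemma word_cancel: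
  "w \<in> gwords X \<Longrightarrow> (inverse_word w @ w, []) \<in> presentation_rel X R"
proof (induction w)
  case Nil
  then show ?case by (simp add: inverse_word_def presentation_rel.refl)
next
  case (Cons l w)
  obtain x s where l: "l = (x, s)" by (cases l)
  with Cons.prems have w: "x \<in> X" "w \<in> gwords X" by auto
  have "(inverse_word w @ [(x, \<not> s), (x, \<not> \<not> s)] @ w, inverse_word w @ w) \<in> presentation_rel X R"
    using w by (intro presentation_rel.cancel) auto
  then have "(inverse_word (l # w) @ l # w, inverse_word w @ w) \<in> presentation_rel X R"
    by (simp add: l inverse_word_def)
  then show ?case
    using Cons.IH[OF w(2)] by (rule presentation_rel.trans)
qed

lemma group_P: "group P"
proof (rule groupI)
  show "\<one>\<^bsub>P\<^esub> \<in> carrier P"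
    by (simp add: one_P)
next
  fix x y assume "x \<in> carrier P" "y \<in> carrier P"
  then show "x \<otimes>\<^bsub>P\<^esub> y \<in> carrier P"
    by (auto simp: carrier_P mult_P)
next
  fix x y z assume "x \<in> carrier P" "y \<in> carrier P" "z \<in> carrier P"
  then show "x \<otimes>\<^bsub>P\<^esub> y \<otimes>\<^bsub>P\<^esub> z = x \<otimes>\<^bsub>P\<^esub> (y \<otimes>\<^bsub>P\<^esub> z)"
    by (auto simp: carrier_P mult_P)
next
  fix x assume "x \<in> carrier P"
  then show "\<one>\<^bsub>P\<^esub> \<otimes>\<^bsub>P\<^esub> x = x"
    by (auto simp: carrier_P mult_P one_P)
next
  fix x assume "x \<in> carrier P"
  then obtain w where w: "w \<in> gwords X" "x = word_class w"
    by (auto simp: carrier_P)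
  then have "word_class (inverse_word w) \<otimes>\<^bsub>P\<^esub> x = \<one>\<^bsub>P\<^esub>"
    using word_cancel[OF w(1)] by (simp add: mult_P one_P word_class_eq_iff)
  then show "\<exists>y\<in>carrier P. y \<otimes>\<^bsub>P\<^esub> x = \<one>\<^bsub>P\<^esub>"
    using w by (auto intro!: bexI[of _ "word_class (inverse_word w)"])
qed

sublocale P: group P
  by (rule group_P)

lemma gen_in [simp]: "x \<in> X \<Longrightarrow> gen x \<in> carrier P"
  by (simp add: gen_P)

lemma inv_gen_class: "x \<in> X \<Longrightarrow> inv\<^bsub>P\<^esub> gen x = word_class [(x, False)]"
  using word_cancel[of "[(x, True)]"]
  by (intro P.inv_equality) (auto simp: gen_P mult_P one_P word_class_eq_iff inverse_word_def)

text \<open>Words are built up from the left, one generator or inverse generator at a time. Through this rule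
  a statement about all of \<open>P\<close> is reduced to the generators.\<close>

lemma presented_induct [consumes 1, case_names one gen inv_gen]:
  assumes a: "a \<in> carrier P"
    and one: "Q \<one>\<^bsub>P\<^esub>"
    and gen: "\<And>x a. x \<in> X \<Longrightarrow> a \<in> carrier P \<Longrightarrow> Q a \<Longrightarrow> Q (gen x \<otimes>\<^bsub>P\<^esub> a)"
    and inv_gen: "\<And>x a. x \<in> X \<Longrightarrow> a \<in> carrier P \<Longrightarrow> Q a \<Longrightarrow> Q (inv\<^bsub>P\<^esub> gen x \<otimes>\<^bsub>P\<^esub> a)"
  shows "Q a"
proof -
  have "Q (word_class w)" if "w \<in> gwords X" for w
    using that
  proof (induction w)
    case Nil
    then show ?case using one by (simp add: one_P)
  next
    case (Cons l w)
    obtain x s where l: "l = (x, s)" by (cases l)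
    with Cons.prems have w: "x \<in> X" "w \<in> gwords X" by auto
    have "gen x \<otimes>\<^bsub>P\<^esub> word_class w = word_class ((x, True) # w)"
      using w by (simp add: gen_P mult_P)
    moreover have "inv\<^bsub>P\<^esub> gen x \<otimes>\<^bsub>P\<^esub> word_class w = word_class ((x, False) # w)"
      using w by (simp add: inv_gen_class mult_P)
    ultimately have "word_class (l # w) = (if s then gen x else inv\<^bsub>P\<^esub> gen x) \<otimes>\<^bsub>P\<^esub> word_class w"
      by (simp add: l)
    then show ?case
      using gen[of x "word_class w"] inv_gen[of x "word_class w"] w Cons.IH by (cases s) auto
  qed
  then show ?thesis
    using a by (auto simp: carrier_P)
qed

lemma hom_eqI:
  assumes "group G" "h \<in> hom P G" "h' \<in> hom P G" "\<And>x. x \<in> X \<Longrightarrow> h (gen x) = h' (gen x)"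
    and "a \<in> carrier P"
  shows "h a = h' a"
proof -
  interpret G: group G by fact
  interpret h: group_hom P G h using assms by unfold_locales
  interpret h': group_hom P G h' using assms by unfold_locales
  show ?thesis
    using assms(5) by (induction rule: presented_induct) (simp_all add: assms(4))
qed

end

locale presentation_map = presentation X R + G: group G
  for X :: "'a set" and R and G (structure) +
  fixes f :: "'a \<Rightarrow> 'g"
  assumes f_in: "x \<in> X \<Longrightarrow> f x \<in> carrier G"
    and f_rel: "(r, r') \<in> R \<Longrightarrow> word_val G f r = word_val G f r'"
begin

lemma letter_val_in [simp]: "fst l \<in> X \<Longrightarrow> letter_val G f l \<in> carrier G"
  by (auto simp: letter_val_def f_in)

lemma word_val_simps [simp]:
  "word_val G f [] = \<one>" "word_val G f (l # w) = letter_val G f l \<otimes> word_val G f w"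
  by (simp_all add: word_val_def)

lemma word_val_in [simp]: "w \<in> gwords X \<Longrightarrow> word_val G f w \<in> carrier G"
  by (induction w) auto

lemma word_val_append [simp]:
  "u \<in> gwords X \<Longrightarrow> v \<in> gwords X \<Longrightarrow> word_val G f (u @ v) = word_val G f u \<otimes> word_val G f v"
  by (induction u) (auto simp: G.m_assoc)

text \<open>It suffices to look at the elementary moves: a cancelling pair has value \<open>\<one>\<close>, and the two sides
  of a relator have equal values by assumption. This is the universal property of \<open>P\<close>.\<close>

lemma word_val_cong:
  "(u, v) \<in> presentation_rel X R \<Longrightarrow> word_val G f u = word_val G f v"
proof (induction rule: presentation_rel.induct)
  case (cancel u v x s)
  have "word_val G f ([(x, s), (x, \<not> s)] @ v) = word_val G f v"
    using cancel by (cases s) (simp_all add: letter_val_def f_in flip: G.m_assoc)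
  then show ?case
    using cancel by simp
next
  case (relator u v r r')
  then show ?case using relators f_rel by auto
qed auto

lemma lift_word_class: "w \<in> gwords X \<Longrightarrow> presented_lift G f (word_class w) = word_val G f w"
proof -
  assume w: "w \<in> gwords X"
  have "(SOME v. v \<in> word_class w) \<in> word_class w"
    using word_class_self[OF w] by (rule someI)
  then show ?thesis
    unfolding presented_lift_def using word_class_memD word_val_cong by metis
qed

lemma lift_gen [simp]: "x \<in> X \<Longrightarrow> presented_lift G f (gen x) = f x"
  using f_in by (simp add: gen_P lift_word_class letter_val_def)

lemma lift_hom: "presented_lift G f \<in> hom P G"
  by (auto simp: hom_def carrier_P mult_P lift_word_class)

end

section \<open>The Artin action and representations of the semidirect product\<close>

lemma (in group) cancel_left:
  assumes "a \<in> carrier G" "b \<in> carrier G"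
  shows "inv a \<otimes> (a \<otimes> b) = b" "a \<otimes> (inv a \<otimes> b) = b"
  using assms by (simp_all flip: m_assoc)

interpretation F: presentation "{1..n::nat}" "{}"
  rewrites "presented_group {1..n} {} = free_group n" and "group_gen {1..n} {} = free_gen n" for n
  by unfold_locales (simp_all add: free_group_def free_gen_def)

lemma braid_relations_gwords: "braid_relations n \<subseteq> gwords {1..<n} \<times> gwords {1..<n}"
  by (auto simp: braid_relations_def gwords_def)

interpretation B: presentation "{1..<n::nat}" "braid_relations n"
  rewrites "presented_group {1..<n} (braid_relations n) = braid_group n"
    and "group_gen {1..<n} (braid_relations n) = braid_gen n" for n
  by unfold_locales (use braid_relations_gwords in \<open>simp_all add: braid_group_def braid_gen_def\<close>)

lemma free_presentation_map:
  fixes G (structure)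
  assumes "group G" "f \<in> {1..n} \<rightarrow> carrier G"
  shows "presented_lift G f \<in> hom (free_group n) G"
    and "j \<in> {1..n} \<Longrightarrow> presented_lift G f (free_gen n j) = f j"
proof -
  interpret G: group G by fact
  interpret presentation_map "{1..n}" "{}" G f
    using assms by unfold_locales auto
  show "presented_lift G f \<in> hom (free_group n) G"
    using lift_hom by (simp add: free_group_def)
  show "j \<in> {1..n} \<Longrightarrow> presented_lift G f (free_gen n j) = f j"
    using lift_gen[of j] by (simp add: free_gen_def)
qed

lemma braid_presentation_map:
  fixes G (structure)
  assumes "group G" "s \<in> {1..<n} \<rightarrow> carrier G"
    and far: "\<And>i j. i \<in> {1..<n} \<Longrightarrow> j \<in> {1..<n} \<Longrightarrow> i + 2 \<le> j \<Longrightarrow> s i \<otimes> s j = s j \<otimes> s i"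
    and near: "\<And>i. i \<in> {1..<n} \<Longrightarrow> i + 1 \<in> {1..<n} \<Longrightarrow>
      s i \<otimes> s (i + 1) \<otimes> s i = s (i + 1) \<otimes> s i \<otimes> s (i + 1)"
  shows "presented_lift G s \<in> hom (braid_group n) G"
    and "i \<in> {1..<n} \<Longrightarrow> presented_lift G s (braid_gen n i) = s i"
proof -
  interpret G: group G by fact
  have s_in: "s i \<in> carrier G" if "Suc 0 \<le> i" "i < n" for i
    using assms(2) that by auto
  interpret presentation_map "{1..<n}" "braid_relations n" G s
  proof unfold_locales
    show "word_val G s r = word_val G s r'" if "(r, r') \<in> braid_relations n" for r r'
      using that far near
      by (auto simp: braid_relations_def word_val_def letter_val_def s_in simp flip: G.m_assoc)
  qed (use assms in auto)
  show "presented_lift G s \<in> hom (braid_group n) G"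
    using lift_hom by (simp add: braid_group_def)
  show "i \<in> {1..<n} \<Longrightarrow> presented_lift G s (braid_gen n i) = s i"
    using lift_gen[of i] by (simp add: braid_gen_def)
qed

text \<open>Restricted to the carrier, because automorphism groups consist of extensional functions.\<close>

definition free_endo :: "nat \<Rightarrow> (nat \<Rightarrow> nat gword set) \<Rightarrow> nat gword set \<Rightarrow> nat gword set" where
  "free_endo n f = restrict (presented_lift (free_group n) f) (carrier (free_group n))"

lemma free_endo:
  assumes "f \<in> {1..n} \<rightarrow> carrier (free_group n)"
  shows "free_endo n f \<in> hom (free_group n) (free_group n)"
    and "j \<in> {1..n} \<Longrightarrow> free_endo n f (free_gen n j) = f j"
    and "free_endo n f \<in> extensional (carrier (free_group n))"
proof -
  note lift = free_presentation_map[OF F.group_P assms]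
  show "free_endo n f \<in> hom (free_group n) (free_group n)"
    using lift(1) by (auto simp: free_endo_def hom_def Pi_iff)
  show "j \<in> {1..n} \<Longrightarrow> free_endo n f (free_gen n j) = f j"
    using lift(2)[of j] by (simp add: free_endo_def)
  show "free_endo n f \<in> extensional (carrier (free_group n))"
    by (simp add: free_endo_def)
qed

definition artin_image :: "nat \<Rightarrow> nat \<Rightarrow> nat \<Rightarrow> nat gword set" where
  "artin_image n i j =
    (if j = i then free_gen n (i + 1)
     else if j = i + 1 then inv\<^bsub>free_group n\<^esub> (free_gen n (i + 1)) \<otimes>\<^bsub>free_group n\<^esub> free_gen n i
            \<otimes>\<^bsub>free_group n\<^esub> free_gen n (i + 1)
     else free_gen n j)"

text \<open>The images of the generators under the inverse of the \<open>i\<close>-th braid generator.\<close>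

definition artin_inverse_image :: "nat \<Rightarrow> nat \<Rightarrow> nat \<Rightarrow> nat gword set" where
  "artin_inverse_image n i j =
    (if j = i then free_gen n i \<otimes>\<^bsub>free_group n\<^esub> free_gen n (i + 1)
            \<otimes>\<^bsub>free_group n\<^esub> inv\<^bsub>free_group n\<^esub> (free_gen n i)
     else if j = i + 1 then free_gen n i
     else free_gen n j)"

abbreviation artin_gen :: "nat \<Rightarrow> nat \<Rightarrow> nat gword set \<Rightarrow> nat gword set" where
  "artin_gen n i \<equiv> free_endo n (artin_image n i)"

context
  fixes n :: nat
begin

private abbreviation "F \<equiv> free_group n"
private abbreviation "x \<equiv> free_gen n"

lemma artin_image_in: "i \<in> {1..<n} \<Longrightarrow> artin_image n i \<in> {1..n} \<rightarrow> carrier F"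
  by (auto simp: artin_image_def)

lemma artin_inverse_image_in:
  "i \<in> {1..<n} \<Longrightarrow> artin_inverse_image n i \<in> {1..n} \<rightarrow> carrier F"
  by (auto simp: artin_inverse_image_def)

text \<open>The endomorphism given by \<open>artin_inverse_image\<close> is a two-sided inverse, since both composites fix
  the free generators.\<close>

lemma artin_gen_in_auto:
  assumes i: "i \<in> {1..<n}"
  shows "artin_gen n i \<in> auto F"
proof -
  note f = free_endo[where f = "artin_image n i", OF artin_image_in[OF i]]
  let ?h = "free_endo n (artin_inverse_image n i)"
  note h = free_endo[where f = "artin_inverse_image n i", OF artin_inverse_image_in[OF i]]
  interpret f: group_hom F F "artin_gen n i" using f by unfold_locales
  interpret h: group_hom F F ?h using h by unfold_locales
  have "?h (artin_gen n i (x j)) = x j" "artin_gen n i (?h (x j)) = x j" if "j \<in> {1..n}" for j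
    using that i
    by (cases "j = i"; cases "j = i + 1";
        simp add: f(2) h(2) artin_image_def artin_inverse_image_def F.P.m_assoc F.P.cancel_left)+
  moreover have "(\<lambda>a. ?h (artin_gen n i a)) \<in> hom F F" "(\<lambda>a. artin_gen n i (?h a)) \<in> hom F F"
    "(\<lambda>a. a) \<in> hom F F"
    by (auto simp: hom_def)
  ultimately have "?h (artin_gen n i a) = a" "artin_gen n i (?h a) = a" if "a \<in> carrier F" for a
    using that F.hom_eqI[where G = F and h' = "\<lambda>a. a" and a = a] F.group_P[of n] by (metis, metis)
  then have "bij_betw (artin_gen n i) (carrier F) (carrier F)"
    by (intro bij_betwI[where g = ?h]) auto
  then show ?thesis
    using f by (simp add: auto_def Bij_def)
qed

lemma auto_eqI:
  assumes "\<phi> \<in> auto F" "\<psi> \<in> auto F" "\<And>j. j \<in> {1..n} \<Longrightarrow> \<phi> (x j) = \<psi> (x j)"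
  shows "\<phi> = \<psi>"
proof (rule extensionalityI)
  show "\<phi> \<in> extensional (carrier F)" "\<psi> \<in> extensional (carrier F)"
    using assms by (auto simp: auto_def Bij_def)
  show "\<phi> a = \<psi> a" if "a \<in> carrier F" for a
    by (rule F.hom_eqI[where n = n, OF F.group_P[of n] _ _ _ that]) (use assms in \<open>simp_all add: auto_def\<close>)
qed

lemma AutoGroup_simps [simp]:
  "carrier (AutoGroup F) = auto F"
  "\<phi> \<in> auto F \<Longrightarrow> \<psi> \<in> auto F \<Longrightarrow> \<phi> \<otimes>\<^bsub>AutoGroup F\<^esub> \<psi> = compose (carrier F) \<phi> \<psi>"
  "\<one>\<^bsub>AutoGroup F\<^esub> = (\<lambda>a\<in>carrier F. a)"
  by (simp_all add: AutoGroup_def BijGroup_def auto_def)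

lemma auto_closed: "\<phi> \<in> auto F \<Longrightarrow> a \<in> carrier F \<Longrightarrow> \<phi> a \<in> carrier F"
  by (auto simp: auto_def hom_def)

lemma auto_group_hom: "\<phi> \<in> auto F \<Longrightarrow> group_hom F F \<phi>"
  by unfold_locales (simp add: auto_def)

lemma auto_mult: "\<phi> \<in> auto F \<Longrightarrow> \<psi> \<in> auto F \<Longrightarrow> compose (carrier F) \<phi> \<psi> \<in> auto F"
  using group.AutoGroup[OF F.group_P, of n, THEN group.is_monoid, THEN monoid.m_closed, of \<phi> \<psi>] by simp

text \<open>Automorphisms of a free group are equal if they agree on the free generators, and a braid
  generator moves only two of these; so the braid relations amount to a finite case distinction.\<close>

lemma artin_gen_braid_far:
  assumes ij: "i \<in> {1..<n}" "j \<in> {1..<n}" "i + 2 \<le> j"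
  shows "artin_gen n i \<otimes>\<^bsub>AutoGroup F\<^esub> artin_gen n j = artin_gen n j \<otimes>\<^bsub>AutoGroup F\<^esub> artin_gen n i"
proof -
  note a = artin_gen_in_auto[OF ij(1)] artin_gen_in_auto[OF ij(2)]
  interpret i: group_hom F F "artin_gen n i" using a by (rule_tac auto_group_hom)
  interpret j: group_hom F F "artin_gen n j" using a by (rule_tac auto_group_hom)
  note v = free_endo(2)[where f = "artin_image n i", OF artin_image_in[OF ij(1)]]
    free_endo(2)[where f = "artin_image n j", OF artin_image_in[OF ij(2)]]
  have "compose (carrier F) (artin_gen n i) (artin_gen n j) = compose (carrier F) (artin_gen n j) (artin_gen n i)"
    using a
  proof (intro auto_eqI auto_mult)
    show "compose (carrier F) (artin_gen n i) (artin_gen n j) (x k) =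
      compose (carrier F) (artin_gen n j) (artin_gen n i) (x k)" if "k \<in> {1..n}" for k
      using that ij
      by (cases "k = i"; cases "k = i + 1"; cases "k = j"; cases "k = j + 1"; simp add: compose_def v artin_image_def)
  qed
  then show ?thesis
    using a by simp
qed

lemma artin_gen_braid_near:
  assumes i: "i \<in> {1..<n}" "i + 1 \<in> {1..<n}"
  shows "artin_gen n i \<otimes>\<^bsub>AutoGroup F\<^esub> artin_gen n (i + 1) \<otimes>\<^bsub>AutoGroup F\<^esub> artin_gen n i =
    artin_gen n (i + 1) \<otimes>\<^bsub>AutoGroup F\<^esub> artin_gen n i \<otimes>\<^bsub>AutoGroup F\<^esub> artin_gen n (i + 1)"
proof -
  let ?f = "artin_gen n i" and ?g = "artin_gen n (i + 1)"
  note a = artin_gen_in_auto[OF i(1)] artin_gen_in_auto[OF i(2)]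
  interpret i: group_hom F F ?f using a by (rule_tac auto_group_hom)
  interpret j: group_hom F F "artin_gen n (Suc i)" using a by (rule_tac auto_group_hom) simp
  note v = free_endo(2)[where f = "artin_image n i", OF artin_image_in[OF i(1)]]
    free_endo(2)[where f = "artin_image n (i + 1)", OF artin_image_in[OF i(2)], unfolded Suc_eq_plus1[symmetric]]
  have "compose (carrier F) (compose (carrier F) ?f ?g) ?f = compose (carrier F) (compose (carrier F) ?g ?f) ?g"
    using a
  proof (intro auto_eqI auto_mult)
    show "compose (carrier F) (compose (carrier F) ?f ?g) ?f (x k) =
      compose (carrier F) (compose (carrier F) ?g ?f) ?g (x k)" if "k \<in> {1..n}" for k
      using that i
      by (cases "k = i"; cases "k = i + 1"; cases "k = i + 2";
        simp add: compose_def v artin_image_def F.P.m_assoc F.P.inv_mult_group F.P.cancel_left)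
  qed
  then show ?thesis
    using a by (simp add: auto_mult)
qed

text \<open>\<open>artin_action n\<close> is defined by a description, so it has to be shown that exactly one homomorphism
  answers it. Existence is the compatibility of the automorphisms with the braid relations;
  uniqueness holds because both groups are generated by the given generators.\<close>

lemma artin_action:
  shows "artin_action n \<in> hom (braid_group n) (AutoGroup F)"
    and "i \<in> {1..<n} \<Longrightarrow> artin_action n (braid_gen n i) = artin_gen n i"
proof -
  define Q where "Q = (\<lambda>\<theta>. \<theta> \<in> hom (braid_group n) (AutoGroup F) \<inter> extensional (carrier (braid_group n)) \<and>
     (\<forall>i\<in>{1..<n}.
        \<theta> (braid_gen n i) (x i) = x (i + 1) \<and>
        \<theta> (braid_gen n i) (x (i + 1)) = inv\<^bsub>F\<^esub> (x (i + 1)) \<otimes>\<^bsub>F\<^esub> x i \<otimes>\<^bsub>F\<^esub> x (i + 1) \<and>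
        (\<forall>j\<in>{1..n} - {i, i + 1}. \<theta> (braid_gen n i) (x j) = x j)))"
  have Q_gen: "\<theta> (braid_gen n i) = artin_gen n i" if "Q \<theta>" "i \<in> {1..<n}" for \<theta> i
  proof (rule auto_eqI)
    show "\<theta> (braid_gen n i) \<in> auto F"
      using that by (auto simp: Q_def hom_def)
    show "artin_gen n i \<in> auto F"
      using that by (intro artin_gen_in_auto)
    show "\<theta> (braid_gen n i) (x j) = artin_gen n i (x j)" if "j \<in> {1..n}" for j
      using that \<open>Q \<theta>\<close> \<open>i \<in> {1..<n}\<close>
      by (cases "j = i"; cases "j = i + 1"; simp add: Q_def free_endo(2)[OF artin_image_in] artin_image_def)
  qed
  have group: "group (AutoGroup F)"
    by (rule group.AutoGroup[OF F.group_P])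
  have uniq: "\<theta> = \<theta>'" if "Q \<theta>" "Q \<theta>'" for \<theta> \<theta>'
  proof (rule extensionalityI)
    show "\<theta> \<in> extensional (carrier (braid_group n))" "\<theta>' \<in> extensional (carrier (braid_group n))"
      using that by (auto simp: Q_def)
    show "\<theta> h = \<theta>' h" if "h \<in> carrier (braid_group n)" for h
      by (rule B.hom_eqI[where n = n, OF group _ _ _ that])
        (use Q_gen[OF \<open>Q \<theta>\<close>] Q_gen[OF \<open>Q \<theta>'\<close>] \<open>Q \<theta>\<close> \<open>Q \<theta>'\<close> in \<open>simp_all add: Q_def\<close>)
  qed
  define \<theta> where "\<theta> = restrict (presented_lift (AutoGroup F) (artin_gen n)) (carrier (braid_group n))"
  have lift: "presented_lift (AutoGroup F) (artin_gen n) \<in> hom (braid_group n) (AutoGroup F)"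
    "i \<in> {1..<n} \<Longrightarrow> presented_lift (AutoGroup F) (artin_gen n) (braid_gen n i) = artin_gen n i" for i
    using artin_gen_in_auto
    by (intro braid_presentation_map[OF group] artin_gen_braid_far artin_gen_braid_near; simp)+
  have "\<theta> \<in> hom (braid_group n) (AutoGroup F) \<inter> extensional (carrier (braid_group n))"
    using lift(1) by (auto simp: \<theta>_def hom_def Pi_iff)
  moreover have "\<theta> (braid_gen n i) = artin_gen n i" if "i \<in> {1..<n}" for i
    using lift(2)[OF that] that by (simp add: \<theta>_def)
  ultimately have "Q \<theta>"
    by (simp add: Q_def free_endo(2)[OF artin_image_in] artin_image_def)
  then have "(THE \<theta>. Q \<theta>) = \<theta>"
    by (intro the_equality[where P = Q] uniq)
  then have "artin_action n = \<theta>"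
    by (simp only: artin_action_def Q_def)
  with \<open>Q \<theta>\<close> have Q: "Q (artin_action n)"
    by (simp only:)
  then show "artin_action n \<in> hom (braid_group n) (AutoGroup F)"
    unfolding Q_def by blast
  show "artin_action n (braid_gen n i) = artin_gen n i" if "i \<in> {1..<n}"
    by (rule Q_gen[OF Q that])
qed

end

text \<open>Images of the generators of \<open>F\<^sub>n \<rtimes> B\<^sub>n\<close> that satisfy its defining relations. The relation
  \<open>\<sigma>\<^sub>i x\<^bsub>i+1\<^esub> \<sigma>\<^sub>i\<inverse> = x\<^bsub>i+1\<^esub>\<inverse> x\<^sub>i x\<^bsub>i+1\<^esub>\<close> is cleared of inverses in \<open>act_second\<close>, so that it
  can be verified for operators without inverting them.\<close>

locale FB_images = G: group G
  for G :: "('g, 'm) monoid_scheme" (structure) and n :: nat and X S :: "nat \<Rightarrow> 'g" +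
  assumes X_in: "X \<in> {1..n} \<rightarrow> carrier G"
    and S_in: "S \<in> {1..<n} \<rightarrow> carrier G"
    and braid_far: "i \<in> {1..<n} \<Longrightarrow> j \<in> {1..<n} \<Longrightarrow> i + 2 \<le> j \<Longrightarrow> S i \<otimes> S j = S j \<otimes> S i"
    and braid_near: "i \<in> {1..<n} \<Longrightarrow> i + 1 \<in> {1..<n} \<Longrightarrow>
      S i \<otimes> S (i + 1) \<otimes> S i = S (i + 1) \<otimes> S i \<otimes> S (i + 1)"
    and act_first: "i \<in> {1..<n} \<Longrightarrow> S i \<otimes> X i = X (i + 1) \<otimes> S i"
    and act_second: "i \<in> {1..<n} \<Longrightarrow> X (i + 1) \<otimes> (S i \<otimes> X (i + 1)) = X i \<otimes> (X (i + 1) \<otimes> S i)"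
    and act_other: "i \<in> {1..<n} \<Longrightarrow> j \<in> {1..n} - {i, i + 1} \<Longrightarrow> S i \<otimes> X j = X j \<otimes> S i"
begin

definition "LX = presented_lift G X"
definition "LS = presented_lift G S"

lemma X_closed: "j \<in> {1..n} \<Longrightarrow> X j \<in> carrier G"
  using X_in by auto

lemma S_closed: "i \<in> {1..<n} \<Longrightarrow> S i \<in> carrier G"
  using S_in by auto

lemma LX: "LX \<in> hom (free_group n) G" "j \<in> {1..n} \<Longrightarrow> LX (free_gen n j) = X j"
  unfolding LX_def by (rule free_presentation_map[OF G.is_group X_in], assumption?)+

lemma LS: "LS \<in> hom (braid_group n) G" "i \<in> {1..<n} \<Longrightarrow> LS (braid_gen n i) = S i"
  unfolding LS_def
  by (rule braid_presentation_map[OF G.is_group S_in braid_far braid_near], assumption+)+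

interpretation LX: group_hom "free_group n" G LX
  using LX by unfold_locales

interpretation LS: group_hom "braid_group n" G LS
  using LS by unfold_locales

abbreviation (input) "\<theta> \<equiv> artin_action n"

lemma theta_auto: "h \<in> carrier (braid_group n) \<Longrightarrow> \<theta> h \<in> auto (free_group n)"
  using artin_action(1)[of n] by (auto simp: hom_def)

lemma theta_closed:
  "h \<in> carrier (braid_group n) \<Longrightarrow> a \<in> carrier (free_group n) \<Longrightarrow> \<theta> h a \<in> carrier (free_group n)"
  using auto_closed theta_auto by blast

lemma theta_mult:
  assumes "h \<in> carrier (braid_group n)" "k \<in> carrier (braid_group n)" "a \<in> carrier (free_group n)"
  shows "\<theta> (h \<otimes>\<^bsub>braid_group n\<^esub> k) a = \<theta> h (\<theta> k a)"
  using hom_mult[OF artin_action(1)[of n] assms(1,2)] assms theta_auto by (simp add: compose_def)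

lemma theta_one:
  assumes "a \<in> carrier (free_group n)"
  shows "\<theta> \<one>\<^bsub>braid_group n\<^esub> a = a"
proof -
  have "\<theta> \<one>\<^bsub>braid_group n\<^esub> = \<one>\<^bsub>AutoGroup (free_group n)\<^esub>"
    by (rule hom_one[OF artin_action(1) B.group_P group.AutoGroup[OF F.group_P]])
  then show ?thesis
    using assms by simp
qed

text \<open>The homomorphisms \<open>a \<mapsto> LX (\<theta> \<sigma>\<^sub>i a)\<close> and \<open>a \<mapsto> S i \<otimes> LX a \<otimes> inv (S i)\<close> agree on the free
  generators by the three relations \<open>act_first\<close>, \<open>act_second\<close>, \<open>act_other\<close>; the induction carries this over
  to products.\<close>

lemma twist_gen:
  assumes i: "i \<in> {1..<n}" and a: "a \<in> carrier (free_group n)"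
  shows "LX (\<theta> (braid_gen n i) a) \<otimes> S i = S i \<otimes> LX a"
proof -
  note S = S_closed[OF i]
  interpret t: group_hom "free_group n" "free_group n" "\<theta> (braid_gen n i)"
    using theta_auto[of "braid_gen n i"] i by (intro auto_group_hom) simp
  have gen: "LX (\<theta> (braid_gen n i) (free_gen n j)) \<otimes> S i = S i \<otimes> X j" if j: "j \<in> {1..n}" for j
  proof -
    have v: "\<theta> (braid_gen n i) (free_gen n j) = artin_image n i j"
      using free_endo(2)[OF artin_image_in[OF i] j] artin_action(2)[OF i] by simp
    consider "j = i" | "j = i + 1" | "j \<noteq> i" "j \<noteq> i + 1" by blast
    then show ?thesis
    proof cases
      case 1
      then show ?thesis
        unfolding v using i act_first[OF i] by (simp add: artin_image_def LX(2))
    next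
      case 2
      have "X i \<in> carrier G" "X (i + 1) \<in> carrier G"
        using i X_closed by auto
      then show ?thesis
        unfolding v using 2 i act_second[OF i] S j
        by (simp add: artin_image_def LX(2) G.m_assoc G.inv_solve_left')
    next
      case 3
      then show ?thesis
        unfolding v using i j act_other[OF i] by (simp add: artin_image_def LX(2))
    qed
  qed
  show ?thesis
    using a
  proof (induction rule: F.presented_induct)
    case one
    then show ?case using S by simp
  next
    case (gen j a)
    note X = X_closed[OF gen(1)]
    have "LX (\<theta> (braid_gen n i) (free_gen n j \<otimes>\<^bsub>free_group n\<^esub> a)) \<otimes> S i =
      LX (\<theta> (braid_gen n i) (free_gen n j)) \<otimes> (S i \<otimes> LX a)"
      using gen S by (simp add: G.m_assoc)
    also have "\<dots> = S i \<otimes> X j \<otimes> LX a"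
      using gen S X \<open>\<And>j. j \<in> {1..n} \<Longrightarrow> LX (\<theta> (braid_gen n i) (free_gen n j)) \<otimes> S i = S i \<otimes> X j\<close>[OF gen(1)]
      by (simp flip: G.m_assoc)
    finally show ?case
      using gen S X by (simp add: LX(2) G.m_assoc)
  next
    case (inv_gen j a)
    let ?y = "LX (\<theta> (braid_gen n i) (free_gen n j))"
    note X = X_closed[OF inv_gen(1)]
    have y: "?y \<in> carrier G" "?y \<otimes> S i = S i \<otimes> X j"
      using inv_gen(1) gen by simp_all
    then have "S i = inv ?y \<otimes> (S i \<otimes> X j)"
      using S X by (simp add: G.inv_solve_left)
    then have inv: "inv ?y \<otimes> S i = S i \<otimes> inv X j"
      using S X y by (metis G.inv_closed G.inv_solve_right G.m_assoc G.m_closed)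
    have "LX (\<theta> (braid_gen n i) (inv\<^bsub>free_group n\<^esub> free_gen n j \<otimes>\<^bsub>free_group n\<^esub> a)) \<otimes> S i =
      inv ?y \<otimes> (S i \<otimes> LX a)"
      using inv_gen S by (simp add: G.m_assoc)
    also have "\<dots> = S i \<otimes> inv X j \<otimes> LX a"
      using inv_gen S X y inv by (simp flip: G.m_assoc)
    finally show ?case
      using inv_gen S X by (simp add: LX(2) G.m_assoc)
  qed
qed

text \<open>Both \<open>\<theta>\<close> and conjugation by \<open>LS h\<close> are multiplicative in \<open>h\<close>, so the case of a braid
  generator decides.\<close>

lemma twist:
  assumes h: "h \<in> carrier (braid_group n)" and a: "a \<in> carrier (free_group n)"
  shows "LX (\<theta> h a) \<otimes> LS h = LS h \<otimes> LX a"
  using h a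
proof (induction arbitrary: a rule: B.presented_induct)
  case one
  then show ?case by (simp add: theta_one)
next
  case (gen i h)
  note S = S_closed[OF gen(1)]
  have "LX (\<theta> (braid_gen n i) (\<theta> h a)) \<otimes> (S i \<otimes> LS h) = S i \<otimes> LX (\<theta> h a) \<otimes> LS h"
    using twist_gen[OF gen(1) theta_closed[OF gen(2,4)]] gen S
    by (simp add: theta_closed flip: G.m_assoc)
  then have "LX (\<theta> (braid_gen n i) (\<theta> h a)) \<otimes> (S i \<otimes> LS h) = S i \<otimes> (LX (\<theta> h a) \<otimes> LS h)"
    using gen S by (simp add: theta_closed G.m_assoc)
  then show ?case
    using gen S by (simp add: theta_mult LS(2) G.m_assoc)
next
  case (inv_gen i h)
  note S = S_closed[OF inv_gen(1)]
  let ?s = "braid_gen n i"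
  define b where "b = \<theta> (inv\<^bsub>braid_group n\<^esub> ?s) (\<theta> h a)"
  have s: "?s \<in> carrier (braid_group n)"
    using inv_gen by simp
  have b: "b \<in> carrier (free_group n)"
    unfolding b_def using inv_gen s by (intro theta_closed) auto
  have "\<theta> ?s b = \<theta> h a"
    using inv_gen s unfolding b_def
    by (subst theta_mult[symmetric]) (simp_all add: theta_closed theta_one)
  then have "LX (\<theta> h a) \<otimes> S i = S i \<otimes> LX b"
    using twist_gen[OF inv_gen(1) b] by simp
  then have "LX b = inv S i \<otimes> (LX (\<theta> h a) \<otimes> S i)"
    using S b inv_gen by (simp add: G.inv_solve_left theta_closed)
  then have "LX b \<otimes> (inv S i \<otimes> LS h) = inv S i \<otimes> (LX (\<theta> h a) \<otimes> LS h)"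
    using S b inv_gen by (simp add: theta_closed G.m_assoc G.cancel_left)
  then show ?case
    using inv_gen S s by (simp add: theta_mult LS(2) G.m_assoc flip: b_def)
qed

text \<open>The value on \<open>(a, h)\<close> has to be the product of the values on \<open>a\<close> and on \<open>h\<close>. This is
  multiplicative because conjugation by the image of \<open>h\<close> realises \<open>\<theta> h\<close>, which is inherited from the
  generators.\<close>

lemma exists_unique_hom:
  "\<exists>!\<rho>. \<rho> \<in> hom (FB n) G \<inter> extensional (carrier (FB n)) \<and>
     (\<forall>j\<in>{1..n}. \<rho> (fb_x n j) = X j) \<and> (\<forall>i\<in>{1..<n}. \<rho> (fb_sigma n i) = S i)"
proof (rule ex1I)
  let ?\<rho> = "\<lambda>p\<in>carrier (FB n). LX (fst p) \<otimes> LS (snd p)"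
  have FB: "carrier (FB n) = carrier (free_group n) \<times> carrier (braid_group n)"
    "(a, h) \<otimes>\<^bsub>FB n\<^esub> (b, k) = (a \<otimes>\<^bsub>free_group n\<^esub> \<theta> h b, h \<otimes>\<^bsub>braid_group n\<^esub> k)" for a b h k
    by (simp_all add: FB_def semidirect_product_def)
  have "?\<rho> \<in> hom (FB n) G"
  proof (rule homI)
    show "?\<rho> p \<in> carrier G" if "p \<in> carrier (FB n)" for p
      using that by (auto simp: FB)
  next
    fix p q assume pq: "p \<in> carrier (FB n)" "q \<in> carrier (FB n)"
    obtain a h b k where p: "p = (a, h)" and q: "q = (b, k)" by (cases p, cases q)
    have c: "a \<in> carrier (free_group n)" "h \<in> carrier (braid_group n)"
      "b \<in> carrier (free_group n)" "k \<in> carrier (braid_group n)"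
      using pq by (auto simp: FB p q)
    have "LX a \<otimes> (LX (\<theta> h b) \<otimes> LS h) \<otimes> LS k = LX a \<otimes> (LS h \<otimes> LX b) \<otimes> LS k"
      by (simp add: twist c)
    then show "?\<rho> (p \<otimes>\<^bsub>FB n\<^esub> q) = ?\<rho> p \<otimes> ?\<rho> q"
      using c by (simp add: FB p q theta_closed G.m_assoc)
  qed
  then show "?\<rho> \<in> hom (FB n) G \<inter> extensional (carrier (FB n)) \<and>
     (\<forall>j\<in>{1..n}. ?\<rho> (fb_x n j) = X j) \<and> (\<forall>i\<in>{1..<n}. ?\<rho> (fb_sigma n i) = S i)"
    by (simp add: fb_x_def fb_sigma_def FB LX(2) LS(2) X_closed S_closed)
next
  let ?\<rho> = "\<lambda>p\<in>carrier (FB n). LX (fst p) \<otimes> LS (snd p)"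
  fix \<rho>
  assume \<rho>: "\<rho> \<in> hom (FB n) G \<inter> extensional (carrier (FB n)) \<and>
     (\<forall>j\<in>{1..n}. \<rho> (fb_x n j) = X j) \<and> (\<forall>i\<in>{1..<n}. \<rho> (fb_sigma n i) = S i)"
  have FB: "carrier (FB n) = carrier (free_group n) \<times> carrier (braid_group n)"
    "(a, h) \<otimes>\<^bsub>FB n\<^esub> (b, k) = (a \<otimes>\<^bsub>free_group n\<^esub> \<theta> h b, h \<otimes>\<^bsub>braid_group n\<^esub> k)" for a b h k
    by (simp_all add: FB_def semidirect_product_def)
  let ?e = "\<one>\<^bsub>free_group n\<^esub>" and ?e' = "\<one>\<^bsub>braid_group n\<^esub>"
  have theta_e: "\<theta> h ?e = ?e" if "h \<in> carrier (braid_group n)" for h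
    using group_hom.hom_one[OF auto_group_hom[OF theta_auto[OF that]]] .
  have "(\<lambda>a. \<rho> (a, ?e')) \<in> hom (free_group n) G"
  proof (rule homI)
    fix a b assume ab: "a \<in> carrier (free_group n)" "b \<in> carrier (free_group n)"
    then have "(a \<otimes>\<^bsub>free_group n\<^esub> b, ?e') = (a, ?e') \<otimes>\<^bsub>FB n\<^esub> (b, ?e')"
      by (simp add: FB theta_one)
    then show "\<rho> (a \<otimes>\<^bsub>free_group n\<^esub> b, ?e') = \<rho> (a, ?e') \<otimes> \<rho> (b, ?e')"
      using \<rho> ab by (simp add: hom_mult FB(1))
  qed (use \<rho> in \<open>auto simp: hom_def FB(1)\<close>)
  then have x: "\<rho> (a, ?e') = LX a" if "a \<in> carrier (free_group n)" for a
    by (rule F.hom_eqI[OF G.is_group _ LX(1) _ that]) (use \<rho> in \<open>simp add: LX(2) flip: fb_x_def\<close>)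
  have "(\<lambda>h. \<rho> (?e, h)) \<in> hom (braid_group n) G"
  proof (rule homI)
    fix a b assume ab: "a \<in> carrier (braid_group n)" "b \<in> carrier (braid_group n)"
    then have "(?e, a \<otimes>\<^bsub>braid_group n\<^esub> b) = (?e, a) \<otimes>\<^bsub>FB n\<^esub> (?e, b)"
      by (simp add: FB theta_e)
    then show "\<rho> (?e, a \<otimes>\<^bsub>braid_group n\<^esub> b) = \<rho> (?e, a) \<otimes> \<rho> (?e, b)"
      using \<rho> ab by (simp add: hom_mult FB(1))
  qed (use \<rho> in \<open>auto simp: hom_def FB(1)\<close>)
  then have s: "\<rho> (?e, h) = LS h" if "h \<in> carrier (braid_group n)" for h
    by (rule B.hom_eqI[OF G.is_group _ LS(1) _ that]) (use \<rho> in \<open>simp add: LS(2) flip: fb_sigma_def\<close>)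
  show "\<rho> = ?\<rho>"
  proof (rule extensionalityI)
    show "\<rho> p = ?\<rho> p" if "p \<in> carrier (FB n)" for p
    proof -
      obtain a h where p: "p = (a, h)" "a \<in> carrier (free_group n)" "h \<in> carrier (braid_group n)"
        using \<open>p \<in> carrier (FB n)\<close> by (auto simp: FB)
      then have "p = (a, ?e') \<otimes>\<^bsub>FB n\<^esub> (?e, h)"
        by (simp add: FB theta_e)
      then have "\<rho> p = \<rho> (a, ?e') \<otimes> \<rho> (?e, h)"
        using \<rho> p by (simp add: hom_mult FB(1))
      then show ?thesis
        using p by (simp add: x s FB(1))
    qed
  qed (use \<rho> in auto)
qed

end

lemma rep_on_gens:
  assumes "FB_images (GL W) n X S"
  shows "j \<in> {1..n} \<Longrightarrow> rep_on_gens n W X S (fb_x n j) = X j"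
    and "i \<in> {1..<n} \<Longrightarrow> rep_on_gens n W X S (fb_sigma n i) = S i"
  using theI'[OF FB_images.exists_unique_hom[OF assms]] by (auto simp: rep_on_gens_def)

lemma fb_sigma_in: "i \<in> {1..<n} \<Longrightarrow> fb_sigma n i \<in> carrier (FB n)"
  by (simp add: fb_sigma_def FB_def semidirect_product_def)

section \<open>Endomorphism algebras\<close>

locale vspace = vectorspace "class_ring :: 'k ring" V
  for V :: "('k::field, 'v, 'm) module_scheme" (structure)
begin

lemma vs_simps [simp]:
  "v \<in> carrier V \<Longrightarrow> 1 \<odot> v = v" "v \<in> carrier V \<Longrightarrow> 0 \<odot> v = \<zero>" "a \<odot> \<zero> = \<zero>"
  using smult_one[of v] lmult_0[of v] rmult_0[of a] by auto

lemma vs_distrib: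
  "v \<in> carrier V \<Longrightarrow> (a + b) \<odot> v = a \<odot> v \<oplus> b \<odot> v"
  "u \<in> carrier V \<Longrightarrow> v \<in> carrier V \<Longrightarrow> a \<odot> (u \<oplus> v) = a \<odot> u \<oplus> a \<odot> v"
  "v \<in> carrier V \<Longrightarrow> (a * b) \<odot> v = a \<odot> (b \<odot> v)"
  using smult_l_distr[of a b v] smult_r_distr[of a u v] smult_assoc1[of a b v] by auto

lemma vs_minus_one: "v \<in> carrier V \<Longrightarrow> (- 1) \<odot> v = \<ominus> v"
  using smult_minus_1[of v] by (simp add: class_ring_simps)

lemma End_carrier:
  "f \<in> carrier (End V) \<longleftrightarrow> f \<in> carrier V \<rightarrow> carrier V \<and> f \<in> extensional (carrier V) \<and>
    (\<forall>u\<in>carrier V. \<forall>v\<in>carrier V. f (u \<oplus> v) = f u \<oplus> f v) \<and> (\<forall>a. \<forall>v\<in>carrier V. f (a \<odot> v) = a \<odot> f v)"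
  by (auto simp: End_def LinearCombinations.module_hom_def)

lemma EndI:
  assumes "f \<in> extensional (carrier V)" "\<And>v. v \<in> carrier V \<Longrightarrow> f v \<in> carrier V"
    and "\<And>u v. u \<in> carrier V \<Longrightarrow> v \<in> carrier V \<Longrightarrow> f (u \<oplus> v) = f u \<oplus> f v"
    and "\<And>a v. v \<in> carrier V \<Longrightarrow> f (a \<odot> v) = a \<odot> f v"
  shows "f \<in> carrier (End V)"
  using assms by (auto simp: End_carrier)

lemma End_extensional: "f \<in> carrier (End V) \<Longrightarrow> f \<in> extensional (carrier V)"
  by (simp add: End_def)

lemma End_closed [simp]: "f \<in> carrier (End V) \<Longrightarrow> v \<in> carrier V \<Longrightarrow> f v \<in> carrier V"
  by (auto simp: End_carrier)

lemma End_linear [simp]: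
  "f \<in> carrier (End V) \<Longrightarrow> u \<in> carrier V \<Longrightarrow> v \<in> carrier V \<Longrightarrow> f (u \<oplus> v) = f u \<oplus> f v"
  "f \<in> carrier (End V) \<Longrightarrow> v \<in> carrier V \<Longrightarrow> f (a \<odot> v) = a \<odot> f v"
  by (auto simp: End_carrier)

lemma End_zero [simp]:
  assumes "f \<in> carrier (End V)"
  shows "f \<zero> = \<zero>"
proof -
  have "f (0 \<odot> \<zero>) = 0 \<odot> f \<zero>"
    using assms by (intro End_linear) auto
  then show ?thesis
    using assms by simp
qed

lemma End_eqI:
  assumes "f \<in> carrier (End V)" "h \<in> carrier (End V)" "\<And>v. v \<in> carrier V \<Longrightarrow> f v = h v"
  shows "f = h"
  by (rule extensionalityI[OF End_extensional[OF assms(1)] End_extensional[OF assms(2)] assms(3)])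

lemma End_apply [simp]:
  assumes "v \<in> carrier V"
  shows "(f \<otimes>\<^bsub>End V\<^esub> h) v = f (h v)" "(f \<oplus>\<^bsub>End V\<^esub> h) v = f v \<oplus> h v"
    "(a \<odot>\<^bsub>End V\<^esub> f) v = a \<odot> f v" "\<one>\<^bsub>End V\<^esub> v = v" "\<zero>\<^bsub>End V\<^esub> v = \<zero>"
    "scalar_op V a v = a \<odot> v"
  using assms by (simp_all add: End_def compose_def scalar_op_def)

lemma End_ops_closed [simp]:
  "f \<in> carrier (End V) \<Longrightarrow> h \<in> carrier (End V) \<Longrightarrow> f \<otimes>\<^bsub>End V\<^esub> h \<in> carrier (End V)"
  "f \<in> carrier (End V) \<Longrightarrow> h \<in> carrier (End V) \<Longrightarrow> f \<oplus>\<^bsub>End V\<^esub> h \<in> carrier (End V)"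
  "f \<in> carrier (End V) \<Longrightarrow> a \<odot>\<^bsub>End V\<^esub> f \<in> carrier (End V)"
  "\<one>\<^bsub>End V\<^esub> \<in> carrier (End V)" "\<zero>\<^bsub>End V\<^esub> \<in> carrier (End V)"
proof -
  show "f \<otimes>\<^bsub>End V\<^esub> h \<in> carrier (End V)" if "f \<in> carrier (End V)" "h \<in> carrier (End V)"
    by (rule EndI) (use that in \<open>simp_all, simp add: End_def\<close>)
  show "f \<oplus>\<^bsub>End V\<^esub> h \<in> carrier (End V)" if "f \<in> carrier (End V)" "h \<in> carrier (End V)"
    by (rule EndI) (use that in \<open>simp_all add: vs_distrib(2) a_ac, simp add: End_def\<close>)
  show "a \<odot>\<^bsub>End V\<^esub> f \<in> carrier (End V)" if "f \<in> carrier (End V)"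
    by (rule EndI) (use that in \<open>simp_all add: vs_distrib(2) mult.commute flip: vs_distrib(3), simp add: End_def\<close>)
  show "\<one>\<^bsub>End V\<^esub> \<in> carrier (End V)"
    by (rule EndI) (simp_all, simp add: End_def)
  show "\<zero>\<^bsub>End V\<^esub> \<in> carrier (End V)"
    by (rule EndI) (simp_all, simp add: End_def)
qed

lemma scalar_op_closed [simp]: "scalar_op V a \<in> carrier (End V)"
  by (simp add: scalar_op_def)

lemma End_ring: "ring (End V)"
proof (intro ringI abelian_groupI monoidI)
  show "\<exists>h\<in>carrier (End V). h \<oplus>\<^bsub>End V\<^esub> f = \<zero>\<^bsub>End V\<^esub>" if f: "f \<in> carrier (End V)" for f
    using f by (intro bexI[of _ "(- 1) \<odot>\<^bsub>End V\<^esub> f"] End_eqI) (simp_all add: vs_minus_one l_neg)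
qed (auto intro!: End_eqI simp: a_ac)

sublocale E: ring "End V"
  by (rule End_ring)

lemma End_module: "Module.module class_ring (End V)"
  by (intro Module.module.intro abelian_group.axioms E.is_abelian_group Module.module_axioms.intro)
    (auto intro!: End_eqI simp: vs_distrib class_cring.is_cring)

sublocale EM: Module.module "class_ring :: 'k ring" "End V"
  by (rule End_module)

lemma End_minus_apply [simp]:
  assumes "f \<in> carrier (End V)" "h \<in> carrier (End V)" "v \<in> carrier V"
  shows "(f \<ominus>\<^bsub>End V\<^esub> h) v = f v \<ominus> h v"
proof -
  have "\<ominus>\<^bsub>End V\<^esub> h = (- 1) \<odot>\<^bsub>End V\<^esub> h"
    using EM.smult_minus_1[of h] assms by (simp add: class_ring_simps)
  then show ?thesis
    using assms by (simp add: a_minus_def vs_minus_one)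
qed

lemma End_finsum_apply:
  assumes "\<And>i. i \<in> A \<Longrightarrow> T i \<in> carrier (End V)" "v \<in> carrier V"
  shows "(\<Oplus>\<^bsub>End V\<^esub>i\<in>A. T i) v = (\<Oplus>i\<in>A. T i v)"
  using assms(1)
proof (induction A rule: infinite_finite_induct)
  case (insert i A)
  then show ?case
    using assms(2) by (simp add: Pi_iff)
qed (use assms(2) in simp_all)

lemma pow_closed [simp]: "f \<in> carrier (End V) \<Longrightarrow> f [^]\<^bsub>End V\<^esub> (i::nat) \<in> carrier (End V)"
  by simp

lemma op_poly_closed [simp]: "f \<in> carrier (End V) \<Longrightarrow> op_poly V p f \<in> carrier (End V)"
  unfolding op_poly_def by (rule E.finsum_closed) auto

lemma op_poly_apply:
  assumes f: "f \<in> carrier (End V)" and v: "v \<in> carrier V" and d: "degree p \<le> d"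
  shows "op_poly V p f v = (\<Oplus>i\<in>{..d}. coeff p i \<odot> (f [^]\<^bsub>End V\<^esub> i) v)"
proof -
  have "op_poly V p f v = (\<Oplus>i\<in>{..degree p}. coeff p i \<odot> (f [^]\<^bsub>End V\<^esub> i) v)"
    unfolding op_poly_def using f v by (subst End_finsum_apply) auto
  also have "\<dots> = (\<Oplus>i\<in>{..d}. coeff p i \<odot> (f [^]\<^bsub>End V\<^esub> i) v)"
    using f v d by (intro add.finprod_mono_neutral_cong_left) (auto simp: coeff_eq_0)
  finally show ?thesis .
qed

lemma op_poly_0 [simp]: "f \<in> carrier (End V) \<Longrightarrow> v \<in> carrier V \<Longrightarrow> op_poly V 0 f v = \<zero>"
  by (subst op_poly_apply[where d = 0]) auto

text \<open>Horner's rule. It opens \<open>op_poly\<close> to induction on the polynomial.\<close>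

lemma op_poly_pCons:
  assumes f: "f \<in> carrier (End V)" and v: "v \<in> carrier V"
  shows "op_poly V (pCons a p) f v = a \<odot> v \<oplus> op_poly V p f (f v)"
proof -
  have "op_poly V (pCons a p) f v = (\<Oplus>i\<in>{..Suc (degree p)}. coeff (pCons a p) i \<odot> (f [^]\<^bsub>End V\<^esub> i) v)"
    using f v by (intro op_poly_apply) auto
  also have "\<dots> = (\<Oplus>i\<in>{..degree p}. coeff p i \<odot> (f [^]\<^bsub>End V\<^esub> i) (f v)) \<oplus> a \<odot> v"
    using f v by (subst finsum_Suc2) (auto simp: Pi_iff)
  also have "\<dots> = a \<odot> v \<oplus> op_poly V p f (f v)"
    using f v by (subst op_poly_apply[where d = "degree p"]) (auto simp: a_comm Pi_iff)
  finally show ?thesis .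
qed

end

section \<open>Coordinates\<close>

text \<open>A linear isomorphism of \<open>V\<close> with the functions \<open>I \<rightarrow> 'k\<close>, as a substitute for a basis: it
  passes to powers and quotients of \<open>V\<close> without choosing vectors.\<close>

locale coords = vspace V
  for V :: "('k::field, 'v, 'm) module_scheme" (structure) +
  fixes I :: "'i set" and \<phi> :: "'v \<Rightarrow> 'i \<Rightarrow> 'k"
  assumes finite_index: "finite I"
    and coord_add: "u \<in> carrier V \<Longrightarrow> v \<in> carrier V \<Longrightarrow> i \<in> I \<Longrightarrow> \<phi> (u \<oplus> v) i = \<phi> u i + \<phi> v i"
    and coord_smult: "v \<in> carrier V \<Longrightarrow> i \<in> I \<Longrightarrow> \<phi> (a \<odot> v) i = a * \<phi> v i"
    and coord_eqI: "u \<in> carrier V \<Longrightarrow> v \<in> carrier V \<Longrightarrow> (\<And>i. i \<in> I \<Longrightarrow> \<phi> u i = \<phi> v i) \<Longrightarrow> u = v"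
    and coord_surj: "\<exists>v\<in>carrier V. \<forall>i\<in>I. \<phi> v i = x i"
begin

lemma coord_zero: "i \<in> I \<Longrightarrow> \<phi> \<zero> i = 0"
  using coord_smult[of \<zero> i 0] by simp

lemma coord_minus: "u \<in> carrier V \<Longrightarrow> v \<in> carrier V \<Longrightarrow> i \<in> I \<Longrightarrow> \<phi> (u \<ominus> v) i = \<phi> u i - \<phi> v i"
  using coord_add[of u "\<ominus> v" i] coord_smult[of v i "- 1"] by (simp add: a_minus_def vs_minus_one)

lemma coord_finsum:
  assumes "\<And>j. j \<in> A \<Longrightarrow> h j \<in> carrier V" "i \<in> I"
  shows "\<phi> (\<Oplus>j\<in>A. h j) i = (\<Sum>j\<in>A. \<phi> (h j) i)"
  using assms(1)
proof (induction A rule: infinite_finite_induct)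
  case (insert j A)
  then show ?case
    using assms(2) by (simp add: Pi_iff coord_add)
qed (use assms(2) in \<open>simp_all add: coord_zero\<close>)

definition vec :: "('i \<Rightarrow> 'k) \<Rightarrow> 'v" where
  "vec x = (SOME v. v \<in> carrier V \<and> (\<forall>i\<in>I. \<phi> v i = x i))"

lemma vec_closed [simp]: "vec x \<in> carrier V" and coord_vec [simp]: "i \<in> I \<Longrightarrow> \<phi> (vec x) i = x i"
proof -
  have "\<exists>v. v \<in> carrier V \<and> (\<forall>i\<in>I. \<phi> v i = x i)"
    using coord_surj[of x] by blast
  from someI_ex[OF this] show "vec x \<in> carrier V" "i \<in> I \<Longrightarrow> \<phi> (vec x) i = x i"
    by (auto simp: vec_def)
qed

lemma basis_vec: "basis ((\<lambda>i. vec (\<lambda>j. if i = j then 1 else 0)) ` I)"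
  and inj_on_vec: "inj_on (\<lambda>i. vec (\<lambda>j. if i = j then 1 else 0)) I"
proof -
  let ?e = "\<lambda>i. vec (\<lambda>j. if i = j then 1 else 0)"
  show inj: "inj_on ?e I"
  proof (rule inj_onI)
    fix i j assume ij: "i \<in> I" "j \<in> I" "?e i = ?e j"
    then have "\<phi> (?e i) i = \<phi> (?e j) i" by simp
    then show "i = j"
      using ij(1,2) by (simp split: if_splits)
  qed
  have comb: "\<phi> (lincomb a (?e ` I)) i = a (?e i)" if "i \<in> I" for a i
  proof -
    have "\<phi> (lincomb a (?e ` I)) i = (\<Sum>v\<in>?e ` I. a v * \<phi> v i)"
      unfolding lincomb_def using that by (subst coord_finsum) (auto simp: coord_smult intro!: sum.cong)
    also have "\<dots> = (\<Sum>j\<in>I. if i = j then a (?e j) else 0)"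
      using that by (subst sum.reindex[OF inj]) (auto intro!: sum.cong)
    also have "\<dots> = a (?e i)"
      using that finite_index by simp
    finally show ?thesis .
  qed
  have fin: "finite (?e ` I)" and carr: "?e ` I \<subseteq> carrier V"
    using finite_index by auto
  have "lin_indpt (?e ` I)"
  proof (rule finite_lin_indpt2[OF fin carr])
    fix a assume a: "lincomb a (?e ` I) = \<zero>"
    have "a (?e i) = 0" if "i \<in> I" for i
      using comb[OF that, of a] coord_zero[OF that] by (simp add: a)
    then show "\<forall>v\<in>?e ` I. a v = \<zero>\<^bsub>class_ring\<^esub>"
      by simp
  qed
  moreover have "span (?e ` I) = carrier V"
  proof
    show "span (?e ` I) \<subseteq> carrier V"
      using carr by (rule span_is_subset2)
    show "carrier V \<subseteq> span (?e ` I)"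
    proof
      fix v assume v: "v \<in> carrier V"
      let ?a = "\<lambda>w. \<phi> v (inv_into I ?e w)"
      have "v = lincomb ?a (?e ` I)"
        using v carr inj by (intro coord_eqI lincomb_closed) (auto simp: comb inv_into_f_f[OF inj])
      then show "v \<in> span (?e ` I)"
        using fin by (subst finite_span[OF fin carr]) auto
    qed
  qed
  ultimately show "basis (?e ` I)"
    using carr by (simp add: basis_def)
qed

lemma finite_dimensional: fin_dim
  using basis_vec finite_index by (auto simp: fin_dim_def basis_def)

lemma vdim_eq: "vdim V = card I"
  using dim_basis[OF _ basis_vec] finite_index card_image[OF inj_on_vec] by (simp add: vdim_def)

text \<open>Linearity and equality of operators can be tested on coordinates.\<close>

lemma End_coordI:
  assumes "f \<in> extensional (carrier V)" "\<And>v. v \<in> carrier V \<Longrightarrow> f v \<in> carrier V"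
    and "\<And>u v i. u \<in> carrier V \<Longrightarrow> v \<in> carrier V \<Longrightarrow> i \<in> I \<Longrightarrow> \<phi> (f (u \<oplus> v)) i = \<phi> (f u) i + \<phi> (f v) i"
    and "\<And>a v i. v \<in> carrier V \<Longrightarrow> i \<in> I \<Longrightarrow> \<phi> (f (a \<odot> v)) i = a * \<phi> (f v) i"
  shows "f \<in> carrier (End V)"
  using assms(1,2) by (rule EndI) (auto intro!: coord_eqI simp: assms coord_add coord_smult)

end

text \<open>The vector space axioms are inherited from \<open>'k\<close> through the injective coordinate map.\<close>

lemma coordsI:
  fixes V :: "('k::field, 'v, 'm) module_scheme" (structure)
  assumes "finite I" "\<zero> \<in> carrier V"
    and add: "\<And>u v. u \<in> carrier V \<Longrightarrow> v \<in> carrier V \<Longrightarrow> u \<oplus> v \<in> carrier V"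
    and smult: "\<And>a v. v \<in> carrier V \<Longrightarrow> a \<odot> v \<in> carrier V"
    and zero: "\<And>i. i \<in> I \<Longrightarrow> \<phi> \<zero> i = 0"
    and coord_add: "\<And>u v i. u \<in> carrier V \<Longrightarrow> v \<in> carrier V \<Longrightarrow> i \<in> I \<Longrightarrow> \<phi> (u \<oplus> v) i = \<phi> u i + \<phi> v i"
    and coord_smult: "\<And>a v i. v \<in> carrier V \<Longrightarrow> i \<in> I \<Longrightarrow> \<phi> (a \<odot> v) i = a * \<phi> v i"
    and eqI: "\<And>u v. u \<in> carrier V \<Longrightarrow> v \<in> carrier V \<Longrightarrow> (\<And>i. i \<in> I \<Longrightarrow> \<phi> u i = \<phi> v i) \<Longrightarrow> u = v"
    and surj: "\<And>x. \<exists>v\<in>carrier V. \<forall>i\<in>I. \<phi> v i = x i"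
  shows "coords V I \<phi>"
proof -
  have "vectorspace class_ring V"
  proof (rule vs_criteria[OF class_field.field_axioms])
    show "\<forall>v\<in>carrier V. \<exists>w\<in>carrier V. v \<oplus> w = \<zero>"
    proof
      fix v assume v: "v \<in> carrier V"
      have "v \<oplus> (- 1) \<odot> v = \<zero>"
        by (rule eqI) (simp_all add: v assms(2) add smult zero coord_add coord_smult)
      then show "\<exists>w\<in>carrier V. v \<oplus> w = \<zero>"
        using v smult by blast
    qed
  qed (use assms in \<open>auto intro!: eqI simp: algebra_simps\<close>)
  then show ?thesis
    by (intro coords.intro coords_axioms.intro vspace.intro) (use assms in auto)
qed

lemma (in coords) subspace_coords:
  assumes U: "U = {v \<in> carrier V. \<forall>i\<in>I - J. \<phi> v i = 0}" and J: "J \<subseteq> I"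
  shows "coords (V\<lparr>carrier := U\<rparr>) J \<phi>"
proof (rule coordsI)
  show "finite J"
    using finite_index J by (rule rev_finite_subset)
  show "u = v" if "u \<in> carrier (V\<lparr>carrier := U\<rparr>)" "v \<in> carrier (V\<lparr>carrier := U\<rparr>)"
    "\<And>i. i \<in> J \<Longrightarrow> \<phi> u i = \<phi> v i" for u v
  proof (rule coord_eqI)
    show "\<phi> u i = \<phi> v i" if "i \<in> I" for i
      using that \<open>u \<in> carrier (V\<lparr>carrier := U\<rparr>)\<close> \<open>v \<in> carrier (V\<lparr>carrier := U\<rparr>)\<close>
        \<open>\<And>i. i \<in> J \<Longrightarrow> \<phi> u i = \<phi> v i\<close>[of i] by (cases "i \<in> J") (auto simp: U)
  qed (use that in \<open>auto simp: U\<close>)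
  show "\<exists>v\<in>carrier (V\<lparr>carrier := U\<rparr>). \<forall>i\<in>J. \<phi> v i = x i" for x
    using J by (intro bexI[of _ "vec (\<lambda>i. if i \<in> J then x i else 0)"]) (auto simp: U)
qed (use J in \<open>auto simp: U coord_zero coord_add coord_smult\<close>)

lemma (in coords) subspace_dim_eq:
  assumes "U = {v \<in> carrier V. \<forall>i\<in>I - J. \<phi> v i = 0}" "J \<subseteq> I"
  shows "subspace_dim V U = card J"
  using coords.vdim_eq[OF subspace_coords[OF assms]] by (simp add: subspace_dim_def)

section \<open>Semisimple operators are the diagonalisable ones\<close>

context vspace
begin

lemma End_finsum:
  assumes "f \<in> carrier (End V)" "\<And>i. i \<in> A \<Longrightarrow> h i \<in> carrier V"
  shows "f (\<Oplus>i\<in>A. h i) = (\<Oplus>i\<in>A. f (h i))"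
  using assms(2)
proof (induction A rule: infinite_finite_induct)
  case (insert i A)
  then show ?case
    using assms(1) by (simp add: Pi_iff)
qed (use assms(1) in simp_all)

lemma subspace_closed:
  assumes "VectorSpace.subspace class_ring U V"
  shows "U \<subseteq> carrier V" "\<zero> \<in> U" "u \<in> U \<Longrightarrow> v \<in> U \<Longrightarrow> u \<oplus> v \<in> U" "u \<in> U \<Longrightarrow> a \<odot> u \<in> U"
  using submodule.subset submodule.m_closed submodule.zero_closed submodule.smult_closed
    assms[unfolded VectorSpace.subspace_def] by (metis, metis, metis, metis UNIV_I partial_object.select_convs(1))

lemma subspaceI:
  assumes "U \<subseteq> carrier V" "\<zero> \<in> U" "\<And>u v. u \<in> U \<Longrightarrow> v \<in> U \<Longrightarrow> u \<oplus> v \<in> U" "\<And>a u. u \<in> U \<Longrightarrow> a \<odot> u \<in> U"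
  shows "VectorSpace.subspace class_ring U V"
  by (intro VectorSpace.subspace.intro submodule.intro) (use assms in \<open>auto intro: vectorspace_axioms module_axioms\<close>)

lemma in_span_iff: "v \<in> span A \<longleftrightarrow> (\<exists>a B. finite B \<and> B \<subseteq> A \<and> v = lincomb a B)"
  by (auto simp: span_def)

lemma lincomb_add:
  assumes "B \<subseteq> carrier V"
  shows "lincomb (\<lambda>b. a b + a' b) B = lincomb a B \<oplus> lincomb a' B"
proof -
  have "lincomb (\<lambda>b. a b + a' b) B = (\<Oplus>b\<in>B. a b \<odot> b \<oplus> a' b \<odot> b)"
    unfolding lincomb_def using assms by (intro finsum_cong') (auto simp: subset_iff vs_distrib(1))
  also have "\<dots> = lincomb a B \<oplus> lincomb a' B"
    unfolding lincomb_def using assms by (intro finsum_addf) auto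
  finally show ?thesis .
qed

text \<open>Coefficients with respect to a basis of eigenvectors are coordinates in which the operator
  is diagonal.\<close>

lemma eigenbasis_coords:
  assumes B: "finite B" "basis B"
  obtains \<phi> where "coords V B \<phi>"
    "\<And>g \<nu> v b. g \<in> carrier (End V) \<Longrightarrow> (\<And>b. b \<in> B \<Longrightarrow> g b = \<nu> b \<odot> b) \<Longrightarrow> v \<in> carrier V \<Longrightarrow> b \<in> B \<Longrightarrow>
      \<phi> (g v) b = \<nu> b * \<phi> v b"
proof -
  have carr: "B \<subseteq> carrier V" and li: "lin_indpt B" and gen: "span B = carrier V"
    using B by (auto simp: basis_def)
  define \<phi> where "\<phi> = (\<lambda>v. SOME a. v = lincomb a B)"
  have lincomb_phi: "lincomb (\<phi> v) B = v" if "v \<in> carrier V" for v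
  proof -
    have "\<exists>a. v = lincomb a B"
      using that gen finite_span[OF B(1) carr] by auto
    from someI_ex[OF this] show ?thesis
      by (simp add: \<phi>_def)
  qed
  have comb_closed: "lincomb a B \<in> carrier V" for a
    using carr by (intro lincomb_closed) auto
  have uniq: "a b = a' b" if "lincomb a B = lincomb a' B" "b \<in> B" for a a' b
  proof (rule ccontr)
    assume "a b \<noteq> a' b"
    have "lincomb (\<lambda>b. a b + (- 1) * a' b) B = lincomb a B \<oplus> lincomb (\<lambda>b. (- 1) * a' b) B"
      by (rule lincomb_add[OF carr])
    also have "lincomb (\<lambda>b. (- 1) * a' b) B = \<ominus> lincomb a' B"
      using lincomb_smult[OF carr, of a' "- 1"] comb_closed vs_minus_one by simp
    finally have "lincomb (\<lambda>b. a b + (- 1) * a' b) B = \<zero>"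
      using that(1) comb_closed by (simp add: r_neg)
    then have "lin_dep B"
      using B(1) that(2) \<open>a b \<noteq> a' b\<close> by (intro lin_dep_crit[of B B "\<lambda>b. a b + (- 1) * a' b" b]) auto
    then show False
      using li by simp
  qed
  have phi_lincomb: "\<phi> (lincomb a B) b = a b" if "b \<in> B" for a b
    using uniq[OF lincomb_phi that] comb_closed by simp
  have "coords V B \<phi>"
  proof (intro coords.intro coords_axioms.intro)
    show "vspace V" by (rule vspace_axioms)
    show "\<phi> (u \<oplus> v) b = \<phi> u b + \<phi> v b" if "u \<in> carrier V" "v \<in> carrier V" "b \<in> B" for u v b
    proof -
      have "lincomb (\<lambda>b. \<phi> u b + \<phi> v b) B = lincomb (\<phi> u) B \<oplus> lincomb (\<phi> v) B"
        by (rule lincomb_add[OF carr])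
      then show ?thesis
        using that phi_lincomb[of b "\<lambda>b. \<phi> u b + \<phi> v b"] by (simp add: lincomb_phi)
    qed
    show "\<phi> (a \<odot> v) b = a * \<phi> v b" if "v \<in> carrier V" "b \<in> B" for a v b
      using lincomb_smult[OF carr, of "\<phi> v" a] that phi_lincomb[of b "\<lambda>b. a * \<phi> v b"]
      by (simp add: lincomb_phi)
    show "u = v" if "u \<in> carrier V" "v \<in> carrier V" "\<And>b. b \<in> B \<Longrightarrow> \<phi> u b = \<phi> v b" for u v
    proof -
      have "lincomb (\<phi> u) B = lincomb (\<phi> v) B"
        using that(3) carr by (intro lincomb_cong) auto
      then show ?thesis
        using that by (simp add: lincomb_phi)
    qed
    show "\<exists>v\<in>carrier V. \<forall>b\<in>B. \<phi> v b = x b" for x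
      using phi_lincomb comb_closed by (intro bexI[of _ "lincomb x B"]) auto
  qed (rule B(1))
  moreover have "\<phi> (g v) b = \<nu> b * \<phi> v b"
    if g: "g \<in> carrier (End V)" and eig: "\<And>b. b \<in> B \<Longrightarrow> g b = \<nu> b \<odot> b" and v: "v \<in> carrier V" and b: "b \<in> B"
    for g \<nu> v b
  proof -
    have "g v = g (lincomb (\<phi> v) B)"
      using v by (simp add: lincomb_phi)
    also have "\<dots> = (\<Oplus>b\<in>B. \<phi> v b \<odot> g b)"
      unfolding lincomb_def using g carr by (subst End_finsum) (auto simp: subset_iff intro!: finsum_cong')
    also have "\<dots> = lincomb (\<lambda>b. \<nu> b * \<phi> v b) B"
      unfolding lincomb_def using eig carr
      by (intro finsum_cong') (auto simp: subset_iff mult.commute simp flip: vs_distrib(3))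
    finally show ?thesis
      using b by (simp add: phi_lincomb)
  qed
  ultimately show ?thesis
    by (rule that)
qed

lemma op_poly_add:
  assumes "f \<in> carrier (End V)" "v \<in> carrier V"
  shows "op_poly V (p + q) f v = op_poly V p f v \<oplus> op_poly V q f v"
  using assms(2)
proof (induction p q arbitrary: v rule: poly_induct2)
  case (pCons a p b q)
  then show ?case
    using assms(1) by (simp add: op_poly_pCons vs_distrib(1) a_ac)
qed (use assms(1) in simp)

lemma op_poly_smult:
  assumes "f \<in> carrier (End V)" "v \<in> carrier V"
  shows "op_poly V (Polynomial.smult a p) f v = a \<odot> op_poly V p f v"
  using assms(2)
proof (induction p arbitrary: v)
  case (pCons b p)
  then show ?case
    using assms(1) by (simp add: op_poly_pCons vs_distrib)
qed (use assms(1) in simp)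

lemma op_poly_linear_factor:
  assumes "f \<in> carrier (End V)" "v \<in> carrier V"
  shows "op_poly V ([:- a, 1:] * r) f v = op_poly V r f (f v \<oplus> (- a) \<odot> v)"
proof -
  have "[:- a, 1:] * r = Polynomial.smult (- a) r + pCons 0 r"
    by simp
  then show ?thesis
    using assms by (simp only: op_poly_add op_poly_smult op_poly_pCons) (simp add: a_comm op_poly_closed)
qed

lemma op_poly_monom:
  assumes "f \<in> carrier (End V)" "v \<in> carrier V"
  shows "op_poly V (monom 1 i) f v = (f [^]\<^bsub>End V\<^esub> i) v"
  using assms(2)
proof (induction i arbitrary: v)
  case (Suc i)
  then show ?case
    using assms(1) by (simp add: monom_Suc op_poly_pCons)
qed (use assms(1) in \<open>simp add: monom_0 op_poly_pCons\<close>)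

text \<open>The vectors \<open>u, f u, \<dots>, f\<^sup>d u\<close> with \<open>d\<close> the dimension are linearly dependent.\<close>

lemma annihilating_polynomial:
  assumes fd: fin_dim and f: "f \<in> carrier (End V)" and u: "u \<in> carrier V"
  obtains p where "p \<noteq> 0" "op_poly V p f u = \<zero>"
proof (cases "inj_on (\<lambda>i. (f [^]\<^bsub>End V\<^esub> i) u) {..dim}")
  case False
  then obtain i j :: nat where ij: "i \<noteq> j" "(f [^]\<^bsub>End V\<^esub> i) u = (f [^]\<^bsub>End V\<^esub> j) u"
    unfolding inj_on_def by blast
  let ?p = "monom 1 i + Polynomial.smult (- 1) (monom (1::'k) j)"
  have "coeff ?p i = 1"
    using ij(1) by simp
  then have "?p \<noteq> 0"
    by (metis coeff_0 zero_neq_one)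
  moreover have "op_poly V ?p f u = \<zero>"
    using f u ij(2) by (simp only: op_poly_add op_poly_smult op_poly_monom vs_minus_one pow_closed End_closed r_neg)
  ultimately show ?thesis
    by (rule that)
next
  case True
  let ?h = "\<lambda>i. (f [^]\<^bsub>End V\<^esub> i) u"
  let ?A = "?h ` {..dim}"
  have carr: "?A \<subseteq> carrier V"
    using f u by auto
  have "card ?A = Suc dim"
    using True by (simp add: card_image)
  then have "lin_dep ?A"
    using li_le_dim(2)[OF fd carr] by auto
  then obtain a v where a: "lincomb a ?A = \<zero>" "v \<in> ?A" "a v \<noteq> 0"
    using finite_lin_dep[OF _ _ carr] by auto
  let ?p = "\<Sum>i\<le>dim. monom (a (?h i)) i"
  have coeff: "coeff ?p i = (if i \<le> dim then a (?h i) else 0)" for i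
    by (simp add: coeff_sum)
  obtain i where "i \<le> dim" "v = ?h i"
    using a(2) by auto
  then have "coeff ?p i \<noteq> 0"
    using a(3) by (simp add: coeff)
  then have "?p \<noteq> 0"
    by (metis coeff_0)
  moreover have "op_poly V ?p f u = \<zero>"
  proof -
    have "op_poly V ?p f u = (\<Oplus>i\<in>{..dim}. coeff ?p i \<odot> ?h i)"
      using f u by (intro op_poly_apply) (auto intro!: degree_le simp: coeff)
    also have "\<dots> = (\<Oplus>i\<in>{..dim}. a (?h i) \<odot> ?h i)"
      using f u by (intro finsum_cong') (auto simp: coeff)
    also have "\<dots> = lincomb a ?A"
      unfolding lincomb_def using f u True by (subst finsum_reindex) auto
    finally show ?thesis
      using a(1) by simp
  qed
  ultimately show ?thesis
    by (rule that)
qed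

definition eigenvectors :: "('v \<Rightarrow> 'v) \<Rightarrow> 'v set" where
  "eigenvectors f = {v \<in> carrier V. v \<noteq> \<zero> \<and> (\<exists>a. f v = a \<odot> v)}"

lemma eigenvectors_eigenvalues:
  assumes "A \<subseteq> eigenvectors f"
  shows "\<exists>\<nu>. \<forall>v\<in>A. f v = \<nu> v \<odot> v"
  by (rule bchoice) (use assms in \<open>auto simp: eigenvectors_def\<close>)

lemma span_eigenvectors_invariant:
  assumes f: "f \<in> carrier (End V)" and A: "A \<subseteq> eigenvectors f"
  shows "f ` span A \<subseteq> span A"
proof
  fix w assume "w \<in> f ` span A"
  then obtain a B where B: "finite B" "B \<subseteq> A" "w = f (lincomb a B)"
    by (auto simp: in_span_iff)
  obtain \<nu> where \<nu>: "\<forall>v\<in>A. f v = \<nu> v \<odot> v"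
    using eigenvectors_eigenvalues[OF A] by blast
  have carr: "v \<in> carrier V" if "v \<in> B" for v
    using that A B(2) by (auto simp: eigenvectors_def)
  have "w = (\<Oplus>v\<in>B. a v \<odot> f v)"
    unfolding B(3) lincomb_def using f carr by (subst End_finsum) (auto intro!: finsum_cong')
  also have "\<dots> = lincomb (\<lambda>v. a v * \<nu> v) B"
    unfolding lincomb_def using \<nu> B(2) carr
    by (intro finsum_cong') (auto simp: subset_iff simp flip: vs_distrib(3))
  finally show "w \<in> span A"
    using B by (auto simp: in_span_iff)
qed

lemma set_add_iff: "w \<in> A <+>\<^bsub>V\<^esub> B \<longleftrightarrow> (\<exists>a\<in>A. \<exists>b\<in>B. w = a \<oplus> b)"
  by (auto simp: set_add_def')

text \<open>An invariant complement of the span of some eigenvectors is found among the spans of further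
  eigenvectors: take a maximal set of them whose span is independent of the given subspace.\<close>

lemma semisimple_if_eigenvectors_span:
  assumes f: "f \<in> carrier (End V)" and D: "finite D" "D \<subseteq> eigenvectors f" "span D = carrier V"
  shows "semisimple V f"
  unfolding semisimple_def
proof (intro allI impI)
  fix U assume "VectorSpace.subspace class_ring U V \<and> f ` U \<subseteq> U"
  then have U: "VectorSpace.subspace class_ring U V" by simp
  note Uc = subspace_closed[OF U]
  have Dc: "D \<subseteq> carrier V"
    using D(2) by (auto simp: eigenvectors_def)
  let ?P = "\<lambda>A. A \<subseteq> D \<and> U \<inter> span A = {\<zero>}"
  have "span {} = {\<zero>}"
    by (auto simp: span_def lincomb_def)
  then have "?P {}"
    using Uc by auto
  then obtain A where A: "?P A" and max: "\<And>B. A \<subseteq> B \<Longrightarrow> ?P B \<Longrightarrow> B = A"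
    using maximal_exists[of ?P "card D" "{}"] D(1) card_mono finite_subset
    unfolding maximal_def by (metis (no_types, lifting))
  have Ac: "A \<subseteq> carrier V"
    using A Dc by auto
  note S = span_is_subspace[OF Ac] 
  note Sc = subspace_closed[OF S]
  have sum: "VectorSpace.subspace class_ring (U <+>\<^bsub>V\<^esub> span A) V"
  proof (rule subspaceI)
    show "U <+>\<^bsub>V\<^esub> span A \<subseteq> carrier V"
      using Uc(1) Sc(1) by (auto simp: set_add_iff intro!: a_closed)
    show "\<zero> \<in> U <+>\<^bsub>V\<^esub> span A"
      using Uc(2) Sc(2) by (force simp: set_add_iff)
    show "v \<oplus> w \<in> U <+>\<^bsub>V\<^esub> span A" if vw: "v \<in> U <+>\<^bsub>V\<^esub> span A" "w \<in> U <+>\<^bsub>V\<^esub> span A" for v w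
    proof -
      obtain a b a' b' where *: "a \<in> U" "b \<in> span A" "v = a \<oplus> b" "a' \<in> U" "b' \<in> span A" "w = a' \<oplus> b'"
        using vw by (auto simp: set_add_iff)
      then have "v \<oplus> w = (a \<oplus> a') \<oplus> (b \<oplus> b')"
        using Uc(1) Sc(1) by (simp add: a_ac subset_iff)
      then show ?thesis
        unfolding set_add_iff using *(1,2,4,5) Uc(3)[of a a'] Sc(3)[of b b'] by blast
    qed
    show "t \<odot> v \<in> U <+>\<^bsub>V\<^esub> span A" if v: "v \<in> U <+>\<^bsub>V\<^esub> span A" for t v
    proof -
      obtain a b where *: "a \<in> U" "b \<in> span A" "v = a \<oplus> b"
        using v by (auto simp: set_add_iff)
      then have "t \<odot> v = t \<odot> a \<oplus> t \<odot> b"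
        using Uc(1) Sc(1) by (simp add: vs_distrib(2) subset_iff)
      then show ?thesis
        unfolding set_add_iff using *(1,2) Uc(4)[of a t] Sc(4)[of b t] by blast
    qed
  qed
  have "d \<in> U <+>\<^bsub>V\<^esub> span A" if d: "d \<in> D" for d
  proof (rule ccontr)
    assume d': "d \<notin> U <+>\<^bsub>V\<^esub> span A"
    have dc: "d \<in> carrier V"
      using d Dc by auto
    have "s \<in> U <+>\<^bsub>V\<^esub> span A" if "s \<in> span A" for s
      using that Uc(2) Sc(1) l_zero[of s] by (force simp: set_add_iff)
    then have dA: "d \<notin> A"
      using d' in_own_span[OF Ac] by blast
    have "U \<inter> span (insert d A) \<subseteq> {\<zero>}"
    proof
      fix x assume x: "x \<in> U \<inter> span (insert d A)"
      have fin: "finite A"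
        using A D(1) by (auto intro: finite_subset)
      obtain a where a: "x = lincomb a (A \<union> {d})"
        using x finite_span[of "insert d A"] fin Ac dc by auto
      define s where "s = lincomb a A"
      have s: "s \<in> span A"
        using fin by (auto simp: in_span_iff s_def)
      have sc: "s \<in> carrier V" and xc: "x \<in> carrier V"
        using s Sc(1) x Uc(1) by auto
      have xs: "x = a d \<odot> d \<oplus> s"
        unfolding a s_def using fin Ac dA dc by (intro lincomb_insert) auto
      show "x \<in> {\<zero>}"
      proof (cases "a d = 0")
        case True
        then have "x \<in> U \<inter> span A"
          using x xs s sc dc by simp
        then show ?thesis
          using A by auto
      next
        case False
        have "a d \<odot> d = x \<oplus> (- 1) \<odot> s"
          using xs sc dc by (simp add: vs_minus_one a_assoc r_neg)
        then have "inverse (a d) \<odot> (a d \<odot> d) = inverse (a d) \<odot> x \<oplus> inverse (a d) \<odot> ((- 1) \<odot> s)"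
          using xc sc by (simp add: vs_distrib(2))
        then have "d = inverse (a d) \<odot> x \<oplus> inverse (a d) \<odot> ((- 1) \<odot> s)"
          using False dc by (simp flip: vs_distrib(3))
        then have "d \<in> U <+>\<^bsub>V\<^esub> span A"
          unfolding set_add_iff using x Uc(4) Sc(4)[OF Sc(4)[OF s]] by blast
        then show ?thesis
          using d' by simp
      qed
    qed
    moreover have "\<zero> \<in> U \<inter> span (insert d A)"
      using Uc(2) subspace_closed(2)[OF span_is_subspace[of "insert d A"]] Ac dc by auto
    ultimately have "?P (insert d A)"
      using A d by auto
    then show False
      using max[of "insert d A"] dA by auto
  qed
  then have "span D \<subseteq> U <+>\<^bsub>V\<^esub> span A"
    using sum by (intro span_is_subset) auto
  then have "U <+>\<^bsub>V\<^esub> span A = carrier V"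
    using subspace_closed(1)[OF sum] D(3) by auto
  then show "\<exists>U'. VectorSpace.subspace class_ring U' V \<and> f ` U' \<subseteq> U' \<and> U \<inter> U' = {\<zero>} \<and> U <+>\<^bsub>V\<^esub> U' = carrier V"
    using S span_eigenvectors_invariant[OF f, of A] A D(2) by (intro exI[of _ "span A"]) auto
qed

end

text \<open>Take a polynomial that annihilates some nonzero \<open>u \<in> U\<close>, and a root \<open>a\<close> of it. Either \<open>u\<close> is an
  eigenvector for \<open>a\<close>, or \<open>(f - a) u \<in> U\<close> is nonzero and annihilated by a polynomial of smaller degree.\<close>

lemma (in vspace) exists_eigenvector:
  fixes f
  assumes closed: "\<And>p::'k poly. degree p > 0 \<Longrightarrow> \<exists>a. poly p a = 0"
    and fd: fin_dim and f: "f \<in> carrier (End V)"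
    and U: "VectorSpace.subspace class_ring U V" "f ` U \<subseteq> U" and u: "u \<in> U" "u \<noteq> \<zero>"
  shows "U \<inter> eigenvectors f \<noteq> {}"
proof -
  note Uc = subspace_closed[OF U(1)]
  have "U \<inter> eigenvectors f \<noteq> {}" if "p \<noteq> 0" "u \<in> U" "u \<noteq> \<zero>" "op_poly V p f u = \<zero>" for p u
    using that
  proof (induction "degree p" arbitrary: p u rule: less_induct)
    case less
    have uc: "u \<in> carrier V"
      using less.prems Uc by auto
    have "degree p \<noteq> 0"
    proof
      assume "degree p = 0"
      then obtain a where p: "p = [:a:]" by (elim degree_eq_zeroE)
      have "a \<odot> u = \<zero>"
        using less.prems(4) f uc by (simp add: p op_poly_pCons)
      then have "inverse a \<odot> (a \<odot> u) = \<zero>" by simp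
      then show False
        using less.prems(1,3) uc by (simp add: p flip: vs_distrib(3))
    qed
    then obtain a where "poly p a = 0"
      using closed by auto
    then obtain r where r: "p = [:- a, 1:] * r"
      by (auto simp: poly_eq_0_iff_dvd)
    then have r0: "r \<noteq> 0"
      using less.prems(1) by auto
    then have deg: "degree r < degree p"
      unfolding r by (subst degree_mult_eq) auto
    let ?w = "f u \<oplus> (- a) \<odot> u"
    show ?case
    proof (cases "?w = \<zero>")
      case True
      have "f u = ?w \<oplus> a \<odot> u"
        using uc f vs_distrib(1)[of u "- a" a] by (simp add: a_assoc)
      then have "f u = a \<odot> u"
        using True uc by simp
      then show ?thesis
        using uc less.prems by (auto simp: eigenvectors_def)
    next
      case False
      moreover have "?w \<in> U"
        using U(2) less.prems(2) Uc by blast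
      moreover have "op_poly V r f ?w = \<zero>"
        using less.prems(4) op_poly_linear_factor[OF f uc, of a r] by (simp add: r)
      ultimately show ?thesis
        using less.hyps[OF deg r0] by blast
    qed
  qed
  moreover obtain p where "p \<noteq> 0" "op_poly V p f u = \<zero>"
    using annihilating_polynomial[OF fd f] u(1) Uc(1) by blast
  ultimately show ?thesis
    using u by blast
qed

text \<open>The span of all eigenvectors is everything: an invariant complement without eigenvectors
  is zero. A maximal independent set of eigenvectors is then a basis.\<close>

lemma (in vspace) semisimple_eigenbasis:
  fixes f
  assumes closed: "\<And>p::'k poly. degree p > 0 \<Longrightarrow> \<exists>a. poly p a = 0"
    and fd: fin_dim and f: "f \<in> carrier (End V)" and ss: "semisimple V f"
  obtains B \<nu> where "finite B" "basis B" "\<And>b. b \<in> B \<Longrightarrow> f b = \<nu> b \<odot> b"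
proof -
  let ?E = "eigenvectors f"
  have Ec: "?E \<subseteq> carrier V"
    by (auto simp: eigenvectors_def)
  obtain U where U: "VectorSpace.subspace class_ring U V" "f ` U \<subseteq> U" "span ?E \<inter> U = {\<zero>}" "span ?E <+>\<^bsub>V\<^esub> U = carrier V"
    using ss span_is_subspace[OF Ec] span_eigenvectors_invariant[OF f order_refl]
    unfolding semisimple_def by blast
  have "u = \<zero>" if u: "u \<in> U" for u
  proof (rule ccontr)
    assume "u \<noteq> \<zero>"
    then have "U \<inter> ?E \<noteq> {}"
      by (intro exists_eigenvector[OF _ fd f U(1,2) u] closed)
    then show False
      using U(3) in_own_span[OF Ec] by (auto simp: eigenvectors_def)
  qed
  then have span: "span ?E = carrier V"
    using U(4) subspace_closed(1)[OF span_is_subspace[OF Ec]] by (force simp: set_add_iff)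
  let ?P = "\<lambda>A. A \<subseteq> ?E \<and> lin_indpt A"
  have "finite A \<and> card A \<le> dim" if "?P A" for A
    using that Ec li_le_dim[OF fd, of A] by auto
  moreover have "?P {}"
    by (auto simp: lin_dep_def)
  ultimately obtain B where B: "finite B" "?P B" and max: "\<And>A. B \<subseteq> A \<Longrightarrow> ?P A \<Longrightarrow> A = B"
    using maximal_exists[of ?P dim "{}"] unfolding maximal_def by (metis (no_types, lifting))
  have Bc: "B \<subseteq> carrier V"
    using B Ec by auto
  have "v \<in> span B" if v: "v \<in> ?E" for v
  proof (rule ccontr)
    assume "v \<notin> span B"
    moreover from this have "v \<notin> B"
      using in_own_span[OF Bc] by auto
    ultimately have "?P (B \<union> {v})"
      using lin_dep_iff_in_span[OF Bc] B v Ec by blast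
    then show False
      using max[of "B \<union> {v}"] \<open>v \<notin> B\<close> by auto
  qed
  then have "span ?E \<subseteq> span B"
    using span_is_submodule[OF Bc] by (intro span_is_subset) auto
  then have "basis B"
    using B Bc span span_is_subset2[OF Bc] by (auto simp: basis_def)
  moreover obtain \<nu> where "\<forall>b\<in>B. f b = \<nu> b \<odot> b"
    using eigenvectors_eigenvalues B(2) by blast
  ultimately show ?thesis
    using B(1) that by blast
qed

section \<open>Representations of Hecke algebras from operators\<close>

lemma free_algebra_simps:
  "f \<in> carrier (free_algebra n) \<longleftrightarrow> finite {w. f w \<noteq> 0} \<and> {w. f w \<noteq> 0} \<subseteq> lists {1..<n}"
  "f \<otimes>\<^bsub>free_algebra n\<^esub> h = (\<lambda>w. \<Sum>i\<le>length w. f (take i w) * h (drop i w))"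
  "\<one>\<^bsub>free_algebra n\<^esub> = monomial []" "\<zero>\<^bsub>free_algebra n\<^esub> = (\<lambda>w. 0)"
  "f \<oplus>\<^bsub>free_algebra n\<^esub> h = (\<lambda>w. f w + h w)" "a \<odot>\<^bsub>free_algebra n\<^esub> f = (\<lambda>w. a * f w)"
  by (simp_all add: free_algebra_def monomial_def)

lemma convolution_support:
  fixes f h :: "'a list \<Rightarrow> 'k::field"
  shows "{w. (\<Sum>i\<le>length w. f (take i w) * h (drop i w)) \<noteq> 0} \<subseteq>
    (\<lambda>(u, v). u @ v) ` ({w. f w \<noteq> 0} \<times> {w. h w \<noteq> 0})"
proof
  fix w assume "w \<in> {w. (\<Sum>i\<le>length w. f (take i w) * h (drop i w)) \<noteq> 0}"
  then have "(\<Sum>i\<le>length w. f (take i w) * h (drop i w)) \<noteq> 0"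
    by simp
  then obtain i where "f (take i w) * h (drop i w) \<noteq> 0"
    by (rule sum.not_neutral_contains_not_neutral)
  then show "w \<in> (\<lambda>(u, v). u @ v) ` ({w. f w \<noteq> 0} \<times> {w. h w \<noteq> 0})"
    by (intro image_eqI[of _ _ "(take i w, drop i w)"]) auto
qed

lemma append_image_lists:
  assumes "A \<subseteq> lists X" "B \<subseteq> lists X"
  shows "(\<lambda>(u, v). u @ v) ` (A \<times> B) \<subseteq> lists X"
proof
  fix w assume "w \<in> (\<lambda>(u, v). u @ v) ` (A \<times> B)"
  then obtain u v where "w = u @ v" "u \<in> A" "v \<in> B"
    by auto
  then show "w \<in> lists X"
    using subsetD[OF assms(1), of u] subsetD[OF assms(2), of v] by simp
qed

lemma free_algebra_closed:
  assumes f: "f \<in> carrier (free_algebra n)"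
  shows "h \<in> carrier (free_algebra n) \<Longrightarrow> f \<oplus>\<^bsub>free_algebra n\<^esub> h \<in> carrier (free_algebra n)"
    and "h \<in> carrier (free_algebra n) \<Longrightarrow> f \<otimes>\<^bsub>free_algebra n\<^esub> h \<in> carrier (free_algebra n)"
    and "a \<odot>\<^bsub>free_algebra n\<^esub> f \<in> carrier (free_algebra n)"
proof -
  show "f \<oplus>\<^bsub>free_algebra n\<^esub> h \<in> carrier (free_algebra n)" if h: "h \<in> carrier (free_algebra n)"
  proof -
    have "{w. f w + h w \<noteq> 0} \<subseteq> {w. f w \<noteq> 0} \<union> {w. h w \<noteq> 0}"
      by auto
    then show ?thesis
      using f h unfolding free_algebra_simps by (meson finite_Un finite_subset subset_trans sup.boundedI)
  qed
  show "f \<otimes>\<^bsub>free_algebra n\<^esub> h \<in> carrier (free_algebra n)" if h: "h \<in> carrier (free_algebra n)"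
  proof -
    let ?P = "(\<lambda>(u, v). u @ v) ` ({w. f w \<noteq> 0} \<times> {w. h w \<noteq> 0})"
    have "{w. (\<Sum>i\<le>length w. f (take i w) * h (drop i w)) \<noteq> 0} \<subseteq> ?P"
      by (rule convolution_support)
    moreover have "finite ?P" "?P \<subseteq> lists {1..<n}"
      using f h append_image_lists[of "{w. f w \<noteq> 0}" "{1..<n}" "{w. h w \<noteq> 0}"]
      by (simp_all add: free_algebra_simps)
    ultimately show ?thesis
      unfolding free_algebra_simps by (meson finite_subset subset_trans)
  qed
  have "{w. a * f w \<noteq> 0} \<subseteq> {w. f w \<noteq> 0}"
    by auto
  then show "a \<odot>\<^bsub>free_algebra n\<^esub> f \<in> carrier (free_algebra n)"
    using f unfolding free_algebra_simps by (meson finite_subset subset_trans)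
qed

lemma monomial_closed: "u \<in> lists {1..<n} \<Longrightarrow> monomial u \<in> carrier (free_algebra n)"
  by (auto simp: free_algebra_simps monomial_def)

lemma free_algebra_assoc:
  "(f \<otimes>\<^bsub>free_algebra n\<^esub> g) \<otimes>\<^bsub>free_algebra n\<^esub> h = f \<otimes>\<^bsub>free_algebra n\<^esub> (g \<otimes>\<^bsub>free_algebra n\<^esub> h)"
proof
  fix w
  have "(\<Sum>i\<le>length w. (\<Sum>j\<le>length (take i w). f (take j (take i w)) * g (drop j (take i w))) * h (drop i w)) =
    (\<Sum>(i, j)\<in>Sigma {..length w} (\<lambda>i. {..i}). f (take j w) * g (drop j (take i w)) * h (drop i w))"
    by (subst sum.Sigma[symmetric]) (auto simp: sum_distrib_right min_def intro!: sum.cong)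
  also have "\<dots> = (\<Sum>(j, k)\<in>Sigma {..length w} (\<lambda>j. {..length w - j}).
      f (take j w) * g (take k (drop j w)) * h (drop k (drop j w)))"
    by (rule sum.reindex_bij_witness[of _ "\<lambda>(j, k). (j + k, j)" "\<lambda>(i, j). (j, i - j)"])
      (auto simp: drop_take add.commute)
  also have "\<dots> = (\<Sum>j\<le>length w. f (take j w) *
      (\<Sum>k\<le>length (drop j w). g (take k (drop j w)) * h (drop k (drop j w))))"
    by (subst sum.Sigma[symmetric]) (auto simp: sum_distrib_left mult.assoc intro!: sum.cong)
  finally show "((f \<otimes>\<^bsub>free_algebra n\<^esub> g) \<otimes>\<^bsub>free_algebra n\<^esub> h) w = (f \<otimes>\<^bsub>free_algebra n\<^esub> (g \<otimes>\<^bsub>free_algebra n\<^esub> h)) w"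
    by (simp add: free_algebra_simps)
qed

lemma free_algebra_one:
  "\<one>\<^bsub>free_algebra n\<^esub> \<otimes>\<^bsub>free_algebra n\<^esub> f = f" "f \<otimes>\<^bsub>free_algebra n\<^esub> \<one>\<^bsub>free_algebra n\<^esub> = f"
proof -
  have "(\<Sum>i\<le>length w. monomial [] (take i w) * f (drop i w)) = f w" for w
  proof -
    have "(\<Sum>i\<le>length w. monomial [] (take i w) * f (drop i w)) = (\<Sum>i\<le>length w. if i = 0 then f w else 0)"
      by (intro sum.cong) (auto simp: monomial_def)
    then show ?thesis by simp
  qed
  moreover have "(\<Sum>i\<le>length w. f (take i w) * monomial [] (drop i w)) = f w" for w
  proof -
    have "(\<Sum>i\<le>length w. f (take i w) * monomial [] (drop i w)) = (\<Sum>i\<le>length w. if i = length w then f w else 0)"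
      by (intro sum.cong) (auto simp: monomial_def)
    then show ?thesis by simp
  qed
  ultimately show "\<one>\<^bsub>free_algebra n\<^esub> \<otimes>\<^bsub>free_algebra n\<^esub> f = f" "f \<otimes>\<^bsub>free_algebra n\<^esub> \<one>\<^bsub>free_algebra n\<^esub> = f"
    by (simp_all add: free_algebra_simps)
qed

lemma free_algebra_ring: "ring (free_algebra n :: ('k::field, nat list \<Rightarrow> 'k) module)"
proof (intro ringI abelian_groupI monoidI)
  let ?F = "free_algebra n :: ('k, nat list \<Rightarrow> 'k) module"
  show "\<exists>h\<in>carrier ?F. h \<oplus>\<^bsub>?F\<^esub> f = \<zero>\<^bsub>?F\<^esub>" if "f \<in> carrier ?F" for f
    using free_algebra_closed(3)[OF that, of "- 1"] by (rule bexI[rotated]) (simp add: free_algebra_simps)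
  show "\<one>\<^bsub>?F\<^esub> \<in> carrier ?F"
    by (simp add: free_algebra_simps(3) monomial_closed)
  show "\<zero>\<^bsub>?F\<^esub> \<in> carrier ?F"
    by (simp add: free_algebra_simps)
qed (simp_all add: free_algebra_closed free_algebra_assoc free_algebra_one,
    simp_all add: free_algebra_simps algebra_simps sum.distrib)

text \<open>Summing over the words \<open>w\<close> and their factorisations is summing over pairs of factors. This is what
  makes the evaluation of noncommutative polynomials multiplicative.\<close>

lemma convolution_sum:
  fixes f h m :: "'a list \<Rightarrow> 'k::field"
  assumes A: "finite A" "{w. f w \<noteq> 0} \<subseteq> A" and B: "finite B" "{w. h w \<noteq> 0} \<subseteq> B"
  shows "(\<Sum>w\<in>(\<lambda>(u, v). u @ v) ` (A \<times> B). (\<Sum>i\<le>length w. f (take i w) * h (drop i w)) * m w) =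
    (\<Sum>u\<in>A. \<Sum>v\<in>B. f u * (h v * m (u @ v)))"
proof -
  define P where "P = (\<lambda>(u, v). u @ v) ` (A \<times> B)"
  have finP: "finite P" and inP: "\<And>u v. u \<in> A \<Longrightarrow> v \<in> B \<Longrightarrow> u @ v \<in> P"
    using A B by (auto simp: P_def)
  let ?S = "Sigma P (\<lambda>w. {..length w})"
  have "(\<Sum>w\<in>P. (\<Sum>i\<le>length w. f (take i w) * h (drop i w)) * m w) =
    (\<Sum>(w, i)\<in>?S. f (take i w) * h (drop i w) * m w)"
    using finP by (subst sum.Sigma[symmetric]) (auto simp: sum_distrib_right)
  also have "\<dots> = (\<Sum>(u, v)\<in>A \<times> B. f u * h v * m (u @ v))"
  proof (rule sum.reindex_bij_witness_not_neutral[where S' = "{p \<in> ?S. f (take (snd p) (fst p)) * h (drop (snd p) (fst p)) = 0}"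
        and T' = "{p \<in> A \<times> B. f (fst p) * h (snd p) = 0}"
        and i = "\<lambda>(u, v). (u @ v, length u)" and j = "\<lambda>(w, i). (take i w, drop i w)"])
    show "finite {p \<in> ?S. f (take (snd p) (fst p)) * h (drop (snd p) (fst p)) = 0}"
      using finP by (intro finite_subset[OF _ finite_SigmaI[OF finP, of "\<lambda>w. {..length w}"]]) auto
    show "finite {p \<in> A \<times> B. f (fst p) * h (snd p) = 0}"
      using A B by (intro finite_subset[OF _ finite_cartesian_product[OF A(1) B(1)]]) auto
  qed (use A(2) B(2) inP in \<open>auto simp: min_def\<close>)
  also have "\<dots> = (\<Sum>u\<in>A. \<Sum>v\<in>B. f u * (h v * m (u @ v)))"
    by (simp add: sum.cartesian_product mult.assoc)
  finally show ?thesis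
    by (simp add: P_def)
qed

lemma (in vspace) End_one_smult [simp]: "f \<in> carrier (End V) \<Longrightarrow> 1 \<odot>\<^bsub>End V\<^esub> f = f"
  by (rule End_eqI) auto

locale hecke_images = coords V I \<phi>
  for V :: "('k::field, 'v, 'm) module_scheme" (structure) and I :: "'i set" and \<phi> +
  fixes n :: nat and q :: 'k and A :: "nat \<Rightarrow> 'v \<Rightarrow> 'v"
  assumes A_in: "i \<in> {1..<n} \<Longrightarrow> A i \<in> carrier (End V)"
    and far: "i \<in> {1..<n} \<Longrightarrow> j \<in> {1..<n} \<Longrightarrow> i + 2 \<le> j \<Longrightarrow> A i \<otimes>\<^bsub>End V\<^esub> A j = A j \<otimes>\<^bsub>End V\<^esub> A i"
    and near: "i \<in> {1..<n} \<Longrightarrow> i + 1 \<in> {1..<n} \<Longrightarrow>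
      A i \<otimes>\<^bsub>End V\<^esub> A (i + 1) \<otimes>\<^bsub>End V\<^esub> A i = A (i + 1) \<otimes>\<^bsub>End V\<^esub> A i \<otimes>\<^bsub>End V\<^esub> A (i + 1)"
    and quadratic: "i \<in> {1..<n} \<Longrightarrow>
      (A i \<ominus>\<^bsub>End V\<^esub> \<one>\<^bsub>End V\<^esub>) \<otimes>\<^bsub>End V\<^esub> (A i \<oplus>\<^bsub>End V\<^esub> q \<odot>\<^bsub>End V\<^esub> \<one>\<^bsub>End V\<^esub>) = \<zero>\<^bsub>End V\<^esub>"
begin

abbreviation "F \<equiv> free_algebra n :: ('k, nat list \<Rightarrow> 'k) module"

definition word_op :: "nat list \<Rightarrow> 'v \<Rightarrow> 'v" where
  "word_op w = foldr (\<lambda>i f. A i \<otimes>\<^bsub>End V\<^esub> f) w \<one>\<^bsub>End V\<^esub>"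

lemma word_op_simps [simp]: "word_op [] = \<one>\<^bsub>End V\<^esub>" "word_op (i # w) = A i \<otimes>\<^bsub>End V\<^esub> word_op w"
  by (simp_all add: word_op_def)

lemma word_op_closed: "w \<in> lists {1..<n} \<Longrightarrow> word_op w \<in> carrier (End V)"
  by (induction w) (auto simp: A_in)

lemma word_op_append:
  "u \<in> lists {1..<n} \<Longrightarrow> w \<in> lists {1..<n} \<Longrightarrow> word_op (u @ w) = word_op u \<otimes>\<^bsub>End V\<^esub> word_op w"
proof (induction u)
  case (Cons i u)
  then show ?case
    using A_in[of i] word_op_closed[of u] word_op_closed[of w] by (simp add: E.m_assoc)
qed (simp add: word_op_closed)

definition eval :: "(nat list \<Rightarrow> 'k) \<Rightarrow> 'v \<Rightarrow> 'v" where
  "eval f = (\<Oplus>\<^bsub>End V\<^esub>w\<in>{w. f w \<noteq> 0}. f w \<odot>\<^bsub>End V\<^esub> word_op w)"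

lemma word_op_in_support: "f \<in> carrier F \<Longrightarrow> f w \<noteq> 0 \<Longrightarrow> word_op w \<in> carrier (End V)"
  unfolding free_algebra_simps by (intro word_op_closed) blast

lemma eval_closed: "f \<in> carrier F \<Longrightarrow> eval f \<in> carrier (End V)"
  unfolding eval_def by (rule E.finsum_closed) (auto simp: word_op_in_support)

lemma eval_apply:
  assumes "f \<in> carrier F" "v \<in> carrier V" "finite D" "{w. f w \<noteq> 0} \<subseteq> D" "D \<subseteq> lists {1..<n}"
  shows "eval f v = (\<Oplus>w\<in>D. f w \<odot> word_op w v)"
proof -
  have closed: "word_op w \<in> carrier (End V)" if "w \<in> D" for w
    using subsetD[OF assms(5) that] by (rule word_op_closed)
  have "eval f v = (\<Oplus>w\<in>{w. f w \<noteq> 0}. f w \<odot> word_op w v)"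
    unfolding eval_def using assms(1,2) by (subst End_finsum_apply) (auto simp: word_op_in_support)
  also have "\<dots> = (\<Oplus>w\<in>D. f w \<odot> word_op w v)"
    using assms(1-4) closed
    by (intro add.finprod_mono_neutral_cong_left) (auto simp: word_op_in_support)
  finally show ?thesis .
qed

lemma coord_eval:
  assumes "f \<in> carrier F" "v \<in> carrier V" "finite D" "{w. f w \<noteq> 0} \<subseteq> D" "D \<subseteq> lists {1..<n}" "k \<in> I"
  shows "\<phi> (eval f v) k = (\<Sum>w\<in>D. f w * \<phi> (word_op w v) k)"
proof -
  have word: "word_op w v \<in> carrier V" if "w \<in> D" for w
    using word_op_closed[OF subsetD[OF assms(5) that]] assms(2) by (rule End_closed)
  then show ?thesis
    unfolding eval_apply[OF assms(1-5)] using assms(6)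
    by (subst coord_finsum) (auto simp: coord_smult intro!: sum.cong)
qed

text \<open>Products are compared coordinate by coordinate, where evaluation becomes a sum in the field and
  \<open>convolution_sum\<close> applies.\<close>

lemma eval_ring_hom: "eval \<in> Ring.ring_hom F (End V)"
proof (rule ring_hom_memI)
  show "eval f \<in> carrier (End V)" if "f \<in> carrier F" for f
    using that by (rule eval_closed)
next
  fix f h assume f: "f \<in> carrier F" and h: "h \<in> carrier F"
  let ?A = "{w. f w \<noteq> 0}" and ?B = "{w. h w \<noteq> 0}"
  have fin: "finite ?A" "finite ?B" "?A \<subseteq> lists {1..<n}" "?B \<subseteq> lists {1..<n}"
    using f h by (auto simp: free_algebra_simps)
  note closed = free_algebra_closed(1,2)[OF f h] eval_closed[OF f] eval_closed[OF h]
    eval_closed[OF free_algebra_closed(1)[OF f h]] eval_closed[OF free_algebra_closed(2)[OF f h]]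
  show "eval (f \<oplus>\<^bsub>F\<^esub> h) = eval f \<oplus>\<^bsub>End V\<^esub> eval h"
  proof (rule End_eqI)
    fix v assume v: "v \<in> carrier V"
    show "eval (f \<oplus>\<^bsub>F\<^esub> h) v = (eval f \<oplus>\<^bsub>End V\<^esub> eval h) v"
    proof (rule coord_eqI)
      fix k assume k: "k \<in> I"
      have "\<phi> (eval (f \<oplus>\<^bsub>F\<^esub> h) v) k = (\<Sum>w\<in>?A \<union> ?B. (f \<oplus>\<^bsub>F\<^esub> h) w * \<phi> (word_op w v) k)"
        using fin by (intro coord_eval closed v k) (auto simp: free_algebra_simps)
      also have "\<dots> = (\<Sum>w\<in>?A \<union> ?B. f w * \<phi> (word_op w v) k) + (\<Sum>w\<in>?A \<union> ?B. h w * \<phi> (word_op w v) k)"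
        by (simp add: free_algebra_simps algebra_simps sum.distrib)
      also have "(\<Sum>w\<in>?A \<union> ?B. f w * \<phi> (word_op w v) k) = \<phi> (eval f v) k"
        using fin by (intro coord_eval[symmetric] f v k) auto
      also have "(\<Sum>w\<in>?A \<union> ?B. h w * \<phi> (word_op w v) k) = \<phi> (eval h v) k"
        using fin by (intro coord_eval[symmetric] h v k) auto
      finally show "\<phi> (eval (f \<oplus>\<^bsub>F\<^esub> h) v) k = \<phi> ((eval f \<oplus>\<^bsub>End V\<^esub> eval h) v) k"
        using v k closed by (simp add: coord_add)
    qed (use v closed in auto)
  qed (use closed in auto)
  show "eval (f \<otimes>\<^bsub>F\<^esub> h) = eval f \<otimes>\<^bsub>End V\<^esub> eval h"
  proof (rule End_eqI)
    fix v assume v: "v \<in> carrier V"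
    show "eval (f \<otimes>\<^bsub>F\<^esub> h) v = (eval f \<otimes>\<^bsub>End V\<^esub> eval h) v"
    proof (rule coord_eqI)
      fix k assume k: "k \<in> I"
      let ?P = "(\<lambda>(u, v). u @ v) ` (?A \<times> ?B)"
      have P: "{w. (f \<otimes>\<^bsub>F\<^esub> h) w \<noteq> 0} \<subseteq> ?P"
        unfolding free_algebra_simps by (rule convolution_support)
      have "\<phi> (eval (f \<otimes>\<^bsub>F\<^esub> h) v) k = (\<Sum>w\<in>?P. (f \<otimes>\<^bsub>F\<^esub> h) w * \<phi> (word_op w v) k)"
        using fin P append_image_lists[OF fin(3,4)] by (intro coord_eval closed v k) simp_all
      also have "\<dots> = (\<Sum>u\<in>?A. \<Sum>w\<in>?B. f u * (h w * \<phi> (word_op (u @ w) v) k))"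
        unfolding free_algebra_simps by (rule convolution_sum) (use fin in auto)
      also have "\<dots> = (\<Sum>u\<in>?A. f u * \<phi> (word_op u (eval h v)) k)"
      proof (rule sum.cong[OF HOL.refl])
        fix u assume u: "u \<in> ?A"
        have uE: "word_op u \<in> carrier (End V)"
          using f u by (simp add: word_op_in_support)
        have wE: "word_op w v \<in> carrier V" if "w \<in> ?B" for w
          using that h v by (simp add: word_op_in_support)
        have "word_op u (eval h v) = (\<Oplus>w\<in>?B. word_op u (h w \<odot> word_op w v))"
          unfolding eval_apply[OF h v fin(2) order_refl fin(4)]
          using uE wE by (subst End_finsum) auto
        also have "\<phi> \<dots> k = (\<Sum>w\<in>?B. \<phi> (word_op u (h w \<odot> word_op w v)) k)"
          using uE wE k by (intro coord_finsum) auto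
        also have "\<dots> = (\<Sum>w\<in>?B. h w * \<phi> (word_op (u @ w) v) k)"
        proof (rule sum.cong[OF HOL.refl])
          fix w assume w: "w \<in> ?B"
          have "word_op (u @ w) = word_op u \<otimes>\<^bsub>End V\<^esub> word_op w"
            using u w fin by (intro word_op_append) auto
          then show "\<phi> (word_op u (h w \<odot> word_op w v)) k = h w * \<phi> (word_op (u @ w) v) k"
            using uE wE[OF w] v k by (simp add: coord_smult)
        qed
        finally show "(\<Sum>w\<in>?B. f u * (h w * \<phi> (word_op (u @ w) v) k)) = f u * \<phi> (word_op u (eval h v)) k"
          by (simp add: sum_distrib_left)
      qed
      also have "\<dots> = \<phi> (eval f (eval h v)) k"
        using fin closed v by (intro coord_eval[symmetric] f k) auto
      finally show "\<phi> (eval (f \<otimes>\<^bsub>F\<^esub> h) v) k = \<phi> ((eval f \<otimes>\<^bsub>End V\<^esub> eval h) v) k"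
        using v by simp
    qed (use v closed in auto)
  qed (use closed in auto)
next
  show "eval \<one>\<^bsub>F\<^esub> = \<one>\<^bsub>End V\<^esub>"
    by (simp add: eval_def free_algebra_simps monomial_def)
qed

lemma eval_smult:
  assumes f: "f \<in> carrier F"
  shows "eval (a \<odot>\<^bsub>F\<^esub> f) = a \<odot>\<^bsub>End V\<^esub> eval f"
proof (rule End_eqI)
  let ?A = "{w. f w \<noteq> 0}"
  have fin: "finite ?A" "?A \<subseteq> lists {1..<n}"
    using f by (auto simp: free_algebra_simps)
  note closed = free_algebra_closed(3)[OF f, of a] eval_closed[OF f]
  then show "eval (a \<odot>\<^bsub>F\<^esub> f) \<in> carrier (End V)" "a \<odot>\<^bsub>End V\<^esub> eval f \<in> carrier (End V)"
    by (auto simp: eval_closed)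
  fix v assume v: "v \<in> carrier V"
  show "eval (a \<odot>\<^bsub>F\<^esub> f) v = (a \<odot>\<^bsub>End V\<^esub> eval f) v"
  proof (rule coord_eqI)
    fix k assume k: "k \<in> I"
    have "\<phi> (eval (a \<odot>\<^bsub>F\<^esub> f) v) k = (\<Sum>w\<in>?A. (a \<odot>\<^bsub>F\<^esub> f) w * \<phi> (word_op w v) k)"
      using fin by (intro coord_eval closed v k) (auto simp: free_algebra_simps)
    also have "\<dots> = a * \<phi> (eval f v) k"
      unfolding coord_eval[OF f v fin(1) order_refl fin(2) k]
      by (simp add: free_algebra_simps sum_distrib_left mult.assoc)
    finally show "\<phi> (eval (a \<odot>\<^bsub>F\<^esub> f) v) k = \<phi> ((a \<odot>\<^bsub>End V\<^esub> eval f) v) k"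
      using v k closed by (simp add: coord_smult)
  qed (use v closed in \<open>auto simp: eval_closed\<close>)
qed

lemma eval_monomial: "u \<in> lists {1..<n} \<Longrightarrow> eval (monomial u) = word_op u"
  by (simp add: eval_def monomial_def word_op_closed)

sublocale eval: ring_hom_ring F "End V" eval
  by (rule ring_hom_ringI2[OF free_algebra_ring E.ring_axioms eval_ring_hom])

lemma relators_closed: "hecke_relators n q \<subseteq> carrier F"
  unfolding hecke_relators_def
  by (auto intro!: eval.R.minus_closed monomial_closed free_algebra_closed eval.R.m_closed eval.R.a_closed eval.R.one_closed)

lemma eval_relators:
  assumes "r \<in> hecke_relators n q"
  shows "eval r = \<zero>\<^bsub>End V\<^esub>"
proof -
  have minus: "eval (f \<ominus>\<^bsub>F\<^esub> h) = eval f \<ominus>\<^bsub>End V\<^esub> eval h" if "f \<in> carrier F" "h \<in> carrier F" for f h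
    using that by (simp add: a_minus_def eval.hom_a_inv)
  have zero: "f \<ominus>\<^bsub>End V\<^esub> h = \<zero>\<^bsub>End V\<^esub>" if "f = h" "h \<in> carrier (End V)" for f h
    using that by (simp add: a_minus_def E.r_neg)
  consider (far) i j where "i \<in> {1..<n}" "j \<in> {1..<n}" "i + 2 \<le> j" "r = monomial [i, j] \<ominus>\<^bsub>F\<^esub> monomial [j, i]"
    | (near) i where "i \<in> {1..<n}" "i + 1 \<in> {1..<n}" "r = monomial [i, i + 1, i] \<ominus>\<^bsub>F\<^esub> monomial [i + 1, i, i + 1]"
    | (quadratic) i where "i \<in> {1..<n}" "r = (monomial [i] \<ominus>\<^bsub>F\<^esub> \<one>\<^bsub>F\<^esub>) \<otimes>\<^bsub>F\<^esub> (monomial [i] \<oplus>\<^bsub>F\<^esub> q \<odot>\<^bsub>F\<^esub> \<one>\<^bsub>F\<^esub>)"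
    using assms unfolding hecke_relators_def by blast
  then show ?thesis
  proof cases
    case far
    note A = A_in[OF far(1)] A_in[OF far(2)]
    have l: "[i, j] \<in> lists {1..<n}" "[j, i] \<in> lists {1..<n}"
      using far by auto
    show ?thesis
      unfolding far(4) minus[OF monomial_closed[OF l(1)] monomial_closed[OF l(2)]] eval_monomial[OF l(1)] eval_monomial[OF l(2)]
      using A hecke_images.far[OF hecke_images_axioms far(1-3)] by (intro zero) auto
  next
    case near
    note A = A_in[OF near(1)] A_in[OF near(2)]
    have l: "[i, i + 1, i] \<in> lists {1..<n}" "[i + 1, i, i + 1] \<in> lists {1..<n}"
      using near by auto
    show ?thesis
      unfolding near(3) minus[OF monomial_closed[OF l(1)] monomial_closed[OF l(2)]] eval_monomial[OF l(1)] eval_monomial[OF l(2)]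
      using A hecke_images.near[OF hecke_images_axioms near(1,2)] by (intro zero) (auto simp: E.m_assoc)
  next
    case quadratic
    have l: "[i] \<in> lists {1..<n}"
      using quadratic by auto
    have m: "monomial [i] \<in> carrier F" "\<one>\<^bsub>F\<^esub> \<in> carrier F" "q \<odot>\<^bsub>F\<^esub> \<one>\<^bsub>F\<^esub> \<in> carrier F"
      by (intro monomial_closed l eval.R.one_closed free_algebra_closed(3))+
    have eval_m: "eval (monomial [i]) = A i"
      using A_in[OF quadratic(1)] by (simp add: eval_monomial[OF l])
    show ?thesis
      unfolding quadratic(2) eval.hom_mult[OF eval.R.minus_closed[OF m(1,2)] eval.R.a_closed[OF m(1,3)]]
        minus[OF m(1,2)] eval.hom_add[OF m(1,3)] eval_smult[OF m(2)] eval.hom_one eval_m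
      by (rule hecke_images.quadratic[OF hecke_images_axioms quadratic(1)])
  qed
qed

lemma hecke_ideal: "ideal (hecke_ideal n q) F"
  unfolding hecke_ideal_def using relators_closed by (rule eval.R.genideal_ideal)

lemma eval_hecke_ideal: "f \<in> hecke_ideal n q \<Longrightarrow> eval f = \<zero>\<^bsub>End V\<^esub>"
proof -
  have "hecke_relators n q \<subseteq> a_kernel F (End V) eval"
    unfolding a_kernel_def' using eval_relators relators_closed by blast
  then have "hecke_ideal n q \<subseteq> a_kernel F (End V) eval"
    unfolding hecke_ideal_def by (rule eval.R.genideal_minimal[OF eval.kernel_is_ideal])
  then show "f \<in> hecke_ideal n q \<Longrightarrow> eval f = \<zero>\<^bsub>End V\<^esub>"
    unfolding a_kernel_def' by blast
qed

text \<open>The evaluation homomorphism of the free algebra is constant on the cosets of the ideal.\<close>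

theorem defines_hecke_rep: "defines_hecke_rep n q V A"
proof -
  let ?I = "hecke_ideal n q" and ?H = "hecke_algebra n q"
  interpret I: ideal ?I F by (rule hecke_ideal)
  define \<Phi> where "\<Phi> = (\<lambda>C. the_elem (eval ` C))"
  have coset: "eval x = eval f" if "f \<in> carrier F" "x \<in> ?I +>\<^bsub>F\<^esub> f" for f x
    using that eval_hecke_ideal I.a_subset eval_closed
    by (auto simp: a_r_coset_def' subset_iff)
  have const: "\<Phi> C = a" if "C \<noteq> {}" "\<And>x. x \<in> C \<Longrightarrow> eval x = a" for C a
  proof -
    have "eval ` C = {a}"
      using that by auto
    then show ?thesis
      by (simp add: \<Phi>_def)
  qed
  have self: "f \<in> ?I +>\<^bsub>F\<^esub> f" if "f \<in> carrier F" for f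
    using that by (rule I.a_rcos_self)
  have \<Phi>: "\<Phi> (?I +>\<^bsub>F\<^esub> f) = eval f" if "f \<in> carrier F" for f
  proof (rule const)
    show "?I +>\<^bsub>F\<^esub> f \<noteq> {}"
      using self[OF that] by blast
  qed (rule coset[OF that])
  have carr: "carrier ?H = {?I +>\<^bsub>F\<^esub> f | f. f \<in> carrier F}"
    by (auto simp: hecke_algebra_def quotient_space_def ring.defs FactRing_def A_RCOSETS_def')
  have ops: "(?I +>\<^bsub>F\<^esub> f) \<otimes>\<^bsub>?H\<^esub> (?I +>\<^bsub>F\<^esub> h) = ?I +>\<^bsub>F\<^esub> (f \<otimes>\<^bsub>F\<^esub> h)"
    "(?I +>\<^bsub>F\<^esub> f) \<oplus>\<^bsub>?H\<^esub> (?I +>\<^bsub>F\<^esub> h) = ?I +>\<^bsub>F\<^esub> (f \<oplus>\<^bsub>F\<^esub> h)"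
    if "f \<in> carrier F" "h \<in> carrier F" for f h
    using that I.rcoset_mult_add I.a_rcos_sum
    by (simp_all add: hecke_algebra_def quotient_space_def ring.defs FactRing_def)
  have one: "\<one>\<^bsub>?H\<^esub> = ?I +>\<^bsub>F\<^esub> \<one>\<^bsub>F\<^esub>"
    by (simp add: hecke_algebra_def quotient_space_def ring.defs FactRing_def)
  have smult: "\<Phi> (a \<odot>\<^bsub>?H\<^esub> (?I +>\<^bsub>F\<^esub> f)) = a \<odot>\<^bsub>End V\<^esub> eval f" if f: "f \<in> carrier F" for a f
  proof -
    have "a \<odot>\<^bsub>?H\<^esub> (?I +>\<^bsub>F\<^esub> f) = (\<Union>x\<in>?I +>\<^bsub>F\<^esub> f. ?I +>\<^bsub>F\<^esub> (a \<odot>\<^bsub>F\<^esub> x))"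
      by (simp add: hecke_algebra_def quotient_space_def ring.defs module.defs)
    moreover have "\<Phi> (\<Union>x\<in>?I +>\<^bsub>F\<^esub> f. ?I +>\<^bsub>F\<^esub> (a \<odot>\<^bsub>F\<^esub> x)) = a \<odot>\<^bsub>End V\<^esub> eval f"
    proof (rule const)
      show "(\<Union>x\<in>?I +>\<^bsub>F\<^esub> f. ?I +>\<^bsub>F\<^esub> (a \<odot>\<^bsub>F\<^esub> x)) \<noteq> {}"
        using self[OF f] self[OF free_algebra_closed(3)[OF f, of a]] by blast
      fix y assume "y \<in> (\<Union>x\<in>?I +>\<^bsub>F\<^esub> f. ?I +>\<^bsub>F\<^esub> (a \<odot>\<^bsub>F\<^esub> x))"
      then obtain x where x: "x \<in> ?I +>\<^bsub>F\<^esub> f" "y \<in> ?I +>\<^bsub>F\<^esub> (a \<odot>\<^bsub>F\<^esub> x)"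
        by blast
      have xc: "x \<in> carrier F"
        using x(1) f eval.R.a_r_coset_subset_G[OF I.a_subset f] by auto
      have "eval y = eval (a \<odot>\<^bsub>F\<^esub> x)"
        using x(2) free_algebra_closed(3)[OF xc] by (intro coset)
      also have "\<dots> = a \<odot>\<^bsub>End V\<^esub> eval f"
        unfolding eval_smult[OF xc] coset[OF f x(1)] ..
      finally show "eval y = a \<odot>\<^bsub>End V\<^esub> eval f" .
    qed
    ultimately show ?thesis
      by simp
  qed
  have "\<Phi> \<in> Ring.ring_hom ?H (End V)"
    by (rule ring_hom_memI) (auto simp: carr ops one \<Phi> eval_closed free_algebra_closed eval.R.one_closed)
  moreover have "\<Phi> \<in> LinearCombinations.module_hom class_ring ?H (End V)"
    by (auto simp: LinearCombinations.module_hom_def carr ops \<Phi> smult eval_closed free_algebra_closed)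
  moreover have "\<Phi> (hecke_gen n q i) = A i" if "i \<in> {1..<n}" for i
    using that A_in[OF that] monomial_closed[of "[i]" n] unfolding hecke_gen_def
    by (subst \<Phi>) (auto simp: eval_monomial)
  ultimately show ?thesis
    unfolding defines_hecke_rep_def by blast
qed

end

section \<open>Powers and quotients of a space with coordinates\<close>

locale coords_pow = coords V I \<phi>
  for V :: "('k::field, 'v, 'm) module_scheme" (structure) and I :: "'i set" and \<phi> :: "'v \<Rightarrow> 'i \<Rightarrow> 'k" +
  fixes n :: nat
begin

text \<open>For fixed \<open>b\<close>, the \<open>b\<close>-th coordinates of the components of \<open>w\<close>, as a sequence supported in
  \<open>{1..n}\<close>.\<close>

definition seq :: "(nat \<Rightarrow> 'v) \<Rightarrow> 'i \<Rightarrow> nat \<Rightarrow> 'k" where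
  "seq w b = (\<lambda>j. if j \<in> {1..n} then \<phi> (w j) b else 0)"

lemma vpow_carrier_closed [simp]: "w \<in> carrier (vpow n V) \<Longrightarrow> j \<in> {1..n} \<Longrightarrow> w j \<in> carrier V"
  by (auto simp: vpow_def)

lemma vpow_coords: "coords (vpow n V) ({1..n} \<times> I) (\<lambda>w p. seq w (snd p) (fst p))"
proof (rule coordsI)
  show "\<exists>w\<in>carrier (vpow n V). \<forall>p\<in>{1..n} \<times> I. seq w (snd p) (fst p) = x p" for x
    by (rule bexI[of _ "\<lambda>j\<in>{1..n}. vec (\<lambda>b. x (j, b))"]) (auto simp: vpow_def seq_def)
  show "w = w'" if w: "w \<in> carrier (vpow n V)" "w' \<in> carrier (vpow n V)"
    and eq: "\<And>p. p \<in> {1..n} \<times> I \<Longrightarrow> seq w (snd p) (fst p) = seq w' (snd p) (fst p)" for w w'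
  proof (rule extensionalityI)
    show "w \<in> extensional {1..n}" "w' \<in> extensional {1..n}"
      using w by (auto simp: vpow_def PiE_def)
    show "w j = w' j" if j: "j \<in> {1..n}" for j
      by (rule coord_eqI) (use w j eq[of "(j, _)"] in \<open>auto simp: seq_def\<close>)
  qed
qed (use finite_index in \<open>auto simp: vpow_def seq_def coord_zero coord_add coord_smult\<close>)

sublocale pow: coords "vpow n V" "{1..n} \<times> I" "\<lambda>w p. seq w (snd p) (fst p)"
  by (rule vpow_coords)

lemma seq_outside: "j \<notin> {1..n} \<Longrightarrow> seq w b j = 0"
  by (auto simp: seq_def)

lemma seq_add: "w \<in> carrier (vpow n V) \<Longrightarrow> w' \<in> carrier (vpow n V) \<Longrightarrow> b \<in> I \<Longrightarrow>
    seq (w \<oplus>\<^bsub>vpow n V\<^esub> w') b = (\<lambda>j. seq w b j + seq w' b j)"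
  by (auto simp: vpow_def seq_def coord_add)

lemma seq_smult: "w \<in> carrier (vpow n V) \<Longrightarrow> b \<in> I \<Longrightarrow>
    seq (a \<odot>\<^bsub>vpow n V\<^esub> w) b = (\<lambda>j. a * seq w b j)"
  by (auto simp: vpow_def seq_def coord_smult)

lemma seq_eqI:
  "w \<in> carrier (vpow n V) \<Longrightarrow> w' \<in> carrier (vpow n V) \<Longrightarrow> (\<And>b. b \<in> I \<Longrightarrow> seq w b = seq w' b) \<Longrightarrow> w = w'"
  by (rule pow.coord_eqI) auto

text \<open>Operators on \<open>V\<^sup>n\<close> that act on each coordinate sequence by itself.\<close>

definition acts :: "((nat \<Rightarrow> 'v) \<Rightarrow> nat \<Rightarrow> 'v) \<Rightarrow> ('i \<Rightarrow> (nat \<Rightarrow> 'k) \<Rightarrow> nat \<Rightarrow> 'k) \<Rightarrow> bool" where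
  "acts f F \<longleftrightarrow> f \<in> carrier (End (vpow n V)) \<and>
    (\<forall>w\<in>carrier (vpow n V). \<forall>b\<in>I. seq (f w) b = F b (seq w b))"

lemma actsD:
  assumes "acts f F"
  shows "f \<in> carrier (End (vpow n V))"
    and "w \<in> carrier (vpow n V) \<Longrightarrow> b \<in> I \<Longrightarrow> seq (f w) b = F b (seq w b)"
  using assms by (auto simp: acts_def)

lemma acts_comp: "acts f F \<Longrightarrow> acts h H \<Longrightarrow> acts (f \<otimes>\<^bsub>End (vpow n V)\<^esub> h) (\<lambda>b x. F b (H b x))"
  by (auto simp: acts_def)

lemma acts_eqI:
  assumes "acts f F" "acts h H"
    and "\<And>b x. b \<in> I \<Longrightarrow> (\<And>j. j \<notin> {1..n} \<Longrightarrow> x j = 0) \<Longrightarrow> F b x = H b x"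
  shows "f = h"
proof (rule pow.End_eqI)
  show "f \<in> carrier (End (vpow n V))" "h \<in> carrier (End (vpow n V))"
    using assms by (auto simp: acts_def)
  show "f w = h w" if w: "w \<in> carrier (vpow n V)" for w
  proof (rule seq_eqI)
    show "seq (f w) b = seq (h w) b" if b: "b \<in> I" for b
      using assms(3)[OF b, of "seq w b"] w b assms(1,2) by (auto simp: acts_def seq_outside)
  qed (use assms(1,2) w in \<open>auto simp: acts_def\<close>)
qed

text \<open>Any family of linear maps of coordinate sequences comes from an operator on \<open>V\<^sup>n\<close>. Applied to the
  inverse maps this yields the invertibility criterion \<open>acts_unit\<close>.\<close>

lemma exists_acts:
  assumes support: "\<And>b x j. (\<And>j. j \<notin> {1..n} \<Longrightarrow> x j = 0) \<Longrightarrow> j \<notin> {1..n} \<Longrightarrow> F b x j = 0"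
    and add: "\<And>b x y j. F b (\<lambda>j. x j + y j) j = F b x j + F b y j"
    and smult: "\<And>b a x j. F b (\<lambda>j. a * x j) j = a * F b x j"
  shows "\<exists>f. acts f F"
proof -
  define f where "f = (\<lambda>w\<in>carrier (vpow n V). pow.vec (\<lambda>p. F (snd p) (seq w (snd p)) (fst p)))"
  have f_apply: "f w = pow.vec (\<lambda>p. F (snd p) (seq w (snd p)) (fst p))" if "w \<in> carrier (vpow n V)" for w
    unfolding f_def by (rule restrict_apply'[OF that])
  have eq: "seq (f w) b = F b (seq w b)" if "w \<in> carrier (vpow n V)" "b \<in> I" for w b
  proof
    have "F b (seq w b) j = 0" if "j \<notin> {1..n}" for j
      by (rule support[OF seq_outside that])
    then show "seq (f w) b j = F b (seq w b) j" for j
      using that pow.coord_vec[of "(j, b)"]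
      by (cases "j \<in> {1..n}") (auto simp: seq_outside f_apply)
  qed
  have "f \<in> carrier (End (vpow n V))"
  proof (rule pow.End_coordI)
    show "f w \<in> carrier (vpow n V)" if "w \<in> carrier (vpow n V)" for w
      unfolding f_apply[OF that] by (rule pow.vec_closed)
  qed (simp add: f_def, auto simp: eq seq_add seq_smult add smult)
  with eq show ?thesis
    by (auto simp: acts_def)
qed

lemma acts_unit:
  assumes f: "acts f F"
    and support: "\<And>b x j. (\<And>j. j \<notin> {1..n} \<Longrightarrow> x j = 0) \<Longrightarrow> j \<notin> {1..n} \<Longrightarrow> F' b x j = 0"
    and add: "\<And>b x y j. F' b (\<lambda>j. x j + y j) j = F' b x j + F' b y j"
    and smult: "\<And>b a x j. F' b (\<lambda>j. a * x j) j = a * F' b x j"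
    and inverse: "\<And>b x. b \<in> I \<Longrightarrow> F b (F' b x) = x" "\<And>b x. b \<in> I \<Longrightarrow> F' b (F b x) = x"
  shows "f \<in> carrier (GL (vpow n V))"
proof -
  obtain f' where f': "acts f' F'"
    using exists_acts[of F', OF support add smult] by blast
  have one: "acts \<one>\<^bsub>End (vpow n V)\<^esub> (\<lambda>b x. x)"
    by (simp add: acts_def)
  have "f \<otimes>\<^bsub>End (vpow n V)\<^esub> f' = \<one>\<^bsub>End (vpow n V)\<^esub>" "f' \<otimes>\<^bsub>End (vpow n V)\<^esub> f = \<one>\<^bsub>End (vpow n V)\<^esub>"
    by (rule acts_eqI[OF acts_comp[OF f f'] one] acts_eqI[OF acts_comp[OF f' f] one], simp add: inverse)+
  then show ?thesis
    using f f' by (auto simp: GL_def units_of_def Units_def acts_def)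
qed

text \<open>Blocks that are diagonal in the coordinates turn a block matrix into one scalar matrix for each
  index \<open>b\<close>.\<close>

lemma block_op_acts:
  assumes B: "\<And>r s. r \<in> {1..n} \<Longrightarrow> s \<in> {1..n} \<Longrightarrow> B r s \<in> carrier (End V)"
    and \<beta>: "\<And>r s v b. r \<in> {1..n} \<Longrightarrow> s \<in> {1..n} \<Longrightarrow> v \<in> carrier V \<Longrightarrow> b \<in> I \<Longrightarrow> \<phi> (B r s v) b = \<beta> b r s * \<phi> v b"
  shows "acts (block_op n V B) (\<lambda>b x r. if r \<in> {1..n} then \<Sum>s\<in>{1..n}. \<beta> b r s * x s else 0)"
proof -
  have eq: "seq (block_op n V B w) b = (\<lambda>r. if r \<in> {1..n} then \<Sum>s\<in>{1..n}. \<beta> b r s * seq w b s else 0)"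
    if w: "w \<in> carrier (vpow n V)" and b: "b \<in> I" for w b
  proof
    fix r
    show "seq (block_op n V B w) b r = (if r \<in> {1..n} then \<Sum>s\<in>{1..n}. \<beta> b r s * seq w b s else 0)"
    proof (cases "r \<in> {1..n}")
      case r: True
      have "seq (block_op n V B w) b r = \<phi> (\<Oplus>s\<in>{1..n}. B r s (w s)) b"
        using w r by (simp add: block_op_def seq_def)
      also have "\<dots> = (\<Sum>s\<in>{1..n}. \<phi> (B r s (w s)) b)"
        using w b B r by (intro coord_finsum) auto
      also have "\<dots> = (\<Sum>s\<in>{1..n}. \<beta> b r s * seq w b s)"
        using w b r \<beta> by (intro sum.cong) (auto simp: seq_def)
      finally show ?thesis
        using r by simp
    qed (auto simp: seq_outside)
  qed
  have "block_op n V B \<in> carrier (End (vpow n V))"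
  proof (rule pow.End_coordI)
    show "block_op n V B \<in> extensional (carrier (vpow n V))"
      by (simp add: block_op_def)
    show "block_op n V B w \<in> carrier (vpow n V)" if "w \<in> carrier (vpow n V)" for w
    proof -
      have "(\<Oplus>s\<in>{1..n}. B r s (w s)) \<in> carrier V" if "r \<in> {1..n}" for r
        using B[OF that] \<open>w \<in> carrier (vpow n V)\<close> by (intro finsum_closed) auto
      then show ?thesis
        using that by (auto simp: block_op_def) (auto simp: vpow_def)
    qed
  qed (auto simp: eq seq_add seq_smult algebra_simps sum.distrib sum_distrib_left)
  with eq show ?thesis
    by (simp add: acts_def)
qed

end

text \<open>The quotient by the common kernel of finitely many functionals that take all tuples of values
  has these functionals as coordinates.\<close>

locale quotient_coords = vspace U
  for U :: "('k::field, 'u, 'm) module_scheme" (structure) +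
  fixes J :: "'j set" and \<Psi> :: "'u \<Rightarrow> 'j \<Rightarrow> 'k"
  assumes finite_J: "finite J"
    and Psi_add: "u \<in> carrier U \<Longrightarrow> v \<in> carrier U \<Longrightarrow> i \<in> J \<Longrightarrow> \<Psi> (u \<oplus> v) i = \<Psi> u i + \<Psi> v i"
    and Psi_smult: "v \<in> carrier U \<Longrightarrow> i \<in> J \<Longrightarrow> \<Psi> (a \<odot> v) i = a * \<Psi> v i"
    and Psi_surj: "\<exists>v\<in>carrier U. \<forall>i\<in>J. \<Psi> v i = x i"
begin

definition "M = {w \<in> carrier U. \<forall>i\<in>J. \<Psi> w i = 0}"

definition "Q = quotient_space U M"

definition "\<pi> w = M +>\<^bsub>U\<^esub> w"

lemma Psi_minus: "u \<in> carrier U \<Longrightarrow> v \<in> carrier U \<Longrightarrow> i \<in> J \<Longrightarrow> \<Psi> (u \<ominus> v) i = \<Psi> u i - \<Psi> v i"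
  using Psi_add[of u "\<ominus> v" i] Psi_smult[of v i "- 1"] by (simp add: a_minus_def vs_minus_one)

lemma Psi_zero: "i \<in> J \<Longrightarrow> \<Psi> \<zero> i = 0"
  using Psi_smult[of \<zero> i 0] by simp

lemma proj_eq:
  assumes w: "w \<in> carrier U"
  shows "\<pi> w = {x \<in> carrier U. \<forall>i\<in>J. \<Psi> x i = \<Psi> w i}"
proof (intro equalityI subsetI)
  fix x assume "x \<in> \<pi> w"
  then show "x \<in> {x \<in> carrier U. \<forall>i\<in>J. \<Psi> x i = \<Psi> w i}"
    using w by (auto simp: \<pi>_def M_def a_r_coset_def' Psi_add)
next
  fix x assume x: "x \<in> {x \<in> carrier U. \<forall>i\<in>J. \<Psi> x i = \<Psi> w i}"
  then have "x \<ominus> w \<in> M"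
    using w by (simp add: M_def Psi_minus)
  moreover have "x = (x \<ominus> w) \<oplus> w"
    using w x by (simp add: a_minus_def a_assoc l_neg)
  ultimately show "x \<in> \<pi> w"
    unfolding \<pi>_def a_r_coset_def' by blast
qed

lemma proj_eq_iff: "w \<in> carrier U \<Longrightarrow> w' \<in> carrier U \<Longrightarrow> \<pi> w = \<pi> w' \<longleftrightarrow> (\<forall>i\<in>J. \<Psi> w i = \<Psi> w' i)"
  by (auto simp: proj_eq)

lemma Q_carrier: "carrier Q = \<pi> ` carrier U"
  by (auto simp: Q_def quotient_space_def ring.defs FactRing_def A_RCOSETS_def' \<pi>_def)

lemma Q_zero: "\<zero>\<^bsub>Q\<^esub> = \<pi> \<zero>"
  by (auto simp: proj_eq Psi_zero Q_def quotient_space_def ring.defs FactRing_def M_def)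

lemma Q_add:
  assumes "u \<in> carrier U" "v \<in> carrier U"
  shows "\<pi> u \<oplus>\<^bsub>Q\<^esub> \<pi> v = \<pi> (u \<oplus> v)"
proof -
  have "\<pi> u <+>\<^bsub>U\<^esub> \<pi> v = \<pi> (u \<oplus> v)"
  proof (intro equalityI subsetI)
    fix x assume "x \<in> \<pi> u <+>\<^bsub>U\<^esub> \<pi> v"
    then show "x \<in> \<pi> (u \<oplus> v)"
      using assms by (auto simp: set_add_iff proj_eq Psi_add)
  next
    fix x assume "x \<in> \<pi> (u \<oplus> v)"
    then have x: "x \<in> carrier U" "\<And>i. i \<in> J \<Longrightarrow> \<Psi> x i = \<Psi> u i + \<Psi> v i"
      using assms by (auto simp: proj_eq Psi_add)
    then have "x = u \<oplus> (x \<ominus> u)"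
      using assms by (simp add: a_minus_def a_lcomm[of u x "\<ominus> u"] r_neg)
    moreover have "x \<ominus> u \<in> \<pi> v" "u \<in> \<pi> u"
      using assms x by (auto simp: proj_eq Psi_minus)
    ultimately show "x \<in> \<pi> u <+>\<^bsub>U\<^esub> \<pi> v"
      unfolding set_add_iff by blast
  qed
  then show ?thesis
    by (simp add: Q_def quotient_space_def ring.defs FactRing_def)
qed

text \<open>Operations on the quotient are unions over the representatives of a class; they collapse to a
  single class if the summand does not depend on the representative.\<close>

lemma UN_proj:
  assumes w: "w \<in> carrier U" and h: "\<And>x. x \<in> \<pi> w \<Longrightarrow> \<pi> (h x) = A"
  shows "(\<Union>x\<in>\<pi> w. \<pi> (h x)) = A"
proof -
  have "w \<in> \<pi> w"
    using w by (simp add: proj_eq)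
  then show ?thesis
    using h by auto
qed

lemma Q_smult:
  assumes "v \<in> carrier U"
  shows "a \<odot>\<^bsub>Q\<^esub> \<pi> v = \<pi> (a \<odot> v)"
proof -
  have "(\<Union>x\<in>\<pi> v. \<pi> (a \<odot> x)) = \<pi> (a \<odot> v)"
    using assms by (intro UN_proj) (auto simp: proj_eq Psi_smult)
  then show ?thesis
    by (simp add: Q_def quotient_space_def ring.defs module.defs \<pi>_def)
qed

definition "\<psi> C = \<Psi> (SOME w. w \<in> C)"

lemma psi_proj: "w \<in> carrier U \<Longrightarrow> i \<in> J \<Longrightarrow> \<psi> (\<pi> w) i = \<Psi> w i"
  unfolding \<psi>_def by (rule someI2[of _ w]) (auto simp: proj_eq)

lemma Q_coords: "coords Q J \<psi>"
proof (rule coordsI[OF finite_J])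
  show "\<exists>v\<in>carrier Q. \<forall>i\<in>J. \<psi> v i = x i" for x
    using Psi_surj[of x] psi_proj by (auto simp: Q_carrier)
  show "u = v" if uv: "u \<in> carrier Q" "v \<in> carrier Q" "\<And>i. i \<in> J \<Longrightarrow> \<psi> u i = \<psi> v i" for u v
  proof -
    obtain x y where "x \<in> carrier U" "u = \<pi> x" "y \<in> carrier U" "v = \<pi> y"
      using uv(1,2) by (auto simp: Q_carrier)
    with uv(3) show ?thesis
      by (simp add: proj_eq_iff psi_proj)
  qed
qed (auto simp: Q_carrier Q_zero Q_add Q_smult psi_proj Psi_zero Psi_add Psi_smult)

sublocale Q: coords Q J \<psi>
  by (rule Q_coords)

lemma proj_closed [simp]: "w \<in> carrier U \<Longrightarrow> \<pi> w \<in> carrier Q"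
  by (simp add: Q_carrier)

lemma proj_zero_iff: "w \<in> carrier U \<Longrightarrow> \<pi> w = \<zero>\<^bsub>Q\<^esub> \<longleftrightarrow> w \<in> M"
  by (simp add: Q_zero proj_eq_iff Psi_zero M_def)

context
  fixes f
  assumes f: "f \<in> carrier (End U)" and invariant: "f ` M \<subseteq> M"
begin

lemma induced_op_proj:
  assumes w: "w \<in> carrier U"
  shows "induced_op U M f (\<pi> w) = \<pi> (f w)"
proof -
  have "\<pi> (f x) = \<pi> (f w)" if "x \<in> \<pi> w" for x
  proof -
    have x: "x \<in> carrier U" "x \<oplus> (- 1) \<odot> w \<in> M"
      using that w by (auto simp: proj_eq M_def Psi_add Psi_smult)
    have "f (x \<oplus> (- 1) \<odot> w) \<in> M"
      using invariant x(2) by blast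
    then have "\<Psi> (f (x \<oplus> (- 1) \<odot> w)) i = 0" if "i \<in> J" for i
      using that by (simp add: M_def)
    then show ?thesis
      using x w f by (auto simp: proj_eq_iff Psi_add Psi_smult)
  qed
  then have "(\<Union>x\<in>\<pi> w. \<pi> (f x)) = \<pi> (f w)"
    using w by (intro UN_proj) auto
  moreover have "\<pi> w \<in> carrier (quotient_space U M)"
    using w proj_closed by (simp add: Q_def)
  ultimately show ?thesis
    by (simp add: induced_op_def \<pi>_def)
qed

lemma induced_op_End: "induced_op U M f \<in> carrier (End Q)"
proof (rule Q.EndI)
  show "induced_op U M f \<in> extensional (carrier Q)"
    by (simp add: induced_op_def Q_def)
qed (use f in \<open>auto simp: Q_carrier Q_add Q_smult induced_op_proj\<close>)

lemma op_poly_induced: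
  "w \<in> carrier U \<Longrightarrow> op_poly Q p (induced_op U M f) (\<pi> w) = \<pi> (op_poly U p f w)"
proof (induction p arbitrary: w)
  case 0
  then show ?case using induced_op_End f by (simp add: Q_zero)
next
  case (pCons a p)
  then show ?case
    using induced_op_End f
    by (simp add: Q.op_poly_pCons op_poly_pCons induced_op_proj Q_smult Q_add)
qed

end

end

section \<open>Long--Moody operators on scalar sequences\<close>

text \<open>The \<open>i\<close>-th row of the twisted Long--Moody matrix of \<open>x\<^sub>i\<close> with the scalar \<open>\<nu>\<close> in place of all the
  operators \<open>g\<^sub>j\<close>.\<close>

definition lm_coeff :: "'k::field \<Rightarrow> 'k \<Rightarrow> nat \<Rightarrow> nat \<Rightarrow> 'k" where
  "lm_coeff lam \<nu> i s = (if s < i then lam * (\<nu> - 1) else if s = i then lam * \<nu> else \<nu> - 1)"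

definition lm_row :: "'k::field \<Rightarrow> 'k \<Rightarrow> nat \<Rightarrow> nat \<Rightarrow> (nat \<Rightarrow> 'k) \<Rightarrow> 'k" where
  "lm_row lam \<nu> n i x = (\<Sum>s\<in>{1..n}. lm_coeff lam \<nu> i s * x s)"

definition lm_map :: "'k::field \<Rightarrow> 'k \<Rightarrow> nat \<Rightarrow> nat \<Rightarrow> (nat \<Rightarrow> 'k) \<Rightarrow> nat \<Rightarrow> 'k" where
  "lm_map lam \<nu> n i x = x(i := lm_row lam \<nu> n i x)"

text \<open>The unreduced Burau matrix of \<open>\<sigma>\<^sub>i\<close> at parameter \<open>\<nu>\<close>, which is the matrix \<open>R\<^sub>i\<close> for the scalar \<open>\<nu>\<close>.\<close>

definition burau :: "'k::field \<Rightarrow> nat \<Rightarrow> (nat \<Rightarrow> 'k) \<Rightarrow> nat \<Rightarrow> 'k" where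
  "burau \<nu> i x = x(i := \<nu> * x (i + 1), i + 1 := x i + (1 - \<nu>) * x (i + 1))"

lemma burau_apply:
  "burau \<nu> i x j = (if j = i then \<nu> * x (i + 1) else if j = i + 1 then x i + (1 - \<nu>) * x (i + 1) else x j)"
  by (simp add: burau_def)

lemma burau_far: "i + 2 \<le> j \<Longrightarrow> burau \<nu> i (burau \<nu> j x) = burau \<nu> j (burau \<nu> i x)"
  by (rule ext) (simp add: burau_apply)

lemma burau_near:
  "burau \<nu> i (burau \<nu> (i + 1) (burau \<nu> i x)) = burau \<nu> (i + 1) (burau \<nu> i (burau \<nu> (i + 1) x))"
  by (rule ext) (simp add: burau_apply algebra_simps)

text \<open>The other terms of the \<open>i\<close>-th and of the \<open>(i + 1)\<close>-st row are the same and do not see the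
  entries that the \<open>i\<close>-th braid generator changes.\<close>

definition other_terms :: "'k::field \<Rightarrow> 'k \<Rightarrow> nat \<Rightarrow> nat \<Rightarrow> (nat \<Rightarrow> 'k) \<Rightarrow> 'k" where
  "other_terms lam \<nu> n i x = (\<Sum>s\<in>{1..n} - {i, i + 1}. lm_coeff lam \<nu> i s * x s)"

lemma sum_two:
  fixes h :: "nat \<Rightarrow> 'k::field"
  assumes "i \<in> {1..<n}"
  shows "(\<Sum>s\<in>{1..n}. h s) = h i + h (i + 1) + (\<Sum>s\<in>{1..n} - {i, i + 1}. h s)"
proof -
  have "{1..n} = {i, i + 1} \<union> ({1..n} - {i, i + 1})"
    using assms by auto
  then have "(\<Sum>s\<in>{1..n}. h s) = (\<Sum>s\<in>{i, i + 1} \<union> ({1..n} - {i, i + 1}). h s)"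
    by simp
  also have "\<dots> = (\<Sum>s\<in>{i, i + 1}. h s) + (\<Sum>s\<in>{1..n} - {i, i + 1}. h s)"
    by (rule sum.union_disjoint) auto
  finally show ?thesis
    by simp
qed

lemma lm_row_i:
  assumes "i \<in> {1..<n}"
  shows "lm_row lam \<nu> n i x = lam * \<nu> * x i + (\<nu> - 1) * x (i + 1) + other_terms lam \<nu> n i x"
  unfolding lm_row_def sum_two[OF assms] other_terms_def by (simp add: lm_coeff_def)

lemma lm_row_Suc:
  assumes "i \<in> {1..<n}"
  shows "lm_row lam \<nu> n (i + 1) x = lam * (\<nu> - 1) * x i + lam * \<nu> * x (i + 1) + other_terms lam \<nu> n i x"
proof -
  have "(\<Sum>s\<in>{1..n} - {i, i + 1}. lm_coeff lam \<nu> (i + 1) s * x s) = other_terms lam \<nu> n i x"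
    unfolding other_terms_def by (intro sum.cong) (auto simp: lm_coeff_def)
  then show ?thesis
    unfolding lm_row_def sum_two[OF assms] by (simp add: lm_coeff_def)
qed

lemma other_terms_cong:
  "(\<And>s. s \<noteq> i \<Longrightarrow> s \<noteq> i + 1 \<Longrightarrow> x s = y s) \<Longrightarrow> other_terms lam \<nu> n i x = other_terms lam \<nu> n i y"
  unfolding other_terms_def by (intro sum.cong) auto

lemma other_terms_update [simp]:
  "other_terms lam \<nu> n i (x(i := a)) = other_terms lam \<nu> n i x"
  "other_terms lam \<nu> n i (x(Suc i := a)) = other_terms lam \<nu> n i x"
  by (rule other_terms_cong; simp)+

lemma lm_act_first:
  assumes "i \<in> {1..<n}"
  shows "burau \<nu> i (lm_map lam \<nu> n i x) = lm_map lam \<nu> n (i + 1) (burau \<nu> i x)"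
  unfolding lm_map_def lm_row_i[OF assms] lm_row_Suc[OF assms]
  by (rule ext) (simp add: burau_def algebra_simps)

lemma lm_act_second:
  assumes "i \<in> {1..<n}"
  shows "lm_map lam \<nu> n (i + 1) (burau \<nu> i (lm_map lam \<nu> n (i + 1) x)) =
    lm_map lam \<nu> n i (lm_map lam \<nu> n (i + 1) (burau \<nu> i x))"
  unfolding lm_map_def lm_row_i[OF assms] lm_row_Suc[OF assms]
  by (rule ext) (simp add: burau_def algebra_simps)

lemma lm_act_other:
  assumes i: "i \<in> {1..<n}" and j: "j \<in> {1..n} - {i, i + 1}"
  shows "burau \<nu> i (lm_map lam \<nu> n j x) = lm_map lam \<nu> n j (burau \<nu> i x)"
proof -
  have "lm_coeff lam \<nu> j (i + 1) = lm_coeff lam \<nu> j i"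
    using j by (auto simp: lm_coeff_def)
  moreover have "(\<Sum>s\<in>{1..n} - {i, i + 1}. lm_coeff lam \<nu> j s * burau \<nu> i x s) =
      (\<Sum>s\<in>{1..n} - {i, i + 1}. lm_coeff lam \<nu> j s * x s)"
    by (intro sum.cong) (auto simp: burau_apply)
  ultimately have "lm_row lam \<nu> n j (burau \<nu> i x) = lm_row lam \<nu> n j x"
    unfolding lm_row_def sum_two[OF i] by (simp add: burau_apply) (simp add: algebra_simps)
  then show ?thesis
    using j unfolding lm_map_def by (intro ext) (simp add: burau_def)
qed

lemma lm_map_inverse:
  assumes "lam \<noteq> 0" "\<nu> \<noteq> 0" "i \<in> {1..n}"
  defines "F' \<equiv> \<lambda>x. x(i := (x i - (\<Sum>s\<in>{1..n} - {i}. lm_coeff lam \<nu> i s * x s)) / (lam * \<nu>))"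
  shows "lm_map lam \<nu> n i (F' x) = x" "F' (lm_map lam \<nu> n i x) = x"
proof -
  have row: "lm_row lam \<nu> n i x = lam * \<nu> * x i + (\<Sum>s\<in>{1..n} - {i}. lm_coeff lam \<nu> i s * x s)" for x
    using assms(3) unfolding lm_row_def by (subst sum.remove[of _ i]) (auto simp: lm_coeff_def)
  have upd: "(\<Sum>s\<in>{1..n} - {i}. lm_coeff lam \<nu> i s * (x(i := a)) s) =
      (\<Sum>s\<in>{1..n} - {i}. lm_coeff lam \<nu> i s * x s)" for x a
    by (intro sum.cong) auto
  show "lm_map lam \<nu> n i (F' x) = x" "F' (lm_map lam \<nu> n i x) = x"
    unfolding lm_map_def F'_def row upd using assms(1,2) by (auto simp: fun_eq_iff)
qed

text \<open>Subtracting consecutive rows turns the fixed point equations into \<open>x i = \<nu> * x (i + 1)\<close>;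
  with a geometric sum the last row becomes \<open>lam * \<nu> ^ n = 1\<close> on the sequences that remain.\<close>

lemma lm_fixed_iff:
  assumes lam: "lam \<noteq> 1" and n: "n \<ge> 1"
  shows "(\<forall>i\<in>{1..n}. lm_map lam \<nu> n i x = x) \<longleftrightarrow>
    (\<exists>u. (u = 0 \<or> lam * \<nu> ^ n = 1) \<and> (\<forall>j\<in>{1..n}. x j = u * \<nu> ^ (n - j)))"
proof -
  have fixed: "lm_map lam \<nu> n i x = x \<longleftrightarrow> lm_row lam \<nu> n i x = x i" for i
    by (auto simp: lm_map_def fun_eq_iff)
  have diff: "(lm_row lam \<nu> n i x - x i) - (lm_row lam \<nu> n (i + 1) x - x (i + 1)) =
      (lam - 1) * (x i - \<nu> * x (i + 1))" if "i \<in> {1..<n}" for i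
    unfolding lm_row_i[OF that] lm_row_Suc[OF that] by (simp add: algebra_simps)
  have last: "lm_row lam \<nu> n n x - x n = (lam * \<nu> ^ n - 1) * u"
    if x: "\<forall>j\<in>{1..n}. x j = u * \<nu> ^ (n - j)" for u
  proof -
    have "lm_row lam \<nu> n n x = (\<Sum>s\<in>{1..n}. lm_coeff lam \<nu> n s * (u * \<nu> ^ (n - s)))"
      unfolding lm_row_def using x by (intro sum.cong) auto
    also have "\<dots> = (\<Sum>s<n. lm_coeff lam \<nu> n (n - s) * (u * \<nu> ^ s))"
      by (rule sum.reindex_bij_witness[of _ "\<lambda>s. n - s" "\<lambda>s. n - s"]) auto
    also have "\<dots> = (\<Sum>s<Suc (n - 1). lm_coeff lam \<nu> n (n - s) * (u * \<nu> ^ s))"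
      using n by simp
    also have "\<dots> = lam * \<nu> * u + (\<Sum>s<n - 1. lam * (\<nu> - 1) * (u * (\<nu> * \<nu> ^ s)))"
      unfolding sum.lessThan_Suc_shift using n by (auto simp: lm_coeff_def intro!: sum.cong)
    also have "(\<Sum>s<n - 1. lam * (\<nu> - 1) * (u * (\<nu> * \<nu> ^ s))) = lam * u * \<nu> * ((\<nu> - 1) * (\<Sum>s<n - 1. \<nu> ^ s))"
      by (simp add: sum_distrib_left mult_ac)
    also have "(\<nu> - 1) * (\<Sum>s<n - 1. \<nu> ^ s) = \<nu> ^ (n - 1) - 1"
      using power_diff_1_eq[of \<nu> "n - 1"] by simp
    finally have "lm_row lam \<nu> n n x = lam * u * (\<nu> * \<nu> ^ (n - 1))"
      by (simp add: algebra_simps)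
    then show ?thesis
      using x n by (simp add: algebra_simps flip: power_Suc)
  qed
  show ?thesis
  proof
    assume rows: "\<forall>i\<in>{1..n}. lm_map lam \<nu> n i x = x"
    have step: "x i = \<nu> * x (i + 1)" if "i \<in> {1..<n}" for i
      using diff[OF that] rows that lam unfolding fixed by auto
    have geom: "x (n - d) = x n * \<nu> ^ d" if "d < n" for d
      using that
    proof (induction d)
      case (Suc d)
      then show ?case
        using step[of "n - Suc d"] by (simp add: Suc_diff_Suc)
    qed simp
    have "\<forall>j\<in>{1..n}. x j = x n * \<nu> ^ (n - j)"
    proof
      show "x j = x n * \<nu> ^ (n - j)" if "j \<in> {1..n}" for j
        using geom[of "n - j"] that by simp
    qed
    moreover from last[OF this] have "x n = 0 \<or> lam * \<nu> ^ n = 1"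
      using rows n unfolding fixed by auto
    ultimately show "\<exists>u. (u = 0 \<or> lam * \<nu> ^ n = 1) \<and> (\<forall>j\<in>{1..n}. x j = u * \<nu> ^ (n - j))"
      by blast
  next
    assume "\<exists>u. (u = 0 \<or> lam * \<nu> ^ n = 1) \<and> (\<forall>j\<in>{1..n}. x j = u * \<nu> ^ (n - j))"
    then obtain u where u: "u = 0 \<or> lam * \<nu> ^ n = 1" and x: "\<forall>j\<in>{1..n}. x j = u * \<nu> ^ (n - j)"
      by blast
    have step: "x i = \<nu> * x (i + 1)" if "i \<in> {1..<n}" for i
      using x that by (auto simp: Suc_diff_Suc simp flip: power_Suc)
    have rows: "lm_row lam \<nu> n (n - d) x = x (n - d)" if "d < n" for d
      using that
    proof (induction d)
      case 0
      then show ?case using last[OF x] u by auto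
    next
      case (Suc d)
      then have "n - Suc d \<in> {1..<n}" "n - Suc d + 1 = n - d"
        by auto
      with diff[of "n - Suc d"] step[of "n - Suc d"] Suc show ?case
        by simp
    qed
    have "lm_row lam \<nu> n j x = x j" if "j \<in> {1..n}" for j
      using rows[of "n - j"] that by simp
    then show "\<forall>i\<in>{1..n}. lm_map lam \<nu> n i x = x"
      unfolding fixed by blast
  qed
qed

text \<open>The coordinate sequences of the elements of \<open>K + L\<close>, at the eigenvalue \<open>\<nu>\<close>: everything for \<open>\<nu> = 1\<close>,
  from \<open>K\<close>, and otherwise the common fixed sequences of the \<open>x\<^sub>j\<close>, from \<open>L\<close>.\<close>

definition in_KL :: "'k::field \<Rightarrow> nat \<Rightarrow> 'k \<Rightarrow> (nat \<Rightarrow> 'k) \<Rightarrow> bool" where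
  "in_KL lam n \<nu> x \<longleftrightarrow> \<nu> = 1 \<or>
    (\<exists>u. (u = 0 \<or> lam * \<nu> ^ n = 1) \<and> (\<forall>j\<in>{1..n}. x j = u * \<nu> ^ (n - j)))"

text \<open>The sequences \<open>u * \<nu> ^ (n - j)\<close> are fixed by the Burau matrices, and the factor \<open>c\<close> only changes \<open>u\<close>.\<close>

lemma burau_in_KL:
  assumes i: "i \<in> {1..<n}" and x: "in_KL lam n \<nu> x"
  shows "in_KL lam n \<nu> (\<lambda>j. c * burau \<nu> i x j)"
proof (cases "\<nu> = 1")
  case False
  then obtain u where u: "u = 0 \<or> lam * \<nu> ^ n = 1" and x: "\<forall>j\<in>{1..n}. x j = u * \<nu> ^ (n - j)"
    using x by (auto simp: in_KL_def)
  have ij: "n - i = Suc (n - (i + 1))"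
    using i by auto
  have xi: "x i = u * (\<nu> * \<nu> ^ (n - (i + 1)))" "x (i + 1) = u * \<nu> ^ (n - (i + 1))"
    using x i ij by auto
  have "burau \<nu> i x j = u * \<nu> ^ (n - j)" if "j \<in> {1..n}" for j
    using that x unfolding burau_apply xi by (auto simp: ij algebra_simps)
  then show ?thesis
    using u unfolding in_KL_def by (intro disjI2 exI[of _ "c * u"]) auto
qed (simp add: in_KL_def)

text \<open>In operator form this is \<open>(burau + \<nu>) (burau - 1) = 0\<close>, the source of all quadratic relations below.\<close>

lemma burau_quadratic:
  "burau \<nu> i (\<lambda>j. burau \<nu> i x j - x j) = (\<lambda>j. - \<nu> * (burau \<nu> i x j - x j))"
  by (rule ext) (simp add: burau_apply algebra_simps)

section \<open>The Long--Moody representation in eigencoordinates\<close>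

context vspace
begin

lemma GL_simps [simp]:
  "carrier (GL V) = Units (End V)" "mult (GL V) = mult (End V)" "one (GL V) = one (End V)"
  by (simp_all add: GL_def units_of_def)

lemma GL_group: "group (GL V)"
  unfolding GL_def by (rule E.units_group)

lemma GL_subset: "f \<in> carrier (GL V) \<Longrightarrow> f \<in> carrier (End V)"
  by (simp add: Units_def)

lemma scalar_op_GL: "a \<noteq> 0 \<Longrightarrow> scalar_op V a \<in> carrier (GL V)"
proof -
  assume "a \<noteq> 0"
  then have "scalar_op V a \<otimes>\<^bsub>End V\<^esub> scalar_op V (inverse a) = \<one>\<^bsub>End V\<^esub>"
    "scalar_op V (inverse a) \<otimes>\<^bsub>End V\<^esub> scalar_op V a = \<one>\<^bsub>End V\<^esub>"
    by (auto intro!: End_eqI simp flip: vs_distrib(3))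
  then show ?thesis
    by (auto simp: Units_def)
qed

lemma scalar_op_commute: "f \<in> carrier (End V) \<Longrightarrow> scalar_op V a \<otimes>\<^bsub>End V\<^esub> f = f \<otimes>\<^bsub>End V\<^esub> scalar_op V a"
  by (rule End_eqI) auto

lemma rho_gc_images:
  assumes "g \<in> carrier (GL V)" "c \<noteq> 0"
  shows "FB_images (GL V) n (\<lambda>_. g) (\<lambda>_. scalar_op V c)"
proof -
  note gE = GL_subset[OF assms(1)]
  have "scalar_op V c \<otimes>\<^bsub>End V\<^esub> g = g \<otimes>\<^bsub>End V\<^esub> scalar_op V c"
    using gE by (rule scalar_op_commute)
  then show ?thesis
    using assms scalar_op_GL[of c]
    by (intro FB_images.intro FB_images_axioms.intro GL_group) auto
qed

lemma rho_gc_values: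
  assumes "g \<in> carrier (GL V)" "c \<noteq> 0"
  shows "j \<in> {1..n} \<Longrightarrow> rho_gc n V g c (fb_x n j) = g"
    and "i \<in> {1..<n} \<Longrightarrow> rho_gc n V g c (fb_sigma n i) = scalar_op V c"
  unfolding rho_gc_def by (rule rep_on_gens[OF rho_gc_images[OF assms]], assumption)+

end

text \<open>Coordinates in which \<open>g\<close> is diagonal with entries \<open>\<nu>\<close>. The operators enter as families \<open>X\<close>, \<open>S\<close> because
  the Long--Moody construction takes them from a representation of \<open>F\<^sub>n \<rtimes> B\<^sub>n\<close>.\<close>

locale eigencoords = coords_pow V I \<phi> n
  for V :: "('k::field, 'v, 'm) module_scheme" (structure) and I :: "'i set" and \<phi> and n +
  fixes g :: "'v \<Rightarrow> 'v" and \<nu> :: "'i \<Rightarrow> 'k" and lam c :: 'k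
    and X S :: "nat \<Rightarrow> 'v \<Rightarrow> 'v"
  assumes g: "g \<in> carrier (End V)"
    and eigen: "v \<in> carrier V \<Longrightarrow> b \<in> I \<Longrightarrow> \<phi> (g v) b = \<nu> b * \<phi> v b"
    and nonzero: "b \<in> I \<Longrightarrow> \<nu> b \<noteq> 0" "lam \<noteq> 0" "lam \<noteq> 1" "c \<noteq> 0"
    and n_pos: "n \<ge> 1"
    and X: "j \<in> {1..n} \<Longrightarrow> X j = g"
    and S: "i \<in> {1..<n} \<Longrightarrow> S i = scalar_op V c"
begin

lemma acts_cong:
  assumes "acts f F" "\<And>b x. b \<in> I \<Longrightarrow> (\<And>j. j \<notin> {1..n} \<Longrightarrow> x j = 0) \<Longrightarrow> F b x = F' b x"
  shows "acts f F'"
  unfolding acts_def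
proof (intro conjI ballI)
  show "seq (f w) b = F' b (seq w b)" if "w \<in> carrier (vpow n V)" "b \<in> I" for w b
    using actsD(2)[OF assms(1) that] assms(2)[OF that(2), of "seq w b"] by (simp add: seq_outside)
qed (rule actsD(1)[OF assms(1)])

lemma LM_x_acts:
  assumes i: "i \<in> {1..n}"
  shows "acts (LM_x n V lam X i) (\<lambda>b. lm_map lam (\<nu> b) n i)"
proof (rule acts_cong)
  let ?\<beta> = "\<lambda>b r s. if r \<noteq> i then (if r = s then 1 else 0) else lm_coeff lam (\<nu> b) i s"
  show "acts (LM_x n V lam X i) (\<lambda>b x r. if r \<in> {1..n} then \<Sum>s\<in>{1..n}. ?\<beta> b r s * x s else 0)"
    unfolding LM_x_def
    by (rule block_op_acts)
      (use i g in \<open>auto simp: X lm_coeff_def coord_zero coord_smult coord_minus eigen algebra_simps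
         intro!: E.minus_closed\<close>)
  fix b x assume x: "\<And>j. j \<notin> {1..n} \<Longrightarrow> x j = (0 :: 'k)"
  show "(\<lambda>r. if r \<in> {1..n} then \<Sum>s\<in>{1..n}. ?\<beta> b r s * x s else 0) = lm_map lam (\<nu> b) n i x"
  proof
    show "(if r \<in> {1..n} then \<Sum>s\<in>{1..n}. ?\<beta> b r s * x s else 0) = lm_map lam (\<nu> b) n i x r" for r
      using i x[of r] by (cases "r = i") (auto simp: lm_map_def lm_row_def if_distrib[of "\<lambda>t. t * _"] cong: if_cong)
  qed
qed

lemma LM_sigma_acts:
  assumes i: "i \<in> {1..<n}"
  shows "acts (LM_sigma n V X S i) (\<lambda>b x j. c * burau (\<nu> b) i x j)"
proof (rule acts_cong)
  let ?\<beta> = "\<lambda>b r s. if r = i \<and> s = i then 0 else if r = i \<and> s = i + 1 then \<nu> b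
     else if r = i + 1 \<and> s = i then 1 else if r = i + 1 \<and> s = i + 1 then 1 - \<nu> b
     else if r = s then 1 else 0"
  let ?F = "\<lambda>b x r. if r \<in> {1..n} then \<Sum>s\<in>{1..n}. (if r = s then c else 0) * x s else 0"
  let ?H = "\<lambda>b x r. if r \<in> {1..n} then \<Sum>s\<in>{1..n}. ?\<beta> b r s * x s else 0"
  have "acts (block_op n V (\<lambda>r t. if r = t then S i else \<zero>\<^bsub>End V\<^esub>)) ?F"
    by (rule block_op_acts) (use i S[OF i] in \<open>auto simp: coord_zero coord_smult\<close>)
  moreover have "acts (block_op n V (\<lambda>r t.
       if r = i \<and> t = i then \<zero>\<^bsub>End V\<^esub>
       else if r = i \<and> t = i + 1 then X i
       else if r = i + 1 \<and> t = i then \<one>\<^bsub>End V\<^esub>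
       else if r = i + 1 \<and> t = i + 1 then \<one>\<^bsub>End V\<^esub> \<ominus>\<^bsub>End V\<^esub> X (i + 1)
       else if r = t then \<one>\<^bsub>End V\<^esub> else \<zero>\<^bsub>End V\<^esub>)) ?H"
    by (rule block_op_acts)
      (use i g in \<open>auto simp: X coord_zero coord_minus eigen algebra_simps intro!: E.minus_closed\<close>)
  ultimately show "acts (LM_sigma n V X S i) (\<lambda>b x. ?F b (?H b x))"
    unfolding LM_sigma_def by (rule acts_comp)
  fix b x assume x: "\<And>j. j \<notin> {1..n} \<Longrightarrow> x j = (0 :: 'k)"
  have H: "?H b x = burau (\<nu> b) i x"
  proof
    show "?H b x r = burau (\<nu> b) i x r" for r
    proof (cases "r \<in> {1..n}")
      case r: True
      have rest: "(\<Sum>s\<in>{1..n} - {i, i + 1}. ?\<beta> b r s * x s) = (if r \<in> {i, i + 1} then 0 else x r)"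
      proof -
        have "(\<Sum>s\<in>{1..n} - {i, i + 1}. ?\<beta> b r s * x s) =
          (\<Sum>s\<in>{1..n} - {i, i + 1}. if r = s then x s else 0)"
          by (intro sum.cong) auto
        then show ?thesis
          using r by simp
      qed
      show ?thesis
        using r unfolding sum_two[OF i] rest by (auto simp: burau_apply)
    next
      case False
      then show ?thesis
        using x[OF False] i by (auto simp: burau_apply)
    qed
  qed
  have F: "?F b y = (\<lambda>j. c * y j)" if "\<And>j. j \<notin> {1..n} \<Longrightarrow> y j = 0" for y
  proof
    show "?F b y j = c * y j" for j
      using that[of j] by (auto simp: if_distrib[of "\<lambda>t. t * _"] cong: if_cong)
  qed
  show "?F b (?H b x) = (\<lambda>j. c * burau (\<nu> b) i x j)"
    by (rule HOL.trans[OF arg_cong[OF H, of "?F b"] F]) (use i x in \<open>auto simp: burau_apply\<close>)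
qed

lemma LM_x_GL:
  assumes i: "i \<in> {1..n}"
  shows "LM_x n V lam X i \<in> carrier (GL (vpow n V))"
proof (rule acts_unit[OF LM_x_acts[OF i]])
  let ?F' = "\<lambda>b x. x(i := (x i - (\<Sum>s\<in>{1..n} - {i}. lm_coeff lam (\<nu> b) i s * x s)) / (lam * \<nu> b))"
  show "lm_map lam (\<nu> b) n i (?F' b x) = x" "?F' b (lm_map lam (\<nu> b) n i x) = x" if "b \<in> I" for b x
    using lm_map_inverse[OF nonzero(2) nonzero(1)[OF that] i, of x] by simp_all
  show "?F' b x j = 0" if "\<And>j. j \<notin> {1..n} \<Longrightarrow> x j = 0" "j \<notin> {1..n}" for b x j
    using that i by auto
  show "?F' b (\<lambda>j. x j + y j) j = ?F' b x j + ?F' b y j" for b x y j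
    by (simp add: add_divide_distrib diff_divide_distrib sum.distrib distrib_left)
  show "?F' b (\<lambda>j. a * x j) j = a * ?F' b x j" for a b x j
    by (simp add: diff_divide_distrib right_diff_distrib sum_distrib_left mult_ac)
qed

lemma LM_sigma_GL:
  assumes i: "i \<in> {1..<n}"
  shows "LM_sigma n V X S i \<in> carrier (GL (vpow n V))"
proof (rule acts_unit[OF LM_sigma_acts[OF i]])
  let ?F' = "\<lambda>b x j. (x(i := x (i + 1) - (1 - \<nu> b) * x i / \<nu> b, i + 1 := x i / \<nu> b)) j / c"
  show "(\<lambda>j. c * burau (\<nu> b) i (?F' b x) j) = x" "?F' b (\<lambda>j. c * burau (\<nu> b) i x j) = x" if "b \<in> I" for b x
    using nonzero(1)[OF that] nonzero(4) by (auto simp: fun_eq_iff burau_def field_simps)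
  show "?F' b x j = 0" if "\<And>j. j \<notin> {1..n} \<Longrightarrow> x j = 0" "j \<notin> {1..n}" for b x j
    using that i by auto
  show "?F' b (\<lambda>j. x j + y j) j = ?F' b x j + ?F' b y j" for b x y j
    by (simp add: add_divide_distrib diff_divide_distrib distrib_left)
  show "?F' b (\<lambda>j. a * x j) j = a * ?F' b x j" for a b x j
    by (simp add: diff_divide_distrib right_diff_distrib mult_ac)
qed

lemma burau_scale: "burau \<mu> i (\<lambda>j. a * x j) = (\<lambda>j. a * burau \<mu> i x j)"
  by (rule ext) (simp add: burau_apply algebra_simps)

lemma lm_map_scale: "lm_map lam \<mu> n i (\<lambda>j. a * x j) = (\<lambda>j. a * lm_map lam \<mu> n i x j)"
  by (rule ext) (simp add: lm_map_def lm_row_def sum_distrib_left mult_ac)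

text \<open>By \<open>acts_eqI\<close> each defining relation becomes an identity between maps of scalar sequences, and the
  scalar \<open>c\<close> can be pulled out of all of them.\<close>

lemma LM_images: "FB_images (GL (vpow n V)) n (LM_x n V lam X) (LM_sigma n V X S)"
proof (intro FB_images.intro FB_images_axioms.intro pow.GL_group; (unfold pow.GL_simps(2))?)
  show "LM_x n V lam X \<in> {1..n} \<rightarrow> carrier (GL (vpow n V))"
    using LM_x_GL by blast
  show "LM_sigma n V X S \<in> {1..<n} \<rightarrow> carrier (GL (vpow n V))"
    using LM_sigma_GL by blast
  note acts = acts_eqI[OF acts_comp acts_comp]
  note acts3 = acts_eqI[OF acts_comp[OF acts_comp] acts_comp[OF acts_comp]]
  note acts3' = acts_eqI[OF acts_comp[OF _ acts_comp] acts_comp[OF _ acts_comp]]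
  show "LM_sigma n V X S i \<otimes>\<^bsub>End (vpow n V)\<^esub> LM_sigma n V X S j =
      LM_sigma n V X S j \<otimes>\<^bsub>End (vpow n V)\<^esub> LM_sigma n V X S i"
    if "i \<in> {1..<n}" "j \<in> {1..<n}" "i + 2 \<le> j" for i j
    by (rule acts[OF LM_sigma_acts LM_sigma_acts LM_sigma_acts LM_sigma_acts])
      (use that in \<open>simp_all only: burau_scale burau_far[OF that(3)]\<close>)
  show "LM_sigma n V X S i \<otimes>\<^bsub>End (vpow n V)\<^esub> LM_sigma n V X S (i + 1) \<otimes>\<^bsub>End (vpow n V)\<^esub> LM_sigma n V X S i =
      LM_sigma n V X S (i + 1) \<otimes>\<^bsub>End (vpow n V)\<^esub> LM_sigma n V X S i \<otimes>\<^bsub>End (vpow n V)\<^esub> LM_sigma n V X S (i + 1)"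
    if "i \<in> {1..<n}" "i + 1 \<in> {1..<n}" for i
    by (rule acts3[OF LM_sigma_acts LM_sigma_acts LM_sigma_acts LM_sigma_acts LM_sigma_acts LM_sigma_acts])
      (use that in \<open>simp_all only: burau_scale burau_near\<close>)
  show "LM_sigma n V X S i \<otimes>\<^bsub>End (vpow n V)\<^esub> LM_x n V lam X i =
      LM_x n V lam X (i + 1) \<otimes>\<^bsub>End (vpow n V)\<^esub> LM_sigma n V X S i"
    if "i \<in> {1..<n}" for i
    by (rule acts[OF LM_sigma_acts LM_x_acts LM_x_acts LM_sigma_acts])
      (use that in \<open>simp_all only: lm_map_scale lm_act_first[OF that], auto\<close>)
  show "LM_x n V lam X (i + 1) \<otimes>\<^bsub>End (vpow n V)\<^esub> (LM_sigma n V X S i \<otimes>\<^bsub>End (vpow n V)\<^esub> LM_x n V lam X (i + 1)) =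
      LM_x n V lam X i \<otimes>\<^bsub>End (vpow n V)\<^esub> (LM_x n V lam X (i + 1) \<otimes>\<^bsub>End (vpow n V)\<^esub> LM_sigma n V X S i)"
    if "i \<in> {1..<n}" for i
    by (rule acts3'[OF LM_x_acts LM_sigma_acts LM_x_acts LM_x_acts LM_x_acts LM_sigma_acts])
      (use that in \<open>simp_all only: lm_map_scale lm_act_second[OF that], auto\<close>)
  show "LM_sigma n V X S i \<otimes>\<^bsub>End (vpow n V)\<^esub> LM_x n V lam X j =
      LM_x n V lam X j \<otimes>\<^bsub>End (vpow n V)\<^esub> LM_sigma n V X S i"
    if "i \<in> {1..<n}" "j \<in> {1..n} - {i, i + 1}" for i j
    by (rule acts[OF LM_sigma_acts LM_x_acts LM_x_acts LM_sigma_acts])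
      (use that in \<open>simp_all only: lm_map_scale lm_act_other[OF that], auto\<close>)
qed

lemmas LM_values = rep_on_gens[OF LM_images]

end

section \<open>The Katz--Long--Moody quotient\<close>

lemma Ker_iff: "v \<in> Ker V f \<longleftrightarrow> v \<in> carrier V \<and> f v = \<zero>\<^bsub>V\<^esub>"
  by (auto simp: Ker_def a_kernel_def')

lemma (in vspace) Ker_minus_iff:
  assumes "f \<in> carrier (End V)" "h \<in> carrier (End V)"
  shows "v \<in> Ker V (f \<ominus>\<^bsub>End V\<^esub> h) \<longleftrightarrow> v \<in> carrier V \<and> f v = h v"
  using assms by (auto simp: Ker_iff)

lemma (in coords) diagonal_Ker_dim:
  assumes "f \<in> carrier (End V)" "\<And>v b. v \<in> carrier V \<Longrightarrow> b \<in> I \<Longrightarrow> \<phi> (f v) b = a b * \<phi> v b"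
  shows "subspace_dim V (Ker V f) = card {b \<in> I. a b = 0}"
proof (rule subspace_dim_eq)
  show "Ker V f = {v \<in> carrier V. \<forall>b\<in>I - {b \<in> I. a b = 0}. \<phi> v b = 0}"
  proof (intro equalityI subsetI)
    fix v assume "v \<in> Ker V f"
    then show "v \<in> {v \<in> carrier V. \<forall>b\<in>I - {b \<in> I. a b = 0}. \<phi> v b = 0}"
      using assms(2)[of v] coord_zero by (auto simp: Ker_iff)
  next
    fix v assume v: "v \<in> {v \<in> carrier V. \<forall>b\<in>I - {b \<in> I. a b = 0}. \<phi> v b = 0}"
    then have "f v = \<zero>"
      using assms by (intro coord_eqI) (auto simp: coord_zero)
    with v show "v \<in> Ker V f"
      by (simp add: Ker_iff)
  qed
qed auto

lemma (in coords) diagonal_spec: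
  assumes "f \<in> carrier (End V)" "\<And>v b. v \<in> carrier V \<Longrightarrow> b \<in> I \<Longrightarrow> \<phi> (f v) b = a b * \<phi> v b"
  shows "spec V f = a ` I"
proof (intro equalityI subsetI)
  fix \<mu> assume "\<mu> \<in> spec V f"
  then obtain v where v: "v \<in> carrier V" "v \<noteq> \<zero>" "f v = \<mu> \<odot> v"
    by (auto simp: spec_def)
  then obtain b where b: "b \<in> I" "\<phi> v b \<noteq> 0"
    using coord_eqI[of v \<zero>] coord_zero by auto
  then have "a b = \<mu>"
    using assms(2)[OF v(1) b(1)] v coord_smult[OF v(1) b(1), of \<mu>] by simp
  then show "\<mu> \<in> a ` I"
    using b by auto
next
  fix \<mu> assume "\<mu> \<in> a ` I"
  then obtain b where b: "b \<in> I" "\<mu> = a b"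
    by auto
  let ?v = "vec (\<lambda>j. if j = b then 1 else 0)"
  have "?v \<noteq> \<zero>"
  proof
    assume "?v = \<zero>"
    then have "\<phi> ?v b = 0"
      using coord_zero[OF b(1)] by simp
    then show False
      using b(1) by simp
  qed
  moreover have "f ?v = \<mu> \<odot> ?v"
    using assms b by (intro coord_eqI) (auto simp: coord_smult)
  ultimately show "\<mu> \<in> spec V f"
    unfolding spec_def by (auto intro!: bexI[of _ ?v])
qed

subsection \<open>Scalar polynomial calculus\<close>

lemma hecke_poly_eq: "hecke_poly c \<nu> = [:- c, 1:] * [:c * \<nu>, 1:]"
  by (simp add: hecke_poly_def power2_eq_square)

text \<open>What a polynomial in \<open>c * burau \<nu> i\<close> does to a sequence, by the quadratic relation.\<close>

definition burau_poly :: "'k::field \<Rightarrow> nat \<Rightarrow> 'k \<Rightarrow> 'k poly \<Rightarrow> (nat \<Rightarrow> 'k) \<Rightarrow> nat \<Rightarrow> 'k" where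
  "burau_poly c i \<nu> q x j =
    poly q c * x j + poly (synthetic_div q c) (- c * \<nu>) * (c * burau \<nu> i x j - c * x j)"

text \<open>The minimal polynomial of \<open>\<sigma>\<^sub>i\<close> on the part of the quotient that belongs to an eigenvalue \<open>\<nu> \<noteq> 1\<close>. If
  \<open>n = 2\<close> and \<open>lam * \<nu>\<^sup>2 = 1\<close>, the subspace \<open>L\<close> takes away one of the two dimensions, and on the remaining line
  \<open>\<sigma>\<^sub>1\<close> is the scalar \<open>- c * \<nu>\<close>.\<close>

definition local_min_poly :: "nat \<Rightarrow> 'k::field \<Rightarrow> 'k \<Rightarrow> 'k \<Rightarrow> 'k poly" where
  "local_min_poly n lam c \<nu> = (if n = 2 \<and> lam * \<nu> ^ 2 = 1 then [:c * \<nu>, 1:] else hecke_poly c \<nu>)"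

text \<open>Write \<open>q = (T - c) r + q(c)\<close> with \<open>r\<close> the quotient of the synthetic division. The conditions are
  \<open>T - c\<close> dividing \<open>q\<close> and \<open>T + c \<nu>\<close> dividing \<open>r\<close>, which also covers the double root at \<open>\<nu> = - 1\<close>.\<close>

lemma hecke_poly_dvd_iff:
  "hecke_poly c \<nu> dvd q \<longleftrightarrow> poly q c = 0 \<and> poly (synthetic_div q c) (- c * \<nu>) = 0"
proof -
  have q: "[:- c, 1:] * synthetic_div q c + [:poly q c:] = q"
    by (rule synthetic_div_correct')
  show ?thesis
  proof
    assume dvd: "hecke_poly c \<nu> dvd q"
    then have "[:- c, 1:] dvd q"
      unfolding hecke_poly_eq by (rule dvd_mult_left)
    then have q0: "poly q c = 0"
      by (simp add: poly_eq_0_iff_dvd)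
    then have "[:- c, 1:] * [:c * \<nu>, 1:] dvd [:- c, 1:] * synthetic_div q c"
      using q dvd by (simp add: hecke_poly_eq del: mult_pCons_left)
    then have "[:- (- c * \<nu>), 1:] dvd synthetic_div q c"
      by (subst (asm) dvd_mult_cancel_left) simp
    then show "poly q c = 0 \<and> poly (synthetic_div q c) (- c * \<nu>) = 0"
      using q0 by (simp only: poly_eq_0_iff_dvd)
  next
    assume *: "poly q c = 0 \<and> poly (synthetic_div q c) (- c * \<nu>) = 0"
    then have "[:- (- c * \<nu>), 1:] dvd synthetic_div q c"
      by (simp only: poly_eq_0_iff_dvd)
    then have "[:- c, 1:] * [:c * \<nu>, 1:] dvd [:- c, 1:] * synthetic_div q c"
      by (intro mult_dvd_mono) auto
    also have "[:- c, 1:] * synthetic_div q c = q"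
      using q * by simp
    finally show "hecke_poly c \<nu> dvd q"
      by (simp only: hecke_poly_eq)
  qed
qed

text \<open>The condition \<open>q(- c \<nu>) = 0\<close>, expressed through the division of \<open>q\<close> by \<open>T - c\<close>.\<close>

lemma linear_dvd_iff:
  fixes c :: "'k::field"
  shows "[:c * \<nu>, 1:] dvd q \<longleftrightarrow> poly q c = c * (1 + \<nu>) * poly (synthetic_div q c) (- c * \<nu>)"
proof -
  have "[:c * \<nu>, 1:] dvd q \<longleftrightarrow> poly q (- c * \<nu>) = 0"
    by (simp add: poly_eq_0_iff_dvd)
  also have "poly q (- c * \<nu>) = (- c * \<nu> - c) * poly (synthetic_div q c) (- c * \<nu>) + poly q c"
    by (subst synthetic_div_correct'[of c q, symmetric]) (simp add: algebra_simps)
  finally show ?thesis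
    by (auto simp: algebra_simps eq_neg_iff_add_eq_0)
qed

lemma burau_poly_in_KL_if:
  assumes i: "i \<in> {1..<n}" and dvd: "local_min_poly n lam c \<nu> dvd q"
  shows "in_KL lam n \<nu> (burau_poly c i \<nu> q x)"
proof (cases "n = 2 \<and> lam * \<nu> ^ 2 = 1")
  case True
  have i1: "i = 1" "n = 2" and res: "lam * \<nu> ^ n = 1"
    using True i by auto
  have q: "poly q c = c * (1 + \<nu>) * poly (synthetic_div q c) (- c * \<nu>)"
    using dvd True unfolding local_min_poly_def if_P[OF True] linear_dvd_iff by blast
  (* the multiplier is the last entry of the image, as \<nu> ^ (n - n) = 1 *)
  let ?u = "c * poly (synthetic_div q c) (- c * \<nu>) * (x 1 + x 2)"
  have "{1..n} = {1, 2}"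
    using i1 by auto
  then have "\<forall>j\<in>{1..n}. burau_poly c i \<nu> q x j = ?u * \<nu> ^ (n - j)"
    unfolding i1 burau_poly_def q by (simp add: burau_apply algebra_simps numeral_2_eq_2)
  then show ?thesis
    unfolding in_KL_def using res by blast
next
  case False
  then have "poly q c = 0" "poly (synthetic_div q c) (- c * \<nu>) = 0"
    using dvd unfolding local_min_poly_def by (auto simp: hecke_poly_dvd_iff)
  then show ?thesis
    unfolding in_KL_def burau_poly_def by (intro disjI2 exI[of _ 0]) simp
qed

text \<open>For \<open>n \<ge> 3\<close> some entry of the image of the \<open>i\<close>-th unit sequence vanishes, so that it lies in
  \<open>K + L\<close> only if it is zero.\<close>

lemma burau_poly_in_KL_only_if:
  assumes i: "i \<in> {1..<n}" and \<nu>: "\<nu> \<noteq> 0" "\<nu> \<noteq> 1" and c: "c \<noteq> 0"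
    and KL: "in_KL lam n \<nu> (burau_poly c i \<nu> q (\<lambda>j. if j = i then 1 else 0))"
  shows "local_min_poly n lam c \<nu> dvd q"
proof -
  let ?r = "poly (synthetic_div q c) (- c * \<nu>)"
  let ?y = "burau_poly c i \<nu> q (\<lambda>j. if j = i then 1 else 0)"
  obtain u where u: "u = 0 \<or> lam * \<nu> ^ n = 1" and y: "\<And>j. j \<in> {1..n} \<Longrightarrow> ?y j = u * \<nu> ^ (n - j)"
    using KL \<nu>(2) unfolding in_KL_def by blast
  have yi: "?y i = poly q c - c * ?r" "?y (i + 1) = c * ?r"
    and other: "\<And>j. j \<noteq> i \<Longrightarrow> j \<noteq> i + 1 \<Longrightarrow> ?y j = 0"
    by (auto simp: burau_poly_def burau_apply)
  have ij: "i \<in> {1..n}" "i + 1 \<in> {1..n}"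
    using i by auto
  show ?thesis
  proof (cases "n = 2 \<and> lam * \<nu> ^ 2 = 1")
    case True
    have i1: "i = 1" "n = 2"
      using True i by auto
    have "c * ?r = u" "poly q c - c * ?r = u * \<nu>"
      using y[OF ij(1)] y[OF ij(2)] unfolding yi by (simp_all add: i1 numeral_2_eq_2)
    then have "poly q c = c * (1 + \<nu>) * ?r"
      by (simp add: algebra_simps)
    then show ?thesis
      unfolding local_min_poly_def if_P[OF True] linear_dvd_iff .
  next
    case False
    have "u = 0"
    proof (cases "n = 2")
      case True
      then show ?thesis
        using False u by auto
    next
      case n: False
      have "\<exists>j\<in>{1..n}. j \<noteq> i \<and> j \<noteq> i + 1"
      proof (cases "i = 1")
        case True
        then show ?thesis
          using n i by (intro bexI[of _ 3]) auto
      qed (use i in \<open>auto intro!: bexI[of _ 1]\<close>)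
      then show ?thesis
        using y other \<nu>(1) by force
    qed
    then have "c * ?r = 0" "poly q c - c * ?r = 0"
      using y[OF ij(1)] y[OF ij(2)] unfolding yi by simp_all
    then have "poly q c = 0 \<and> ?r = 0"
      using c by simp
    then show ?thesis
      using False unfolding local_min_poly_def by (auto simp: hecke_poly_dvd_iff)
  qed
qed

subsection \<open>The subspace \<open>K + L\<close> and coordinates of the quotient\<close>

locale klm = eigencoords V I \<phi> n g \<nu> lam c "\<lambda>j. \<rho> (fb_x n j)" "\<lambda>i. \<rho> (fb_sigma n i)"
  for V :: "('k::field, 'v, 'm) module_scheme" (structure) and I :: "'i set" and \<phi> n g \<nu> lam c \<rho>
begin

abbreviation "LMx \<equiv> LM_x n V lam (\<lambda>j. \<rho> (fb_x n j))"
abbreviation "LMs \<equiv> LM_sigma n V (\<lambda>j. \<rho> (fb_x n j)) (\<lambda>i. \<rho> (fb_sigma n i))"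

lemma KLM_K_iff:
  "w \<in> KLM_K n V \<rho> \<longleftrightarrow> w \<in> carrier (vpow n V) \<and> (\<forall>b\<in>I. \<nu> b = 1 \<or> (\<forall>j\<in>{1..n}. seq w b j = 0))"
proof -
  have "w j \<in> Ker V (\<rho> (fb_x n j) \<ominus>\<^bsub>End V\<^esub> \<one>\<^bsub>End V\<^esub>) \<longleftrightarrow> (\<forall>b\<in>I. \<nu> b = 1 \<or> seq w b j = 0)"
    if w: "w \<in> carrier (vpow n V)" and j: "j \<in> {1..n}" for j
  proof -
    have wj: "w j \<in> carrier V"
      using w j by simp
    have "g (w j) = w j \<longleftrightarrow> (\<forall>b\<in>I. \<phi> (g (w j)) b = \<phi> (w j) b)"
      using wj g by (auto intro!: coord_eqI)
    also have "\<dots> \<longleftrightarrow> (\<forall>b\<in>I. \<nu> b = 1 \<or> \<phi> (w j) b = 0)"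
      using wj by (auto simp: eigen)
    finally show ?thesis
      using g wj j unfolding X[OF j] by (simp add: Ker_minus_iff seq_def)
  qed
  then have "w \<in> KLM_K n V \<rho> \<longleftrightarrow> w \<in> carrier (vpow n V) \<and> (\<forall>j\<in>{1..n}. \<forall>b\<in>I. \<nu> b = 1 \<or> seq w b j = 0)"
    unfolding KLM_K_def mem_Collect_eq by blast
  then show ?thesis
    by blast
qed

lemma KLM_L_iff:
  "w \<in> KLM_L n V lam \<rho> \<longleftrightarrow> w \<in> carrier (vpow n V) \<and>
    (\<forall>b\<in>I. \<exists>u. (u = 0 \<or> lam * \<nu> b ^ n = 1) \<and> (\<forall>j\<in>{1..n}. seq w b j = u * \<nu> b ^ (n - j)))"
proof -
  have "w \<in> Ker (vpow n V) (LM_rep n V lam \<rho> (fb_x n j) \<ominus>\<^bsub>End (vpow n V)\<^esub> \<one>\<^bsub>End (vpow n V)\<^esub>) \<longleftrightarrow>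
      w \<in> carrier (vpow n V) \<and> (\<forall>b\<in>I. lm_map lam (\<nu> b) n j (seq w b) = seq w b)"
    if j: "j \<in> {1..n}" for j
  proof -
    note x = LM_x_acts[OF j]
    have "LMx j w = w \<longleftrightarrow> (\<forall>b\<in>I. seq (LMx j w) b = seq w b)" if "w \<in> carrier (vpow n V)"
      using that actsD(1)[OF x] by (auto intro!: seq_eqI)
    then have "LMx j w = w \<longleftrightarrow> (\<forall>b\<in>I. lm_map lam (\<nu> b) n j (seq w b) = seq w b)"
      if "w \<in> carrier (vpow n V)"
      using that actsD(2)[OF x that] by auto
    then show ?thesis
      unfolding LM_rep_def LM_values(1)[OF j] using actsD(1)[OF x] by (auto simp: pow.Ker_minus_iff)
  qed
  then have "w \<in> KLM_L n V lam \<rho> \<longleftrightarrow> w \<in> carrier (vpow n V) \<and>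
      (\<forall>b\<in>I. \<forall>j\<in>{1..n}. lm_map lam (\<nu> b) n j (seq w b) = seq w b)"
    unfolding KLM_L_def using n_pos by auto
  then show ?thesis
    unfolding lm_fixed_iff[OF nonzero(3) n_pos] .
qed

text \<open>A coordinate sequence at \<open>\<nu> b = 1\<close> can be put entirely into \<open>K\<close>, and at \<open>\<nu> b \<noteq> 1\<close> the subspace \<open>K\<close>
  contributes nothing; so membership in the sum is decided separately for each \<open>b\<close>.\<close>

lemma KL_iff:
  "w \<in> KLM_K n V \<rho> <+>\<^bsub>vpow n V\<^esub> KLM_L n V lam \<rho> \<longleftrightarrow>
    w \<in> carrier (vpow n V) \<and> (\<forall>b\<in>I. in_KL lam n (\<nu> b) (seq w b))"
proof
  assume "w \<in> KLM_K n V \<rho> <+>\<^bsub>vpow n V\<^esub> KLM_L n V lam \<rho>"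
  then obtain k l where kl: "k \<in> KLM_K n V \<rho>" "l \<in> KLM_L n V lam \<rho>" "w = k \<oplus>\<^bsub>vpow n V\<^esub> l"
    by (auto simp: pow.set_add_iff)
  have carr: "k \<in> carrier (vpow n V)" "l \<in> carrier (vpow n V)"
    using kl by (auto simp: KLM_K_iff KLM_L_iff)
  moreover have "in_KL lam n (\<nu> b) (seq w b)" if b: "b \<in> I" for b
  proof (cases "\<nu> b = 1")
    case False
    then have "\<forall>j\<in>{1..n}. seq w b j = seq l b j"
      using kl(1) b unfolding kl(3) seq_add[OF carr b] KLM_K_iff by auto
    then show ?thesis
      using kl(2) b unfolding KLM_L_iff in_KL_def by auto
  qed (simp add: in_KL_def)
  ultimately show "w \<in> carrier (vpow n V) \<and> (\<forall>b\<in>I. in_KL lam n (\<nu> b) (seq w b))"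
    by (simp add: kl(3))
next
  assume w: "w \<in> carrier (vpow n V) \<and> (\<forall>b\<in>I. in_KL lam n (\<nu> b) (seq w b))"
  define k where "k = pow.vec (\<lambda>p. if \<nu> (snd p) = 1 then seq w (snd p) (fst p) else 0)"
  define l where "l = pow.vec (\<lambda>p. if \<nu> (snd p) = 1 then 0 else seq w (snd p) (fst p))"
  have carr: "k \<in> carrier (vpow n V)" "l \<in> carrier (vpow n V)"
    unfolding k_def l_def by (rule pow.vec_closed)+
  have k: "seq k b j = (if \<nu> b = 1 then seq w b j else 0)"
    and l: "seq l b j = (if \<nu> b = 1 then 0 else seq w b j)" if "j \<in> {1..n}" "b \<in> I" for j b
    using that pow.coord_vec[of "(j, b)"] unfolding k_def l_def by auto
  have "k \<in> KLM_K n V \<rho>"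
    using carr k unfolding KLM_K_iff by auto
  moreover have "l \<in> KLM_L n V lam \<rho>"
    unfolding KLM_L_iff
  proof (intro conjI ballI carr)
    show "\<exists>u. (u = 0 \<or> lam * \<nu> b ^ n = 1) \<and> (\<forall>j\<in>{1..n}. seq l b j = u * \<nu> b ^ (n - j))" if b: "b \<in> I" for b
    proof (cases "\<nu> b = 1")
      case False
      then show ?thesis
        using w b l unfolding in_KL_def by auto
    qed (use b l in \<open>auto intro!: exI[of _ 0]\<close>)
  qed
  moreover have "w = k \<oplus>\<^bsub>vpow n V\<^esub> l"
  proof (rule pow.coord_eqI)
    show "seq w (snd p) (fst p) = seq (k \<oplus>\<^bsub>vpow n V\<^esub> l) (snd p) (fst p)" if "p \<in> {1..n} \<times> I" for p
      using that k l seq_add[OF carr] by auto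
  qed (use w carr in auto)
  ultimately show "w \<in> KLM_K n V \<rho> <+>\<^bsub>vpow n V\<^esub> KLM_L n V lam \<rho>"
    unfolding pow.set_add_iff by blast
qed

text \<open>Coordinates on the quotient: for \<open>\<nu> b \<noteq> 1\<close> the entries of the \<open>b\<close>-th sequence, except the last
  one where \<open>L\<close> is non-trivial.\<close>

definition "J = {p \<in> {1..n} \<times> I. \<nu> (snd p) \<noteq> 1 \<and> \<not> (fst p = n \<and> lam * \<nu> (snd p) ^ n = 1)}"

text \<open>At an eigenvalue where \<open>L\<close> is non-trivial, a multiple of the generating sequence \<open>\<nu> ^ (n - j)\<close> with the
  same last entry is subtracted, so that the coordinates vanish on \<open>L\<close>.\<close>

definition "\<Psi> w = (\<lambda>p. seq w (snd p) (fst p) -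
  (if lam * \<nu> (snd p) ^ n = 1 then \<nu> (snd p) ^ (n - fst p) * seq w (snd p) n else 0))"

lemma quotient_coords: "quotient_coords (vpow n V) J \<Psi>"
proof (intro quotient_coords.intro quotient_coords_axioms.intro)
  show "vspace (vpow n V)"
    by (rule pow.vspace_axioms)
  show "finite J"
    using finite_index by (auto simp: J_def)
  show "\<Psi> (u \<oplus>\<^bsub>vpow n V\<^esub> v) i = \<Psi> u i + \<Psi> v i"
    if "u \<in> carrier (vpow n V)" "v \<in> carrier (vpow n V)" "i \<in> J" for u v i
    using that by (auto simp: J_def \<Psi>_def seq_add algebra_simps)
  show "\<Psi> (a \<odot>\<^bsub>vpow n V\<^esub> v) i = a * \<Psi> v i" if "v \<in> carrier (vpow n V)" "i \<in> J" for a v i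
    using that by (auto simp: J_def \<Psi>_def seq_smult algebra_simps)
  show "\<exists>v\<in>carrier (vpow n V). \<forall>i\<in>J. \<Psi> v i = x i" for x
  proof
    let ?v = "pow.vec (\<lambda>p. if p \<in> J then x p else 0)"
    show "?v \<in> carrier (vpow n V)"
      by (rule pow.vec_closed)
    have v: "seq ?v b j = (if (j, b) \<in> J then x (j, b) else 0)" if "j \<in> {1..n}" "b \<in> I" for j b
      using pow.coord_vec[of "(j, b)"] that by auto
    show "\<forall>i\<in>J. \<Psi> ?v i = x i"
    proof
      fix i assume i: "i \<in> J"
      obtain j b where ij: "i = (j, b)" by (cases i)
      have jb: "j \<in> {1..n}" "b \<in> I" "n \<in> {1..n}"
        using i n_pos by (auto simp: J_def ij)
      show "\<Psi> ?v i = x i"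
        using i unfolding \<Psi>_def ij using v[OF jb(1,2)] v[OF jb(3,2)] by (auto simp: J_def)
    qed
  qed
qed

sublocale quot: quotient_coords "vpow n V" J \<Psi>
  by (rule quotient_coords)

lemma M_eq: "quot.M = KLM_K n V \<rho> <+>\<^bsub>vpow n V\<^esub> KLM_L n V lam \<rho>"
proof (intro equalityI subsetI)
  fix w assume "w \<in> quot.M"
  then have w: "w \<in> carrier (vpow n V)" and \<Psi>: "\<And>p. p \<in> J \<Longrightarrow> \<Psi> w p = 0"
    by (auto simp: quot.M_def)
  have "in_KL lam n (\<nu> b) (seq w b)" if b: "b \<in> I" for b
  proof (cases "\<nu> b = 1")
    case False
    let ?u = "if lam * \<nu> b ^ n = 1 then seq w b n else 0"
    show ?thesis
      unfolding in_KL_def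
    proof (rule disjI2, rule exI[of _ ?u], rule conjI, rule_tac [2] ballI)
      show "?u = 0 \<or> lam * \<nu> b ^ n = 1"
        by simp
      show "seq w b j = ?u * \<nu> b ^ (n - j)" if "j \<in> {1..n}" for j
        using \<Psi>[of "(j, b)"] that b False
        by (cases "j = n") (auto simp: J_def \<Psi>_def mult.commute split: if_splits)
    qed
  qed (simp add: in_KL_def)
  with w show "w \<in> KLM_K n V \<rho> <+>\<^bsub>vpow n V\<^esub> KLM_L n V lam \<rho>"
    by (simp add: KL_iff)
next
  fix w assume "w \<in> KLM_K n V \<rho> <+>\<^bsub>vpow n V\<^esub> KLM_L n V lam \<rho>"
  then have w: "w \<in> carrier (vpow n V)" and KL: "\<And>b. b \<in> I \<Longrightarrow> in_KL lam n (\<nu> b) (seq w b)"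
    by (auto simp: KL_iff)
  have "\<Psi> w p = 0" if p: "p \<in> J" for p
  proof -
    obtain j b where jb: "p = (j, b)" "j \<in> {1..n}" "b \<in> I" "\<nu> b \<noteq> 1"
      using p by (auto simp: J_def)
    then obtain u where "u = 0 \<or> lam * \<nu> b ^ n = 1" "\<forall>j\<in>{1..n}. seq w b j = u * \<nu> b ^ (n - j)"
      using KL[of b] by (auto simp: in_KL_def)
    then show ?thesis
      using jb n_pos by (auto simp: \<Psi>_def)
  qed
  with w show "w \<in> quot.M"
    by (simp add: quot.M_def)
qed

lemma in_M_iff: "w \<in> carrier (vpow n V) \<Longrightarrow> w \<in> quot.M \<longleftrightarrow> (\<forall>b\<in>I. in_KL lam n (\<nu> b) (seq w b))"
  by (simp add: M_eq KL_iff)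

lemma KLM_space_eq: "KLM_space n V lam \<rho> = quot.Q"
  by (simp add: KLM_space_def quot.Q_def M_eq)

definition "Sop i = KLM_rep n V lam \<rho> (fb_sigma n i)"

lemma LMs_acts: "i \<in> {1..<n} \<Longrightarrow> acts (LMs i) (\<lambda>b x j. c * burau (\<nu> b) i x j)"
  by (rule LM_sigma_acts)

lemma LMs_End: "i \<in> {1..<n} \<Longrightarrow> LMs i \<in> carrier (End (vpow n V))"
  using LMs_acts actsD(1) by blast

lemma LMs_invariant: "i \<in> {1..<n} \<Longrightarrow> LMs i ` quot.M \<subseteq> quot.M"
proof
  fix w' assume i: "i \<in> {1..<n}" and "w' \<in> LMs i ` quot.M"
  then obtain w where w: "w \<in> quot.M" "w' = LMs i w"
    by auto
  then have wc: "w \<in> carrier (vpow n V)"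
    by (simp add: quot.M_def)
  have "in_KL lam n (\<nu> b) (seq w' b)" if b: "b \<in> I" for b
    unfolding w(2) actsD(2)[OF LMs_acts[OF i] wc b]
    using w(1) b wc by (intro burau_in_KL[OF i]) (simp add: in_M_iff)
  then show "w' \<in> quot.M"
    using LMs_End[OF i] wc unfolding w(2) by (subst in_M_iff) auto
qed

lemma Sop_eq: "i \<in> {1..<n} \<Longrightarrow> Sop i = induced_op (vpow n V) quot.M (LMs i)"
  by (simp add: Sop_def KLM_rep_def fb_sigma_in M_eq LM_rep_def LM_values(2))

lemma Sop_End: "i \<in> {1..<n} \<Longrightarrow> Sop i \<in> carrier (End quot.Q)"
  unfolding Sop_eq by (rule quot.induced_op_End[OF LMs_End LMs_invariant])

lemma Sop_proj:
  "i \<in> {1..<n} \<Longrightarrow> w \<in> carrier (vpow n V) \<Longrightarrow> Sop i (quot.\<pi> w) = quot.\<pi> (LMs i w)"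
  unfolding Sop_eq by (rule quot.induced_op_proj[OF LMs_End LMs_invariant])

lemma Q_End_eqI:
  assumes "f \<in> carrier (End quot.Q)" "h \<in> carrier (End quot.Q)"
    and "\<And>w. w \<in> carrier (vpow n V) \<Longrightarrow> f (quot.\<pi> w) = h (quot.\<pi> w)"
  shows "f = h"
  using assms(3) by (intro quot.Q.End_eqI[OF assms(1,2)]) (auto simp: quot.Q_carrier)

lemma Sop_braid_far:
  assumes "i \<in> {1..<n}" "j \<in> {1..<n}" "i + 2 \<le> j"
  shows "Sop i \<otimes>\<^bsub>End quot.Q\<^esub> Sop j = Sop j \<otimes>\<^bsub>End quot.Q\<^esub> Sop i"
proof (rule Q_End_eqI)
  fix w assume w: "w \<in> carrier (vpow n V)"
  have "LMs i (LMs j w) = LMs j (LMs i w)"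
    using fun_cong[OF FB_images.braid_far[OF LM_images assms], of w] w by simp
  then show "(Sop i \<otimes>\<^bsub>End quot.Q\<^esub> Sop j) (quot.\<pi> w) = (Sop j \<otimes>\<^bsub>End quot.Q\<^esub> Sop i) (quot.\<pi> w)"
    using assms w by (simp add: Sop_proj LMs_End)
qed (use assms in \<open>simp_all add: Sop_End\<close>)

lemma Sop_braid_near:
  assumes "i \<in> {1..<n}" "i + 1 \<in> {1..<n}"
  shows "Sop i \<otimes>\<^bsub>End quot.Q\<^esub> Sop (i + 1) \<otimes>\<^bsub>End quot.Q\<^esub> Sop i =
    Sop (i + 1) \<otimes>\<^bsub>End quot.Q\<^esub> Sop i \<otimes>\<^bsub>End quot.Q\<^esub> Sop (i + 1)"
proof (rule Q_End_eqI)
  fix w assume w: "w \<in> carrier (vpow n V)"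
  have "LMs i (LMs (i + 1) (LMs i w)) = LMs (i + 1) (LMs i (LMs (i + 1) w))"
    using fun_cong[OF FB_images.braid_near[OF LM_images assms], of w] w LMs_End[OF assms(1)] LMs_End[OF assms(2)] by simp
  then show "(Sop i \<otimes>\<^bsub>End quot.Q\<^esub> Sop (i + 1) \<otimes>\<^bsub>End quot.Q\<^esub> Sop i) (quot.\<pi> w) =
      (Sop (i + 1) \<otimes>\<^bsub>End quot.Q\<^esub> Sop i \<otimes>\<^bsub>End quot.Q\<^esub> Sop (i + 1)) (quot.\<pi> w)"
    using assms w LMs_End[OF assms(1)] LMs_End[OF assms(2)] Sop_proj[OF assms(1)] Sop_proj[OF assms(2)] by simp
qed (use Sop_End[OF assms(1)] Sop_End[OF assms(2)] in \<open>simp_all only: quot.Q.End_ops_closed\<close>)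

lemma seq_zero: "b \<in> I \<Longrightarrow> seq \<zero>\<^bsub>vpow n V\<^esub> b = (\<lambda>j. 0)"
  using seq_smult[of "\<zero>\<^bsub>vpow n V\<^esub>" b 0] by simp

text \<open>Synthetic division by \<open>T - c\<close>, together with \<open>(LMs i - c) (LMs i + c \<nu>) = 0\<close>, evaluates
  every polynomial in the operator.\<close>

lemma seq_op_poly:
  assumes i: "i \<in> {1..<n}" and b: "b \<in> I" and w: "w \<in> carrier (vpow n V)"
  shows "seq (op_poly (vpow n V) q (LMs i) w) b = burau_poly c i (\<nu> b) q (seq w b)"
  using w
proof (induction q arbitrary: w)
  case 0
  then show ?case
    using LMs_End[OF i] b by (simp add: seq_zero) (simp add: burau_poly_def fun_eq_iff)
next
  case (pCons a q)
  note T = LMs_End[OF i]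
  let ?x = "seq w b"
  have x: "seq (LMs i w) b = (\<lambda>j. c * burau (\<nu> b) i ?x j)"
    by (rule actsD(2)[OF LMs_acts[OF i] pCons.prems b])
  have quad: "burau (\<nu> b) i (\<lambda>j. c * burau (\<nu> b) i ?x j) j =
      c * (\<nu> b * ?x j + (1 - \<nu> b) * burau (\<nu> b) i ?x j)" for j
    using fun_cong[OF burau_quadratic[of "\<nu> b" i ?x], of j]
    by (simp add: burau_apply algebra_simps)
  have "seq (op_poly (vpow n V) (pCons a q) (LMs i) w) b =
    (\<lambda>j. a * ?x j + burau_poly c i (\<nu> b) q (\<lambda>j. c * burau (\<nu> b) i ?x j) j)"
    using T pCons.prems b pCons.IH[of "LMs i w"]
    by (simp add: pow.op_poly_pCons seq_add seq_smult x)
  also have "\<dots> = burau_poly c i (\<nu> b) (pCons a q) ?x"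
    unfolding burau_poly_def synthetic_div_pCons quad by (rule ext) (simp add: algebra_simps)
  finally show ?case .
qed

text \<open>The polynomial kills the quotient if and only if it sends every coordinate sequence to one of
  \<open>K + L\<close>. For necessity it is enough to test the vector all of whose coordinate sequences are the \<open>i\<close>-th unit
  sequence. Minimal polynomials, quadratic relations and spectra of the braid generators all
  follow from this criterion.\<close>

theorem op_poly_Sop_eq_zero_iff:
  assumes i: "i \<in> {1..<n}"
  shows "op_poly quot.Q q (Sop i) = \<zero>\<^bsub>End quot.Q\<^esub> \<longleftrightarrow>
    (\<forall>b\<in>I. \<nu> b \<noteq> 1 \<longrightarrow> local_min_poly n lam c (\<nu> b) dvd q)"
proof -
  note T = LMs_End[OF i]
  have closed: "op_poly quot.Q q (Sop i) \<in> carrier (End quot.Q)"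
    using Sop_End[OF i] by (rule quot.Q.op_poly_closed)
  have vanish: "op_poly quot.Q q (Sop i) (quot.\<pi> w) = \<zero>\<^bsub>quot.Q\<^esub> \<longleftrightarrow>
      (\<forall>b\<in>I. in_KL lam n (\<nu> b) (burau_poly c i (\<nu> b) q (seq w b)))" if w: "w \<in> carrier (vpow n V)" for w
  proof -
    have "op_poly quot.Q q (Sop i) (quot.\<pi> w) = quot.\<pi> (op_poly (vpow n V) q (LMs i) w)"
      unfolding Sop_eq[OF i] by (rule quot.op_poly_induced[OF T LMs_invariant[OF i] w])
    then show ?thesis
      using T w by (simp add: quot.proj_zero_iff in_M_iff seq_op_poly[OF i])
  qed
  show ?thesis
  proof
    assume zero: "op_poly quot.Q q (Sop i) = \<zero>\<^bsub>End quot.Q\<^esub>"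
    show "\<forall>b\<in>I. \<nu> b \<noteq> 1 \<longrightarrow> local_min_poly n lam c (\<nu> b) dvd q"
    proof (intro ballI impI)
      fix b assume b: "b \<in> I" "\<nu> b \<noteq> 1"
      let ?w = "pow.vec (\<lambda>p. if fst p = i then 1 else 0)"
      have w: "?w \<in> carrier (vpow n V)"
        by (rule pow.vec_closed)
      have "seq ?w b j = (if j = i then 1 else 0)" for j
        using pow.coord_vec[of "(j, b)"] b i by (cases "j \<in> {1..n}") (auto simp: seq_outside)
      then have "seq ?w b = (\<lambda>j. if j = i then 1 else 0)"
        by auto
      moreover have "op_poly quot.Q q (Sop i) (quot.\<pi> ?w) = \<zero>\<^bsub>quot.Q\<^esub>"
        unfolding zero using w by (intro quot.Q.End_apply quot.proj_closed)
      ultimately have "in_KL lam n (\<nu> b) (burau_poly c i (\<nu> b) q (\<lambda>j. if j = i then 1 else 0))"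
        using vanish[OF w] b(1) by auto
      then show "local_min_poly n lam c (\<nu> b) dvd q"
        using i b nonzero by (intro burau_poly_in_KL_only_if[OF i]) auto
    qed
  next
    assume dvd: "\<forall>b\<in>I. \<nu> b \<noteq> 1 \<longrightarrow> local_min_poly n lam c (\<nu> b) dvd q"
    have "in_KL lam n (\<nu> b) (burau_poly c i (\<nu> b) q x)" if "b \<in> I" for b x
      using dvd that burau_poly_in_KL_if[OF i, of lam c "\<nu> b" q x] by (cases "\<nu> b = 1") (auto simp: in_KL_def)
    then show "op_poly quot.Q q (Sop i) = \<zero>\<^bsub>End quot.Q\<^esub>"
      using closed vanish by (intro Q_End_eqI) auto
  qed
qed

lemma vdim_Q:
  "int (vdim quot.Q) = int n * (int (card I) - int (card {b \<in> I. \<nu> b = 1})) - int (card {b \<in> I. lam * \<nu> b ^ n = 1})"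
proof -
  let ?A = "{b \<in> I. \<nu> b = 1}" and ?R = "{b \<in> I. lam * \<nu> b ^ n = 1}"
  have "J = {1..n} \<times> (I - ?A) - {n} \<times> ?R"
    by (auto simp: J_def)
  moreover have sub: "{n} \<times> ?R \<subseteq> {1..n} \<times> (I - ?A)"
    using n_pos nonzero(3) by auto
  moreover have "finite ({n} \<times> ?R)"
    using finite_index by auto
  ultimately have "card J = n * card (I - ?A) - card ?R"
    by (simp add: card_Diff_subset card_cartesian_product)
  moreover have "card ?R \<le> n * card (I - ?A)"
    using card_mono[OF _ sub] finite_index by (simp add: card_cartesian_product)
  moreover have "card (I - ?A) = card I - card ?A" "card ?A \<le> card I"
    using finite_index by (auto intro!: card_Diff_subset card_mono)
  ultimately show ?thesis
    by (simp add: quot.Q.vdim_eq of_nat_diff)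
qed

end

section \<open>Quadratic relations and least common multiples\<close>

context vspace
begin

lemma minus_scalar_op:
  "f \<in> carrier (End V) \<Longrightarrow> f \<ominus>\<^bsub>End V\<^esub> scalar_op V a = f \<oplus>\<^bsub>End V\<^esub> scalar_op V (- a)"
proof (rule End_eqI)
  fix v assume f: "f \<in> carrier (End V)" and v: "v \<in> carrier V"
  have "(- a) \<odot> v = \<ominus> (a \<odot> v)"
    using vs_distrib(3)[of v "- 1" a] v by (simp add: vs_minus_one)
  then show "(f \<ominus>\<^bsub>End V\<^esub> scalar_op V a) v = (f \<oplus>\<^bsub>End V\<^esub> scalar_op V (- a)) v"
    using f v by (simp add: minus_eq)
qed auto

lemma smult_eq_zero:
  assumes "v \<in> carrier V" "v \<noteq> \<zero>" "s \<odot> v = \<zero>"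
  shows "s = 0"
proof (rule ccontr)
  assume "s \<noteq> 0"
  then have "v = inverse s \<odot> (s \<odot> v)"
    using assms(1) by (simp flip: vs_distrib(3))
  then show False
    using assms by simp
qed

lemma op_poly_linear: "f \<in> carrier (End V) \<Longrightarrow> op_poly V [:a, 1:] f = f \<oplus>\<^bsub>End V\<^esub> scalar_op V a"
  by (rule End_eqI) (auto simp: op_poly_pCons a_comm)

lemma op_poly_quadratic:
  assumes f: "f \<in> carrier (End V)"
  shows "op_poly V ([:- a, 1:] * [:b, 1:]) f =
    (f \<ominus>\<^bsub>End V\<^esub> scalar_op V a) \<otimes>\<^bsub>End V\<^esub> (f \<oplus>\<^bsub>End V\<^esub> scalar_op V b)"
proof (rule End_eqI)
  fix v assume v: "v \<in> carrier V"
  have "op_poly V ([:- a, 1:] * [:b, 1:]) f v = op_poly V ([:- (- b), 1:] * [:- a, 1:]) f v"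
    by (subst mult.commute) simp
  also have "\<dots> = (f \<ominus>\<^bsub>End V\<^esub> scalar_op V a) (f v \<oplus> b \<odot> v)"
    using op_poly_linear_factor[OF f v, of "- b" "[:- a, 1:]"]
    by (simp only: op_poly_linear[OF f] minus_scalar_op[OF f] group_add_class.minus_minus)
  finally show "op_poly V ([:- a, 1:] * [:b, 1:]) f v =
      ((f \<ominus>\<^bsub>End V\<^esub> scalar_op V a) \<otimes>\<^bsub>End V\<^esub> (f \<oplus>\<^bsub>End V\<^esub> scalar_op V b)) v"
    using f v by simp
qed (use f in auto)

text \<open>With \<open>t f - 1 = t (f - 1 / t)\<close> and \<open>t f + q = t (f + q / t)\<close> a quadratic relation for \<open>f\<close> becomes the
  quadratic relation of a Hecke generator for \<open>t f\<close>.\<close>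

lemma scaled_quadratic:
  assumes f: "f \<in> carrier (End V)" and t: "t \<noteq> 0"
    and zero: "op_poly V ([:- (1 / t), 1:] * [:q / t, 1:]) f = \<zero>\<^bsub>End V\<^esub>"
  shows "(t \<odot>\<^bsub>End V\<^esub> f \<ominus>\<^bsub>End V\<^esub> \<one>\<^bsub>End V\<^esub>) \<otimes>\<^bsub>End V\<^esub> (t \<odot>\<^bsub>End V\<^esub> f \<oplus>\<^bsub>End V\<^esub> q \<odot>\<^bsub>End V\<^esub> \<one>\<^bsub>End V\<^esub>) = \<zero>\<^bsub>End V\<^esub>"
proof -
  have scale: "t \<odot>\<^bsub>End V\<^esub> f \<oplus>\<^bsub>End V\<^esub> r \<odot>\<^bsub>End V\<^esub> \<one>\<^bsub>End V\<^esub> = t \<odot>\<^bsub>End V\<^esub> (f \<oplus>\<^bsub>End V\<^esub> scalar_op V (r / t))" for r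
    using f t by (intro End_eqI) (auto simp: vs_distrib(2) simp flip: vs_distrib(3))
  have minus: "t \<odot>\<^bsub>End V\<^esub> f \<ominus>\<^bsub>End V\<^esub> \<one>\<^bsub>End V\<^esub> = t \<odot>\<^bsub>End V\<^esub> f \<oplus>\<^bsub>End V\<^esub> (- 1) \<odot>\<^bsub>End V\<^esub> \<one>\<^bsub>End V\<^esub>"
    using f minus_scalar_op[of "t \<odot>\<^bsub>End V\<^esub> f" 1] by (simp add: scalar_op_def)
  have "(f \<oplus>\<^bsub>End V\<^esub> scalar_op V (- 1 / t)) \<otimes>\<^bsub>End V\<^esub> (f \<oplus>\<^bsub>End V\<^esub> scalar_op V (q / t)) = \<zero>\<^bsub>End V\<^esub>"
    using zero unfolding op_poly_quadratic[OF f] minus_scalar_op[OF f] by simp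
  moreover have "(t \<odot>\<^bsub>End V\<^esub> a) \<otimes>\<^bsub>End V\<^esub> (t \<odot>\<^bsub>End V\<^esub> b) = t \<odot>\<^bsub>End V\<^esub> (t \<odot>\<^bsub>End V\<^esub> (a \<otimes>\<^bsub>End V\<^esub> b))"
    if "a \<in> carrier (End V)" "b \<in> carrier (End V)" for a b
    using that by (intro End_eqI) auto
  ultimately show ?thesis
    unfolding minus scale using f by (simp add: EM.rmult_0)
qed

text \<open>If \<open>(f - a) (f - b) = 0\<close> with \<open>a \<noteq> b\<close>, then \<open>(b - a) v = (f - a) v - (f - b) v\<close> writes every
  vector as a sum of two eigenvectors.\<close>

context
  fixes f and a b
  assumes f: "f \<in> carrier (End V)" and ab: "a \<noteq> b"
    and zero: "(f \<ominus>\<^bsub>End V\<^esub> scalar_op V a) \<otimes>\<^bsub>End V\<^esub> (f \<ominus>\<^bsub>End V\<^esub> scalar_op V b) = \<zero>\<^bsub>End V\<^esub>"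
begin

lemma eigen_components:
  assumes v: "v \<in> carrier V"
  shows "f (f v \<oplus> (- b) \<odot> v) = a \<odot> (f v \<oplus> (- b) \<odot> v)" "f (f v \<oplus> (- a) \<odot> v) = b \<odot> (f v \<oplus> (- a) \<odot> v)"
proof -
  have swap: "(f \<ominus>\<^bsub>End V\<^esub> scalar_op V b) \<otimes>\<^bsub>End V\<^esub> (f \<ominus>\<^bsub>End V\<^esub> scalar_op V a) = \<zero>\<^bsub>End V\<^esub>"
    using zero op_poly_quadratic[OF f, of a "- b"] op_poly_quadratic[OF f, of b "- a"]
    unfolding minus_scalar_op[OF f] by (simp only: mult.commute)
  have move: "f w = s \<odot> w" if w: "w \<in> carrier V" "f w \<oplus> (- s) \<odot> w = \<zero>" for w s
  proof -
    have "f w = f w \<oplus> (- s) \<odot> w \<oplus> s \<odot> w"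
      using w(1) f vs_distrib(1)[of w "- s" s] by (simp add: a_assoc)
    then show ?thesis
      using w by simp
  qed
  have "((f \<oplus>\<^bsub>End V\<^esub> scalar_op V (- a)) \<otimes>\<^bsub>End V\<^esub> (f \<oplus>\<^bsub>End V\<^esub> scalar_op V (- b))) v = \<zero>"
    using zero v unfolding minus_scalar_op[OF f] by (simp only: End_apply)
  moreover have "((f \<oplus>\<^bsub>End V\<^esub> scalar_op V (- b)) \<otimes>\<^bsub>End V\<^esub> (f \<oplus>\<^bsub>End V\<^esub> scalar_op V (- a))) v = \<zero>"
    using swap v unfolding minus_scalar_op[OF f] by (simp only: End_apply)
  ultimately show "f (f v \<oplus> (- b) \<odot> v) = a \<odot> (f v \<oplus> (- b) \<odot> v)" "f (f v \<oplus> (- a) \<odot> v) = b \<odot> (f v \<oplus> (- a) \<odot> v)"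
    using f v by (intro move; simp)+
qed

lemma quadratic_semisimple:
  assumes fd: fin_dim
  shows "semisimple V f"
proof -
  obtain B where B: "finite B" "basis B"
    using finite_basis_exists[OF fd] by blast
  have Bc: "B \<subseteq> carrier V" and gen: "span B = carrier V"
    using B by (auto simp: basis_def)
  define D where "D = (\<lambda>v. f v \<oplus> (- b) \<odot> v) ` B \<union> (\<lambda>v. f v \<oplus> (- a) \<odot> v) ` B - {\<zero>}"
  have "finite D"
    using B by (simp add: D_def)
  moreover have De: "D \<subseteq> eigenvectors f"
  proof
    fix d assume "d \<in> D"
    then obtain v s where d: "v \<in> B" "d = f v \<oplus> (- s) \<odot> v" "s = a \<or> s = b" "d \<noteq> \<zero>"
      unfolding D_def by blast
    then have v: "v \<in> carrier V"
      using Bc by auto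
    have "f d = b \<odot> d \<or> f d = a \<odot> d"
      using d(3) eigen_components[OF v] unfolding d(2) by (elim disjE) (simp_all only: simp_thms)
    then have "\<exists>t. f d = t \<odot> d"
      by (elim disjE) (rule exI, assumption)+
    then show "d \<in> eigenvectors f"
      using v f d(2,4) by (simp add: eigenvectors_def)
  qed
  moreover have "span D = carrier V"
  proof -
    have Dc: "D \<subseteq> carrier V"
      using De by (auto simp: eigenvectors_def)
    note S = subspace_closed[OF span_is_subspace[OF Dc]]
    have comp: "f v \<oplus> (- s) \<odot> v \<in> span D" if "v \<in> B" "s = a \<or> s = b" for v s
    proof (cases "f v \<oplus> (- s) \<odot> v = \<zero>")
      case False
      then have "f v \<oplus> (- s) \<odot> v \<in> D"
        using that unfolding D_def by blast
      then show ?thesis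
        using in_own_span[OF Dc] by auto
    qed (use S(2) in simp)
    have "v \<in> span D" if v: "v \<in> B" for v
    proof -
      have vc: "v \<in> carrier V"
        using v Bc by auto
      have "(f v \<oplus> (- a) \<odot> v) \<oplus> (- 1) \<odot> (f v \<oplus> (- b) \<odot> v) = (b - a) \<odot> v"
      proof -
        have "(- 1) \<odot> (f v \<oplus> (- b) \<odot> v) = (- 1) \<odot> f v \<oplus> b \<odot> v"
          using f vc by (simp add: vs_distrib(2) flip: vs_distrib(3))
        moreover have "f v \<oplus> (- 1) \<odot> f v = \<zero>"
          using f vc by (simp add: vs_minus_one r_neg)
        moreover have "(b - a) \<odot> v = (- a) \<odot> v \<oplus> b \<odot> v"
          using vc vs_distrib(1)[of v "- a" b] by simp
        moreover have "(f v \<oplus> (- a) \<odot> v) \<oplus> ((- 1) \<odot> f v \<oplus> b \<odot> v) =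
            (f v \<oplus> (- 1) \<odot> f v) \<oplus> ((- a) \<odot> v \<oplus> b \<odot> v)"
          using f vc by (simp add: a_ac)
        ultimately show ?thesis
          using vc by simp
      qed
      moreover have "inverse (b - a) \<odot> ((b - a) \<odot> v) = v"
        using ab vc by (simp flip: vs_distrib(3))
      ultimately have "v = inverse (b - a) \<odot> ((f v \<oplus> (- a) \<odot> v) \<oplus> (- 1) \<odot> (f v \<oplus> (- b) \<odot> v))"
        by simp
      moreover have "\<dots> \<in> span D"
        by (rule S(4)[OF S(3)[OF comp[OF v] S(4)[OF comp[OF v]]]]) simp_all
      ultimately show ?thesis
        by simp
    qed
    then have "span B \<subseteq> span D"
      using span_is_submodule[OF Dc] by (intro span_is_subset) auto
    then show ?thesis
      using gen S(1) by auto
  qed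
  ultimately show ?thesis
    by (rule semisimple_if_eigenvectors_span[OF f])
qed

lemma quadratic_spec: "spec V f \<subseteq> {a, b}"
proof
  fix t assume "t \<in> spec V f"
  then obtain v where v: "v \<in> carrier V" "v \<noteq> \<zero>" "f v = t \<odot> v"
    by (auto simp: spec_def)
  have tb: "f v \<oplus> (- b) \<odot> v = (t - b) \<odot> v"
    using v vs_distrib(1)[of v t "- b"] by simp
  have "a \<odot> ((t - b) \<odot> v) = f ((t - b) \<odot> v)"
    using eigen_components(1)[OF v(1)] by (simp add: tb)
  also have "\<dots> = ((t - b) * t) \<odot> v"
    using f v by (simp add: vs_distrib(3))
  finally have "((t - b) * t) \<odot> v \<oplus> (- 1) \<odot> ((a * (t - b)) \<odot> v) = \<zero>"
    using v by (simp add: vs_distrib(3) vs_minus_one r_neg)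
  then have "((t - b) * t + (- 1) * (a * (t - b))) \<odot> v = \<zero>"
    using v by (simp only: vs_distrib)
  then have "((t - b) * (t - a)) \<odot> v = \<zero>"
    by (simp add: algebra_simps)
  then have "(t - b) * (t - a) = 0"
    using v smult_eq_zero by blast
  then show "t \<in> {a, b}"
    by auto
qed

lemma quadratic_eigenvalues:
  shows "f \<oplus>\<^bsub>End V\<^esub> scalar_op V (- b) \<noteq> \<zero>\<^bsub>End V\<^esub> \<Longrightarrow> a \<in> spec V f"
    and "f \<oplus>\<^bsub>End V\<^esub> scalar_op V (- a) \<noteq> \<zero>\<^bsub>End V\<^esub> \<Longrightarrow> b \<in> spec V f"
proof -
  have ex: "\<exists>v\<in>carrier V. f v \<oplus> (- s) \<odot> v \<noteq> \<zero>" if "f \<oplus>\<^bsub>End V\<^esub> scalar_op V (- s) \<noteq> \<zero>\<^bsub>End V\<^esub>" for s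
  proof (rule ccontr)
    assume "\<not> ?thesis"
    then have "f \<oplus>\<^bsub>End V\<^esub> scalar_op V (- s) = \<zero>\<^bsub>End V\<^esub>"
      using f by (intro End_eqI) auto
    then show False
      using that by simp
  qed
  show "a \<in> spec V f" if nz: "f \<oplus>\<^bsub>End V\<^esub> scalar_op V (- b) \<noteq> \<zero>\<^bsub>End V\<^esub>"
  proof -
    obtain v where "v \<in> carrier V" "f v \<oplus> (- b) \<odot> v \<noteq> \<zero>"
      using ex[OF nz] by blast
    then show ?thesis
      using eigen_components(1) f unfolding spec_def by (intro CollectI bexI[of _ "f v \<oplus> (- b) \<odot> v"]) simp_all
  qed
  show "b \<in> spec V f" if nz: "f \<oplus>\<^bsub>End V\<^esub> scalar_op V (- a) \<noteq> \<zero>\<^bsub>End V\<^esub>"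
  proof -
    obtain v where "v \<in> carrier V" "f v \<oplus> (- a) \<odot> v \<noteq> \<zero>"
      using ex[OF nz] by blast
    then show ?thesis
      using eigen_components(2) f unfolding spec_def by (intro CollectI bexI[of _ "f v \<oplus> (- a) \<odot> v"]) simp_all
  qed
qed

end

end

lemma monic_dvd_degree_eq:
  fixes p m :: "'k::field poly"
  assumes "lead_coeff p = 1" "lead_coeff m = 1" "p dvd m" "degree p = degree m"
  shows "p = m"
proof -
  obtain r where r: "m = p * r"
    using assms(3) by (elim dvdE)
  have "p \<noteq> 0" "r \<noteq> 0"
    using assms(2) r by auto
  then have "degree r = 0"
    using assms(4) r by (simp add: degree_mult_eq)
  then obtain a where a: "r = [:a:]"
    by (elim degree_eq_zeroE)
  then show ?thesis
    using assms(1,2) r \<open>r \<noteq> 0\<close> by (simp split: if_splits)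
qed

lemma monic_lcm_singleton: "lead_coeff p = 1 \<Longrightarrow> monic_lcm {p} = p"
  by (rule monic_lcm_eqI) (simp add: is_monic_lcm_def)

lemma linear_product_dvd:
  fixes q :: "'k::field poly"
  assumes "a \<noteq> b" "[:- a, 1:] dvd q" "[:- b, 1:] dvd q"
  shows "[:- a, 1:] * [:- b, 1:] dvd q"
proof -
  obtain r where r: "q = [:- a, 1:] * r"
    using assms(2) by (elim dvdE)
  have "poly q b = 0"
    using assms(3) by (simp add: poly_eq_0_iff_dvd)
  then have "poly r b = 0"
    using assms(1) by (simp add: r)
  then have "[:- b, 1:] dvd r"
    by (simp add: poly_eq_0_iff_dvd)
  then show ?thesis
    unfolding r by (rule mult_dvd_mono[OF dvd_refl])
qed

lemma monic_lcm_two_linear: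
  fixes a b :: "'k::field"
  assumes "a \<noteq> b"
  shows "monic_lcm {[:- a, 1:], [:- b, 1:]} = [:- a, 1:] * [:- b, 1:]"
proof (rule monic_lcm_eqI, unfold is_monic_lcm_def, intro conjI ballI allI impI)
  show "lead_coeff ([:- a, 1:] * [:- b, 1:]) = 1"
    by (simp only: lead_coeff_mult) simp
  show "p dvd [:- a, 1:] * [:- b, 1:]" if "p \<in> {[:- a, 1:], [:- b, 1:]}" for p
    using that by (auto simp del: mult_pCons_left mult_pCons_right)
  show "[:- a, 1:] * [:- b, 1:] dvd q" if "\<forall>p\<in>{[:- a, 1:], [:- b, 1:]}. p dvd q" for q
    using that by (intro linear_product_dvd assms) auto
qed

lemma two_linear_roots: "{t. poly ([:- a, 1:] * [:- b, 1:]) t = 0} = {a, b :: 'k::field}"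
  by (auto simp: poly_mult simp del: mult_pCons_left mult_pCons_right)

lemma two_linear_degree: "degree ([:- a, 1:] * [:- b, 1:] :: 'k::field poly) = 2"
  by (subst degree_mult_eq) auto

lemma two_linear_quadratic:
  "quadratic_with_distinct_roots ([:- a, 1:] * [:- b, 1:] :: 'k::field poly) \<longleftrightarrow> a \<noteq> b"
  unfolding quadratic_with_distinct_roots_def two_linear_degree two_linear_roots by (auto simp: card_insert_if)

lemma hecke_poly_linear: "hecke_poly c \<nu> = [:- c, 1:] * [:- (- c * \<nu>), 1:]"
  unfolding hecke_poly_eq by simp

lemma hecke_poly_monic: "lead_coeff (hecke_poly c \<nu>) = 1"
  unfolding hecke_poly_eq by (simp only: lead_coeff_mult) simp

lemma hecke_poly_nonzero: "hecke_poly c \<nu> \<noteq> 0"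
  using hecke_poly_monic[of c \<nu>] by auto

lemma hecke_poly_degree: "degree (hecke_poly c \<nu>) = 2"
  unfolding hecke_poly_linear by (rule two_linear_degree)

lemma hecke_poly_roots: "{t. poly (hecke_poly c \<nu>) t = 0} = {c, - c * \<nu>}"
  unfolding hecke_poly_linear by (rule two_linear_roots)

lemma eq_minus_mult_iff:
  fixes c :: "'k::field"
  assumes "c \<noteq> 0"
  shows "c = - c * \<nu> \<longleftrightarrow> \<nu> = - 1"
proof
  assume "c = - c * \<nu>"
  then have "c * (\<nu> + 1) = 0"
    by (simp add: algebra_simps add_eq_0_iff2)
  then show "\<nu> = - 1"
    using assms by (simp add: eq_neg_iff_add_eq_0)
qed simp

lemma hecke_poly_quadratic:
  fixes c :: "'k::field"
  shows "c \<noteq> 0 \<Longrightarrow> quadratic_with_distinct_roots (hecke_poly c \<nu>) \<longleftrightarrow> \<nu> \<noteq> - 1"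
  unfolding hecke_poly_linear two_linear_quadratic by (simp only: eq_minus_mult_iff not_False_eq_True)

lemma hecke_poly_inject:
  fixes c :: "'k::field"
  assumes "c \<noteq> 0" "hecke_poly c \<mu> = hecke_poly c \<nu>"
  shows "\<mu> = \<nu>"
proof -
  have "[:c * \<mu>, 1:] = [:c * \<nu>, 1:]"
    using assms(2) unfolding hecke_poly_eq by (subst (asm) mult_cancel_left) simp
  then show ?thesis
    using assms(1) by simp
qed

lemma finite_hecke_polys: "finite E \<Longrightarrow> is_monic_lcm (hecke_poly c ` E) (monic_lcm (hecke_poly c ` E))"
  by (intro is_monic_lcm_monic_lcm finite_imageI) (auto simp: image_iff hecke_poly_nonzero[symmetric])

lemma quadratic_hecke_factor:
  fixes m :: "'k::field poly"
  assumes "lead_coeff m = 1" "quadratic_with_distinct_roots m" "hecke_poly c \<mu> dvd m"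
  shows "m = hecke_poly c \<mu>"
  using assms monic_dvd_degree_eq[of "hecke_poly c \<mu>" m] hecke_poly_monic hecke_poly_degree
  by (metis quadratic_with_distinct_roots_def)

text \<open>The members of the family are monic of degree two. If their least common multiple has degree two
  as well, it equals each of them, and they determine their parameters.\<close>

lemma lcm_hecke_quadratic_iff:
  fixes c :: "'k::field"
  assumes c: "c \<noteq> 0" and E: "finite E" "E \<noteq> {}"
  shows "quadratic_with_distinct_roots (monic_lcm (hecke_poly c ` E)) \<longleftrightarrow> (\<exists>\<mu>. E = {\<mu>} \<and> \<mu> \<noteq> - 1)"
proof
  assume quad: "quadratic_with_distinct_roots (monic_lcm (hecke_poly c ` E))"
  obtain \<mu> where \<mu>: "\<mu> \<in> E"
    using E by auto
  note m = finite_hecke_polys[OF E(1), of c, unfolded is_monic_lcm_def]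
  have eq: "monic_lcm (hecke_poly c ` E) = hecke_poly c \<mu>'" if "\<mu>' \<in> E" for \<mu>'
    using m quad that by (intro quadratic_hecke_factor) auto
  have "x = \<mu>" if "x \<in> E" for x
    by (rule hecke_poly_inject[OF c]) (use eq[OF that] eq[OF \<mu>] in simp)
  then have "E = {\<mu>}"
    using \<mu> by blast
  moreover have "\<mu> \<noteq> - 1"
    using quad unfolding eq[OF \<mu>] hecke_poly_quadratic[OF c] .
  ultimately show "\<exists>\<mu>. E = {\<mu>} \<and> \<mu> \<noteq> - 1"
    by blast
next
  assume "\<exists>\<mu>. E = {\<mu>} \<and> \<mu> \<noteq> - 1"
  then show "quadratic_with_distinct_roots (monic_lcm (hecke_poly c ` E))"
    using c by (auto simp: monic_lcm_singleton hecke_poly_monic hecke_poly_quadratic)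
qed

text \<open>Call \<open>\<nu>\<close> resonant if \<open>lam * \<nu>\<^sup>2 = 1\<close>. If all of \<open>E\<close> is resonant, then \<open>E\<close> consists of square roots of
  \<open>1 / lam\<close>, and two of them are needed for degree two. If some \<open>\<mu> \<in> E\<close> is not, a quadratic least common multiple
  must be its \<open>hecke_poly\<close>, with roots \<open>c\<close> and \<open>- c \<mu>\<close>. The root \<open>- c \<nu>\<close> of a resonant \<open>\<nu>\<close> is never \<open>c\<close>, because
  \<open>- 1\<close> is resonant only for \<open>lam = 1\<close>; hence \<open>\<nu> = \<mu>\<close>, a contradiction, and \<open>\<mu>\<close> is the only element.\<close>

lemma lcm_resonant_quadratic_iff:
  fixes c lam :: "'k::{field, ring_char_0}"
  assumes c: "c \<noteq> 0" and lam: "lam \<noteq> 0" "lam \<noteq> 1" and E: "finite E" "E \<noteq> {}" "0 \<notin> E"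
  defines "P \<equiv> (\<lambda>\<nu>. [:c * \<nu>, 1:]) ` {\<nu>\<in>E. lam * \<nu> ^ 2 = 1} \<union> hecke_poly c ` {\<nu>\<in>E. lam * \<nu> ^ 2 \<noteq> 1}"
  shows "quadratic_with_distinct_roots (monic_lcm P) \<longleftrightarrow>
      (\<exists>\<mu>. E = {\<mu>} \<and> \<mu> \<noteq> - 1 \<and> lam * \<mu> ^ 2 \<noteq> 1) \<or> (\<exists>\<nu>. E = {\<nu>, - \<nu>} \<and> lam = inverse (\<nu> ^ 2))"
    and "E = {\<nu>, - \<nu>} \<Longrightarrow> lam = inverse (\<nu> ^ 2) \<Longrightarrow> monic_lcm P = [:- (- c * \<nu>), 1:] * [:- (c * \<nu>), 1:]"
proof -
  have opposite: "monic_lcm P = [:- (- c * \<nu>), 1:] * [:- (c * \<nu>), 1:] \<and> - c * \<nu> \<noteq> c * \<nu>"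
    if \<nu>: "E = {\<nu>, - \<nu>}" "lam = inverse (\<nu> ^ 2)" for \<nu>
  proof -
    have "\<nu> \<noteq> 0"
      using \<nu> E(3) by auto
    then have ne: "- c * \<nu> \<noteq> c * \<nu>"
      using c by (simp add: neg_equal_zero)
    have "lam * \<nu> ^ 2 = 1"
      using \<nu>(2) \<open>\<nu> \<noteq> 0\<close> by simp
    then have R: "{x \<in> E. lam * x ^ 2 = 1} = {\<nu>, - \<nu>}" and U: "{x \<in> E. lam * x ^ 2 \<noteq> 1} = {}"
      using \<nu>(1) by auto
    have "P = {[:- (- c * \<nu>), 1:], [:- (c * \<nu>), 1:]}"
      unfolding P_def R U by simp
    then show ?thesis
      using monic_lcm_two_linear[OF ne] ne by simp
  qed
  then show "E = {\<nu>, - \<nu>} \<Longrightarrow> lam = inverse (\<nu> ^ 2) \<Longrightarrow> monic_lcm P = [:- (- c * \<nu>), 1:] * [:- (c * \<nu>), 1:]"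
    by blast
  have "0 \<notin> P"
    unfolding P_def by (auto simp: image_iff hecke_poly_nonzero[symmetric])
  then have m: "is_monic_lcm P (monic_lcm P)"
    using E(1) unfolding P_def by (intro is_monic_lcm_monic_lcm) auto
  show "quadratic_with_distinct_roots (monic_lcm P) \<longleftrightarrow>
      (\<exists>\<mu>. E = {\<mu>} \<and> \<mu> \<noteq> - 1 \<and> lam * \<mu> ^ 2 \<noteq> 1) \<or> (\<exists>\<nu>. E = {\<nu>, - \<nu>} \<and> lam = inverse (\<nu> ^ 2))"
  proof
    assume quad: "quadratic_with_distinct_roots (monic_lcm P)"
    show "(\<exists>\<mu>. E = {\<mu>} \<and> \<mu> \<noteq> - 1 \<and> lam * \<mu> ^ 2 \<noteq> 1) \<or> (\<exists>\<nu>. E = {\<nu>, - \<nu>} \<and> lam = inverse (\<nu> ^ 2))"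
    proof (cases "\<exists>\<mu>\<in>E. lam * \<mu> ^ 2 \<noteq> 1")
      case True
      then obtain \<mu> where \<mu>: "\<mu> \<in> E" "lam * \<mu> ^ 2 \<noteq> 1"
        by blast
      have eq: "monic_lcm P = hecke_poly c \<mu>'" if "\<mu>' \<in> E" "lam * \<mu>' ^ 2 \<noteq> 1" for \<mu>'
        using m quad that unfolding is_monic_lcm_def P_def by (intro quadratic_hecke_factor) auto
      have "\<mu>' = \<mu>" if \<mu>': "\<mu>' \<in> E" for \<mu>'
      proof (cases "lam * \<mu>' ^ 2 = 1")
        case False
        then show ?thesis
          using eq[OF \<mu>] eq[OF \<mu>'] hecke_poly_inject[OF c, of \<mu>' \<mu>] by simp
      next
        case res: True
        then have "[:- (- c * \<mu>'), 1:] dvd monic_lcm P"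
          using m \<mu>' unfolding is_monic_lcm_def P_def by auto
        then have "- c * \<mu>' \<in> {t. poly (hecke_poly c \<mu>) t = 0}"
          unfolding eq[OF \<mu>] by (simp only: poly_eq_0_iff_dvd mem_Collect_eq)
        then have "- c * \<mu>' = c \<or> - c * \<mu>' = - c * \<mu>"
          unfolding hecke_poly_roots by auto
        moreover have "- c * \<mu>' \<noteq> c"
        proof
          assume "- c * \<mu>' = c"
          then have "c = - c * \<mu>'"
            by (rule HOL.sym)
          then have "\<mu>' = - 1"
            by (simp only: eq_minus_mult_iff[OF c])
          then show False
            using res lam by simp
        qed
        ultimately show ?thesis
          using c by simp
      qed
      then have "E = {\<mu>}"
        using \<mu> by blast
      moreover have "\<mu> \<noteq> - 1"
        using quad unfolding eq[OF \<mu>] hecke_poly_quadratic[OF c] .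
      ultimately show ?thesis
        using \<mu>(2) by blast
    next
      case False
      obtain \<nu> where \<nu>: "\<nu> \<in> E"
        using E by auto
      have sq: "lam * \<nu>' ^ 2 = 1" if "\<nu>' \<in> E" for \<nu>'
        using False that by blast
      have sub: "E \<subseteq> {\<nu>, - \<nu>}"
      proof
        fix \<nu>' assume "\<nu>' \<in> E"
        then have "lam * \<nu>' ^ 2 = lam * \<nu> ^ 2"
          using sq[of \<nu>'] sq[OF \<nu>] by simp
        then show "\<nu>' \<in> {\<nu>, - \<nu>}"
          using lam by (simp add: power2_eq_iff)
      qed
      have "E \<noteq> {\<nu>}"
      proof
        assume "E = {\<nu>}"
        then have R: "{x \<in> E. lam * x ^ 2 = 1} = {\<nu>}" and U: "{x \<in> E. lam * x ^ 2 \<noteq> 1} = {}"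
          using sq[OF \<nu>] by auto
        have "P = {[:c * \<nu>, 1:]}"
          unfolding P_def R U by simp
        then have "degree (monic_lcm P) = 1"
          by (simp add: monic_lcm_singleton)
        then show False
          using quad by (simp add: quadratic_with_distinct_roots_def)
      qed
      then have "E = {\<nu>, - \<nu>}"
        using sub \<nu> by auto
      moreover have "lam = inverse (\<nu> ^ 2)"
        using sq[OF \<nu>] by (metis inverse_unique mult.commute)
      ultimately show ?thesis
        by blast
    qed
  next
    assume "(\<exists>\<mu>. E = {\<mu>} \<and> \<mu> \<noteq> - 1 \<and> lam * \<mu> ^ 2 \<noteq> 1) \<or> (\<exists>\<nu>. E = {\<nu>, - \<nu>} \<and> lam = inverse (\<nu> ^ 2))"
    then show "quadratic_with_distinct_roots (monic_lcm P)"
    proof (elim disjE exE conjE)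
      fix \<mu> assume "E = {\<mu>}" "\<mu> \<noteq> - 1" "lam * \<mu> ^ 2 \<noteq> 1"
      then have R: "{x \<in> E. lam * x ^ 2 = 1} = {}" and U: "{x \<in> E. lam * x ^ 2 \<noteq> 1} = {\<mu>}"
        by auto
      have "P = {hecke_poly c \<mu>}"
        unfolding P_def R U by simp
      then show ?thesis
        using c \<open>\<mu> \<noteq> - 1\<close> by (simp add: monic_lcm_singleton hecke_poly_monic hecke_poly_quadratic)
    next
      fix \<nu> assume \<nu>: "E = {\<nu>, - \<nu>}" "lam = inverse (\<nu> ^ 2)"
      have *: "monic_lcm P = [:- (- c * \<nu>), 1:] * [:- (c * \<nu>), 1:]" "- c * \<nu> \<noteq> c * \<nu>"
        using opposite[OF \<nu>] by blast+
      show ?thesis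
        unfolding *(1) two_linear_quadratic by (rule *(2))
    qed
  qed
qed

section \<open>Minimal polynomials and Hecke relations of the braid generators\<close>

context klm
begin

abbreviation "E \<equiv> \<nu> ` I - {1}"

lemma finite_E: "finite E"
  using finite_index by simp

lemma zero_notin_E: "0 \<notin> E"
  using nonzero(1) by auto

lemma local_min_poly_nonzero: "local_min_poly n lam c \<mu> \<noteq> 0"
  by (simp add: local_min_poly_def hecke_poly_nonzero)

lemma op_poly_zero_iff_E:
  assumes "i \<in> {1..<n}"
  shows "op_poly quot.Q q (Sop i) = \<zero>\<^bsub>End quot.Q\<^esub> \<longleftrightarrow> (\<forall>\<mu>\<in>E. local_min_poly n lam c \<mu> dvd q)"
  unfolding op_poly_Sop_eq_zero_iff[OF assms] by auto

lemma minimal_polynomial_Sop: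
  assumes i: "i \<in> {1..<n}"
  shows "minimal_polynomial quot.Q (Sop i) = monic_lcm (local_min_poly n lam c ` E)"
proof (rule minimal_polynomial_eqI)
  have "is_monic_lcm (local_min_poly n lam c ` E) (monic_lcm (local_min_poly n lam c ` E))"
    using finite_E by (intro is_monic_lcm_monic_lcm finite_imageI) (auto simp: image_iff local_min_poly_nonzero[symmetric])
  then show "is_minimal_polynomial quot.Q (Sop i) (monic_lcm (local_min_poly n lam c ` E))"
    unfolding is_minimal_polynomial_def is_monic_lcm_def op_poly_zero_iff_E[OF i] by auto
qed

lemma local_min_poly_ge3: "n \<ge> 3 \<Longrightarrow> local_min_poly n lam c \<mu> = hecke_poly c \<mu>"
  by (auto simp: local_min_poly_def)

lemma local_min_poly_image_2:
  assumes "n = 2"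
  shows "local_min_poly n lam c ` E =
    (\<lambda>\<mu>. [:c * \<mu>, 1:]) ` {\<mu>\<in>E. lam * \<mu> ^ 2 = 1} \<union> hecke_poly c ` {\<mu>\<in>E. lam * \<mu> ^ 2 \<noteq> 1}"
    (is "_ = ?R \<union> ?U")
proof (intro equalityI subsetI)
  fix p assume "p \<in> local_min_poly n lam c ` E"
  then obtain \<mu> where "\<mu> \<in> E" "p = local_min_poly n lam c \<mu>"
    by blast
  then show "p \<in> ?R \<union> ?U"
    using assms by (cases "lam * \<mu> ^ 2 = 1") (auto simp only: local_min_poly_def if_True if_False simp_thms intro!: imageI)
next
  fix p assume "p \<in> ?R \<union> ?U"
  then consider \<mu> where "\<mu> \<in> E" "lam * \<mu> ^ 2 = 1" "p = [:c * \<mu>, 1:]"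
    | \<mu> where "\<mu> \<in> E" "lam * \<mu> ^ 2 \<noteq> 1" "p = hecke_poly c \<mu>"
    by blast
  then show "p \<in> local_min_poly n lam c ` E"
  proof cases
    case (1 \<mu>)
    then show ?thesis
      using assms by (intro image_eqI[of _ _ \<mu>]) (simp_all add: local_min_poly_def)
  next
    case (2 \<mu>)
    then show ?thesis
      using assms by (intro image_eqI[of _ _ \<mu>]) (simp_all add: local_min_poly_def)
  qed
qed

lemma local_min_poly_dvd_hecke: "local_min_poly n lam c \<mu> dvd hecke_poly c \<mu>"
  unfolding local_min_poly_def hecke_poly_eq by (auto simp del: mult_pCons_left mult_pCons_right)

lemma local_min_poly_minus_one: "local_min_poly n lam c (- 1) = [:- c, 1:] ^ 2"
  using nonzero(3) by (simp add: local_min_poly_def hecke_poly_def)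

lemma Sop_quadratic:
  assumes i: "i \<in> {1..<n}" and dvd: "\<And>\<mu>. \<mu> \<in> E \<Longrightarrow> local_min_poly n lam c \<mu> dvd [:- a, 1:] * [:b, 1:]"
  shows "(Sop i \<ominus>\<^bsub>End quot.Q\<^esub> scalar_op quot.Q a) \<otimes>\<^bsub>End quot.Q\<^esub> (Sop i \<oplus>\<^bsub>End quot.Q\<^esub> scalar_op quot.Q b) = \<zero>\<^bsub>End quot.Q\<^esub>"
  unfolding quot.Q.op_poly_quadratic[OF Sop_End[OF i], symmetric] op_poly_zero_iff_E[OF i] using dvd by blast

lemma scaled_hecke:
  assumes t: "t \<noteq> 0" and i: "i \<in> {1..<n}"
    and dvd: "\<And>\<mu>. \<mu> \<in> E \<Longrightarrow> local_min_poly n lam c \<mu> dvd [:- (1 / t), 1:] * [:q / t, 1:]"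
  shows "(t \<odot>\<^bsub>End quot.Q\<^esub> Sop i \<ominus>\<^bsub>End quot.Q\<^esub> \<one>\<^bsub>End quot.Q\<^esub>) \<otimes>\<^bsub>End quot.Q\<^esub>
    (t \<odot>\<^bsub>End quot.Q\<^esub> Sop i \<oplus>\<^bsub>End quot.Q\<^esub> q \<odot>\<^bsub>End quot.Q\<^esub> \<one>\<^bsub>End quot.Q\<^esub>) = \<zero>\<^bsub>End quot.Q\<^esub>"
proof (rule quot.Q.scaled_quadratic[OF Sop_End[OF i] t])
  show "op_poly quot.Q ([:- (1 / t), 1:] * [:q / t, 1:]) (Sop i) = \<zero>\<^bsub>End quot.Q\<^esub>"
    unfolding op_poly_zero_iff_E[OF i] using dvd by blast
qed

lemma defines_hecke_rep_Sop:
  assumes t: "t \<noteq> 0"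
    and dvd: "\<And>\<mu>. \<mu> \<in> E \<Longrightarrow> local_min_poly n lam c \<mu> dvd [:- (1 / t), 1:] * [:q / t, 1:]"
  shows "defines_hecke_rep n q quot.Q (\<lambda>i. t \<odot>\<^bsub>End quot.Q\<^esub> Sop i)"
proof -
  have scale: "(t \<odot>\<^bsub>End quot.Q\<^esub> x) \<otimes>\<^bsub>End quot.Q\<^esub> (t \<odot>\<^bsub>End quot.Q\<^esub> y) = t \<odot>\<^bsub>End quot.Q\<^esub> (t \<odot>\<^bsub>End quot.Q\<^esub> (x \<otimes>\<^bsub>End quot.Q\<^esub> y))"
    if "x \<in> carrier (End quot.Q)" "y \<in> carrier (End quot.Q)" for x y
    using that by (intro quot.Q.End_eqI) auto
  have scale3: "(t \<odot>\<^bsub>End quot.Q\<^esub> x) \<otimes>\<^bsub>End quot.Q\<^esub> (t \<odot>\<^bsub>End quot.Q\<^esub> y) \<otimes>\<^bsub>End quot.Q\<^esub> (t \<odot>\<^bsub>End quot.Q\<^esub> z) =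
      t \<odot>\<^bsub>End quot.Q\<^esub> (t \<odot>\<^bsub>End quot.Q\<^esub> (t \<odot>\<^bsub>End quot.Q\<^esub> (x \<otimes>\<^bsub>End quot.Q\<^esub> y \<otimes>\<^bsub>End quot.Q\<^esub> z)))"
    if "x \<in> carrier (End quot.Q)" "y \<in> carrier (End quot.Q)" "z \<in> carrier (End quot.Q)" for x y z
    using that by (intro quot.Q.End_eqI) auto
  interpret hecke_images quot.Q J quot.\<psi> n q "\<lambda>i. t \<odot>\<^bsub>End quot.Q\<^esub> Sop i"
  proof (unfold_locales)
    show "t \<odot>\<^bsub>End quot.Q\<^esub> Sop i \<in> carrier (End quot.Q)" if "i \<in> {1..<n}" for i
      using Sop_End[OF that] by simp
    show "(t \<odot>\<^bsub>End quot.Q\<^esub> Sop i) \<otimes>\<^bsub>End quot.Q\<^esub> (t \<odot>\<^bsub>End quot.Q\<^esub> Sop j) =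
        (t \<odot>\<^bsub>End quot.Q\<^esub> Sop j) \<otimes>\<^bsub>End quot.Q\<^esub> (t \<odot>\<^bsub>End quot.Q\<^esub> Sop i)"
      if "i \<in> {1..<n}" "j \<in> {1..<n}" "i + 2 \<le> j" for i j
      using Sop_braid_far[OF that] Sop_End[OF that(1)] Sop_End[OF that(2)] by (simp only: scale)
    show "(t \<odot>\<^bsub>End quot.Q\<^esub> Sop i) \<otimes>\<^bsub>End quot.Q\<^esub> (t \<odot>\<^bsub>End quot.Q\<^esub> Sop (i + 1)) \<otimes>\<^bsub>End quot.Q\<^esub> (t \<odot>\<^bsub>End quot.Q\<^esub> Sop i) =
        (t \<odot>\<^bsub>End quot.Q\<^esub> Sop (i + 1)) \<otimes>\<^bsub>End quot.Q\<^esub> (t \<odot>\<^bsub>End quot.Q\<^esub> Sop i) \<otimes>\<^bsub>End quot.Q\<^esub> (t \<odot>\<^bsub>End quot.Q\<^esub> Sop (i + 1))"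
      if "i \<in> {1..<n}" "i + 1 \<in> {1..<n}" for i
      using Sop_braid_near[OF that] Sop_End[OF that(1)] Sop_End[OF that(2)] by (simp only: scale3)
    show "(t \<odot>\<^bsub>End quot.Q\<^esub> Sop i \<ominus>\<^bsub>End quot.Q\<^esub> \<one>\<^bsub>End quot.Q\<^esub>) \<otimes>\<^bsub>End quot.Q\<^esub>
        (t \<odot>\<^bsub>End quot.Q\<^esub> Sop i \<oplus>\<^bsub>End quot.Q\<^esub> q \<odot>\<^bsub>End quot.Q\<^esub> \<one>\<^bsub>End quot.Q\<^esub>) = \<zero>\<^bsub>End quot.Q\<^esub>"
      if "i \<in> {1..<n}" for i
      by (rule scaled_hecke[OF t that dvd])
  qed
  show ?thesis
    by (rule defines_hecke_rep)
qed

lemma hecke_rep_single: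
  assumes "E \<subseteq> {\<mu>}"
  shows "defines_hecke_rep n \<mu> quot.Q (\<lambda>i. inverse c \<odot>\<^bsub>End quot.Q\<^esub> Sop i)"
proof (rule defines_hecke_rep_Sop)
  show "inverse c \<noteq> 0"
    using nonzero(4) by simp
  show "local_min_poly n lam c \<mu>' dvd [:- (1 / inverse c), 1:] * [:\<mu> / inverse c, 1:]" if "\<mu>' \<in> E" for \<mu>'
  proof -
    have "[:- (1 / inverse c), 1:] * [:\<mu> / inverse c, 1:] = hecke_poly c \<mu>"
      using nonzero(4) unfolding hecke_poly_eq by (simp add: field_simps)
    moreover have "\<mu>' = \<mu>"
      using that assms by auto
    ultimately show ?thesis
      using local_min_poly_dvd_hecke by simp
  qed
qed

lemma hecke_relation_single:
  assumes "E \<subseteq> {\<mu>}" "i \<in> {1..<n}"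
  shows "(Sop i \<ominus>\<^bsub>End quot.Q\<^esub> scalar_op quot.Q c) \<otimes>\<^bsub>End quot.Q\<^esub> (Sop i \<oplus>\<^bsub>End quot.Q\<^esub> scalar_op quot.Q (c * \<mu>)) = \<zero>\<^bsub>End quot.Q\<^esub>"
  using assms local_min_poly_dvd_hecke by (intro Sop_quadratic) (auto simp: hecke_poly_eq simp del: mult_pCons_left mult_pCons_right)

lemma resonant_scalar:
  assumes n2: "n = 2" and E: "E = {\<mu>}" and res: "lam * \<mu> ^ 2 = 1"
  shows "Sop 1 = scalar_op quot.Q (- c * \<mu>)"
    and "minimal_polynomial quot.Q (Sop 1) = [:c * \<mu>, 1:]"
proof -
  have i: "1 \<in> {1..<n}"
    using n2 by simp
  have P: "local_min_poly n lam c \<mu> = [:c * \<mu>, 1:]"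
    using n2 res by (simp add: local_min_poly_def)
  have "op_poly quot.Q [:c * \<mu>, 1:] (Sop 1) = \<zero>\<^bsub>End quot.Q\<^esub>"
    unfolding op_poly_zero_iff_E[OF i] E using P by simp
  then have zero: "Sop 1 \<oplus>\<^bsub>End quot.Q\<^esub> scalar_op quot.Q (c * \<mu>) = \<zero>\<^bsub>End quot.Q\<^esub>"
    unfolding quot.Q.op_poly_linear[OF Sop_End[OF i]] .
  show "Sop 1 = scalar_op quot.Q (- c * \<mu>)"
  proof (rule quot.Q.End_eqI[OF Sop_End[OF i] quot.Q.scalar_op_closed])
    fix v assume v: "v \<in> carrier quot.Q"
    have Sv: "Sop 1 v \<in> carrier quot.Q"
      by (rule quot.Q.End_closed[OF Sop_End[OF i] v])
    have "Sop 1 v \<oplus>\<^bsub>quot.Q\<^esub> (c * \<mu>) \<odot>\<^bsub>quot.Q\<^esub> v = \<zero>\<^bsub>quot.Q\<^esub>"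
      using fun_cong[OF zero, of v] v by simp
    moreover have "Sop 1 v = (Sop 1 v \<oplus>\<^bsub>quot.Q\<^esub> (c * \<mu>) \<odot>\<^bsub>quot.Q\<^esub> v) \<oplus>\<^bsub>quot.Q\<^esub> (- c * \<mu>) \<odot>\<^bsub>quot.Q\<^esub> v"
      using quot.Q.vs_distrib(1)[OF v, of "c * \<mu>" "- c * \<mu>"] v Sv by (simp add: quot.Q.a_assoc)
    ultimately show "Sop 1 v = scalar_op quot.Q (- c * \<mu>) v"
      using v by simp
  qed
  show "minimal_polynomial quot.Q (Sop 1) = [:c * \<mu>, 1:]"
    unfolding minimal_polynomial_Sop[OF i] E using P by (simp add: monic_lcm_singleton)
qed

text \<open>Each of the two values is an eigenvalue unless the other linear factor alone annihilates the operator,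
  which for a quadratic minimal polynomial is impossible. In the resonant case the operator is a scalar.\<close>

lemma spec_both_iff:
  assumes E: "E = {\<mu>}" and \<mu>: "\<mu> \<noteq> - 1" and i: "i \<in> {1..<n}"
  shows "semisimple quot.Q (Sop i)" "spec quot.Q (Sop i) \<subseteq> {c, - c * \<mu>}"
    and "{c, - c * \<mu>} \<subseteq> spec quot.Q (Sop i) \<longleftrightarrow> \<not> (n = 2 \<and> lam * \<mu> ^ 2 = 1)"
proof -
  note S = Sop_End[OF i]
  have ne: "c \<noteq> - c * \<mu>"
    using \<mu> eq_minus_mult_iff[OF nonzero(4)] by blast
  have zero: "(Sop i \<ominus>\<^bsub>End quot.Q\<^esub> scalar_op quot.Q c) \<otimes>\<^bsub>End quot.Q\<^esub> (Sop i \<ominus>\<^bsub>End quot.Q\<^esub> scalar_op quot.Q (- c * \<mu>)) = \<zero>\<^bsub>End quot.Q\<^esub>"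
    using hecke_relation_single[of \<mu> i] E i unfolding quot.Q.minus_scalar_op[OF S] by simp
  show "semisimple quot.Q (Sop i)"
    by (rule quot.Q.quadratic_semisimple[OF S ne zero quot.Q.finite_dimensional])
  show "spec quot.Q (Sop i) \<subseteq> {c, - c * \<mu>}"
    by (rule quot.Q.quadratic_spec[OF S ne zero])
  have vanish: "Sop i \<oplus>\<^bsub>End quot.Q\<^esub> scalar_op quot.Q a = \<zero>\<^bsub>End quot.Q\<^esub> \<longleftrightarrow> local_min_poly n lam c \<mu> dvd [:a, 1:]" for a
    using op_poly_zero_iff_E[OF i, of "[:a, 1:]"] unfolding quot.Q.op_poly_linear[OF S] E by simp
  show "{c, - c * \<mu>} \<subseteq> spec quot.Q (Sop i) \<longleftrightarrow> \<not> (n = 2 \<and> lam * \<mu> ^ 2 = 1)"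
  proof
    assume both: "{c, - c * \<mu>} \<subseteq> spec quot.Q (Sop i)"
    show "\<not> (n = 2 \<and> lam * \<mu> ^ 2 = 1)"
    proof
      assume res: "n = 2 \<and> lam * \<mu> ^ 2 = 1"
      then have "i = 1"
        using i by auto
      then have scalar: "Sop i = scalar_op quot.Q (- c * \<mu>)"
        using resonant_scalar(1)[OF _ E] res by simp
      obtain v where v: "v \<in> carrier quot.Q" "v \<noteq> \<zero>\<^bsub>quot.Q\<^esub>" "Sop i v = c \<odot>\<^bsub>quot.Q\<^esub> v"
        using both by (auto simp: spec_def)
      have "(c + (- 1) * (- c * \<mu>)) \<odot>\<^bsub>quot.Q\<^esub> v = c \<odot>\<^bsub>quot.Q\<^esub> v \<oplus>\<^bsub>quot.Q\<^esub> (- 1) \<odot>\<^bsub>quot.Q\<^esub> ((- c * \<mu>) \<odot>\<^bsub>quot.Q\<^esub> v)"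
        using v(1) by (simp only: quot.Q.vs_distrib)
      also have "(- c * \<mu>) \<odot>\<^bsub>quot.Q\<^esub> v = c \<odot>\<^bsub>quot.Q\<^esub> v"
        using v unfolding scalar by simp
      also have "c \<odot>\<^bsub>quot.Q\<^esub> v \<oplus>\<^bsub>quot.Q\<^esub> (- 1) \<odot>\<^bsub>quot.Q\<^esub> (c \<odot>\<^bsub>quot.Q\<^esub> v) = \<zero>\<^bsub>quot.Q\<^esub>"
        using v(1) by (simp add: quot.Q.vs_minus_one quot.Q.r_neg)
      finally have "c + (- 1) * (- c * \<mu>) = 0"
        by (rule quot.Q.smult_eq_zero[OF v(1,2)])
      then show False
        using ne by (simp add: eq_neg_iff_add_eq_0)
    qed
  next
    assume "\<not> (n = 2 \<and> lam * \<mu> ^ 2 = 1)"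
    then have P: "local_min_poly n lam c \<mu> = hecke_poly c \<mu>"
      by (auto simp: local_min_poly_def)
    have "\<not> local_min_poly n lam c \<mu> dvd [:a, 1:]" for a
    proof
      assume "local_min_poly n lam c \<mu> dvd [:a, 1:]"
      then have "degree (hecke_poly c \<mu>) \<le> degree [:a, 1:]"
        unfolding P by (rule dvd_imp_degree_le) simp
      then show False
        by (simp add: hecke_poly_degree)
    qed
    then show "{c, - c * \<mu>} \<subseteq> spec quot.Q (Sop i)"
      using quot.Q.quadratic_eigenvalues[OF S ne zero] vanish by auto
  qed
qed

text \<open>A product of two distinct linear factors that annihilates the operator would be divisible by
  \<open>(T - c)\<^sup>2\<close>, hence equal to it.\<close>

lemma no_split_relation:
  assumes E: "E = {- 1}" and i: "i \<in> {1..<n}"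
  shows "\<not> (\<exists>a b. a \<noteq> b \<and> (Sop i \<ominus>\<^bsub>End quot.Q\<^esub> scalar_op quot.Q a) \<otimes>\<^bsub>End quot.Q\<^esub> (Sop i \<ominus>\<^bsub>End quot.Q\<^esub> scalar_op quot.Q b) = \<zero>\<^bsub>End quot.Q\<^esub>)"
proof (intro notI, elim exE conjE)
  fix a b
  assume ab: "a \<noteq> b" and zero: "(Sop i \<ominus>\<^bsub>End quot.Q\<^esub> scalar_op quot.Q a) \<otimes>\<^bsub>End quot.Q\<^esub> (Sop i \<ominus>\<^bsub>End quot.Q\<^esub> scalar_op quot.Q b) = \<zero>\<^bsub>End quot.Q\<^esub>"
  have "op_poly quot.Q ([:- a, 1:] * [:- b, 1:]) (Sop i) = \<zero>\<^bsub>End quot.Q\<^esub>"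
    unfolding quot.Q.op_poly_quadratic[OF Sop_End[OF i]]
    using zero quot.Q.minus_scalar_op[OF Sop_End[OF i], of b] by simp
  then have dvd: "hecke_poly c (- 1) dvd [:- a, 1:] * [:- b, 1:]"
    unfolding op_poly_zero_iff_E[OF i] E using local_min_poly_minus_one by (simp add: hecke_poly_def)
  have "[:- a, 1:] * [:- b, 1:] = hecke_poly c (- 1)"
  proof (rule quadratic_hecke_factor[OF _ _ dvd])
    show "lead_coeff ([:- a, 1:] * [:- b, 1:]) = 1"
      by (simp only: lead_coeff_mult) simp
    show "quadratic_with_distinct_roots ([:- a, 1:] * [:- b, 1:])"
      unfolding two_linear_quadratic by (rule ab)
  qed
  then have "quadratic_with_distinct_roots (hecke_poly c (- 1))"
    using ab two_linear_quadratic by metis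
  then show False
    unfolding hecke_poly_quadratic[OF nonzero(4)] by simp
qed

end

section \<open>The representations attached to a semisimple operator\<close>

lemma (in coords) diagonal_dims:
  assumes g: "g \<in> carrier (End V)" and eigen: "\<And>v b. v \<in> carrier V \<Longrightarrow> b \<in> I \<Longrightarrow> \<phi> (g v) b = \<nu> b * \<phi> v b"
  shows "subspace_dim V (Ker V (g \<ominus>\<^bsub>End V\<^esub> scalar_op V \<mu>)) = card {b \<in> I. \<nu> b = \<mu>}"
    and "subspace_dim V (Ker V (g \<ominus>\<^bsub>End V\<^esub> \<one>\<^bsub>End V\<^esub>)) = card {b \<in> I. \<nu> b = 1}"
    and "subspace_dim V (Ker V (lam \<odot>\<^bsub>End V\<^esub> (g [^]\<^bsub>End V\<^esub> n) \<ominus>\<^bsub>End V\<^esub> \<one>\<^bsub>End V\<^esub>)) =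
      card {b \<in> I. lam * \<nu> b ^ n = 1}"
proof -
  have pow: "\<phi> ((g [^]\<^bsub>End V\<^esub> k) v) b = \<nu> b ^ k * \<phi> v b" if "v \<in> carrier V" "b \<in> I" for k :: nat and v b
    using that(1)
  proof (induction k arbitrary: v)
    case (Suc k)
    then show ?case
      using g that(2) by (simp add: eigen)
  qed simp
  have "subspace_dim V (Ker V (g \<ominus>\<^bsub>End V\<^esub> scalar_op V \<mu>)) = card {b \<in> I. \<nu> b - \<mu> = 0}"
    using g by (intro diagonal_Ker_dim E.minus_closed) (simp_all add: coord_minus coord_smult eigen algebra_simps)
  then show "subspace_dim V (Ker V (g \<ominus>\<^bsub>End V\<^esub> scalar_op V \<mu>)) = card {b \<in> I. \<nu> b = \<mu>}"
    by simp
  have "subspace_dim V (Ker V (g \<ominus>\<^bsub>End V\<^esub> \<one>\<^bsub>End V\<^esub>)) = card {b \<in> I. \<nu> b - 1 = 0}"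
    using g by (intro diagonal_Ker_dim E.minus_closed) (simp_all add: coord_minus eigen algebra_simps)
  then show "subspace_dim V (Ker V (g \<ominus>\<^bsub>End V\<^esub> \<one>\<^bsub>End V\<^esub>)) = card {b \<in> I. \<nu> b = 1}"
    by simp
  have "subspace_dim V (Ker V (lam \<odot>\<^bsub>End V\<^esub> (g [^]\<^bsub>End V\<^esub> n) \<ominus>\<^bsub>End V\<^esub> \<one>\<^bsub>End V\<^esub>)) =
      card {b \<in> I. lam * \<nu> b ^ n - 1 = 0}"
    using g by (intro diagonal_Ker_dim E.minus_closed) (simp_all add: coord_minus coord_smult pow algebra_simps)
  then show "subspace_dim V (Ker V (lam \<odot>\<^bsub>End V\<^esub> (g [^]\<^bsub>End V\<^esub> n) \<ominus>\<^bsub>End V\<^esub> \<one>\<^bsub>End V\<^esub>)) =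
      card {b \<in> I. lam * \<nu> b ^ n = 1}"
    by simp
qed

theorem theorem4p4:
  fixes V :: "('k::{alg_closed_field, field_char_0}, 'v) module"
    and g :: "'v \<Rightarrow> 'v" and c lam :: 'k and n N k1 l :: nat
    and E :: "'k set" and m :: "'k \<Rightarrow> nat"
    and \<rho> :: "fb_elt \<Rightarrow> 'v \<Rightarrow> 'v"
    and W :: "('k, (nat \<Rightarrow> 'v) set) module"
    and S :: "nat \<Rightarrow> (nat \<Rightarrow> 'v) set \<Rightarrow> (nat \<Rightarrow> 'v) set"
  assumes "2 \<le> n"
    and "vectorspace class_ring V" and "vectorspace.fin_dim class_ring V" and "vdim V = N"
    and "g \<in> carrier (GL V)" and "semisimple V g"
    and "subspace_dim V (Ker V (g \<ominus>\<^bsub>End V\<^esub> \<one>\<^bsub>End V\<^esub>)) = k1"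
    and "c \<noteq> 0" and "lam \<noteq> 0" and "lam \<noteq> 1"
    and E: "E = spec V g - {1}"
    and m: "\<And>\<nu>. m \<nu> = subspace_dim V (Ker V (g \<ominus>\<^bsub>End V\<^esub> scalar_op V \<nu>))"
    and l: "l = subspace_dim V
              (Ker V (lam \<odot>\<^bsub>End V\<^esub> (g [^]\<^bsub>End V\<^esub> n) \<ominus>\<^bsub>End V\<^esub> \<one>\<^bsub>End V\<^esub>))"
    and \<rho>: "\<rho> = rho_gc n V g c"
    and W: "W = KLM_space n V lam \<rho>"
    and S: "S = (\<lambda>i. KLM_rep n V lam \<rho> (fb_sigma n i))"
  shows
    \<comment> \<open>(i)\<close>
    "int (vdim W) = int n * (int N - int k1) - int l
     \<and>
    \<comment> \<open>(ii)\<close>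
    (\<forall>\<mu>. \<mu> \<noteq> 0 \<and> \<mu> \<noteq> 1 \<and> \<mu> \<noteq> -1 \<and> E \<subseteq> {\<mu>} \<longrightarrow>
       (\<forall>i\<in>{1..<n}. (S i \<ominus>\<^bsub>End W\<^esub> scalar_op W c) \<otimes>\<^bsub>End W\<^esub> (S i \<oplus>\<^bsub>End W\<^esub> scalar_op W (c * \<mu>))
                      = \<zero>\<^bsub>End W\<^esub>)
       \<and> defines_hecke_rep n \<mu> W (\<lambda>i. inverse c \<odot>\<^bsub>End W\<^esub> S i)
       \<and> int (vdim W) = int n * int (m \<mu>) - int l
       \<and> (m \<mu> \<noteq> 0 \<longrightarrow>
            (\<forall>i\<in>{1..<n}. semisimple W (S i) \<and> spec W (S i) \<subseteq> {c, - c * \<mu>}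
               \<and> ({c, - c * \<mu>} \<subseteq> spec W (S i) \<longleftrightarrow> (n - 1) * m \<mu> > l))
            \<and> ((n - 1) * m \<mu> > l \<longleftrightarrow> \<not> (n = 2 \<and> lam = inverse (\<mu> ^ 2)))))
     \<and>
    \<comment> \<open>(iii)\<close>
    (n \<ge> 3 \<and> E \<noteq> {} \<longrightarrow>
       (\<forall>i\<in>{1..<n}.
          minimal_polynomial W (S i) = monic_lcm (hecke_poly c ` E)
          \<and> (quadratic_with_distinct_roots (minimal_polynomial W (S i))
               \<longleftrightarrow> (\<exists>\<mu>. E = {\<mu>} \<and> \<mu> \<noteq> -1))
          \<and> (\<forall>\<mu>. E = {\<mu>} \<and> \<mu> \<noteq> -1 \<longrightarrow>
               {t. poly (minimal_polynomial W (S i)) t = 0} = {c, - c * \<mu>})))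
     \<and>
    \<comment> \<open>(iv)\<close>
    (n = 2 \<and> E \<noteq> {} \<longrightarrow>
       minimal_polynomial W (S 1) =
         monic_lcm ((\<lambda>\<nu>. [:c * \<nu>, 1:]) ` {\<nu>\<in>E. lam * \<nu> ^ 2 = 1}
                     \<union> hecke_poly c ` {\<nu>\<in>E. lam * \<nu> ^ 2 \<noteq> 1})
       \<and> (quadratic_with_distinct_roots (minimal_polynomial W (S 1)) \<longleftrightarrow>
            (\<exists>\<mu>. E = {\<mu>} \<and> \<mu> \<noteq> -1 \<and> lam * \<mu> ^ 2 \<noteq> 1)
            \<or> (\<exists>\<nu>. E = {\<nu>, - \<nu>} \<and> lam = inverse (\<nu> ^ 2)))
       \<and> (\<forall>\<mu>. E = {\<mu>} \<and> \<mu> \<noteq> -1 \<and> lam * \<mu> ^ 2 \<noteq> 1 \<longrightarrow>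
            {t. poly (minimal_polynomial W (S 1)) t = 0} = {c, - c * \<mu>})
       \<and> (\<forall>\<nu>. E = {\<nu>, - \<nu>} \<and> lam = inverse (\<nu> ^ 2) \<longrightarrow>
            {t. poly (minimal_polynomial W (S 1)) t = 0} = {c * \<nu>, - c * \<nu>}
            \<and> (let T1 = inverse (c * \<nu>) \<odot>\<^bsub>End W\<^esub> S 1 in
                 (T1 \<ominus>\<^bsub>End W\<^esub> \<one>\<^bsub>End W\<^esub>) \<otimes>\<^bsub>End W\<^esub> (T1 \<oplus>\<^bsub>End W\<^esub> \<one>\<^bsub>End W\<^esub>) = \<zero>\<^bsub>End W\<^esub>)
            \<and> defines_hecke_rep 2 1 W (\<lambda>i. inverse (c * \<nu>) \<odot>\<^bsub>End W\<^esub> S i)))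
     \<and>
    \<comment> \<open>(v)\<close>
    (E = {-1} \<longrightarrow>
       (\<forall>i\<in>{1..<n}.
          minimal_polynomial W (S i) = [:-c, 1:] ^ 2
          \<and> \<not> (\<exists>a b. a \<noteq> b \<and>
                 (S i \<ominus>\<^bsub>End W\<^esub> scalar_op W a) \<otimes>\<^bsub>End W\<^esub> (S i \<ominus>\<^bsub>End W\<^esub> scalar_op W b) = \<zero>\<^bsub>End W\<^esub>))
       \<and> defines_hecke_rep n (-1) W (\<lambda>i. inverse c \<odot>\<^bsub>End W\<^esub> S i))
     \<and>
    (\<forall>\<mu>. n = 2 \<and> E = {\<mu>} \<and> lam * \<mu> ^ 2 = 1 \<longrightarrow>
       S 1 = scalar_op W (- c * \<mu>)
       \<and> minimal_polynomial W (S 1) = [:c * \<mu>, 1:]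
       \<and> (S 1 \<ominus>\<^bsub>End W\<^esub> scalar_op W c) \<otimes>\<^bsub>End W\<^esub> (S 1 \<oplus>\<^bsub>End W\<^esub> scalar_op W (c * \<mu>)) = \<zero>\<^bsub>End W\<^esub>
       \<and> defines_hecke_rep 2 \<mu> W (\<lambda>i. inverse c \<odot>\<^bsub>End W\<^esub> S i))"
proof -
  interpret V: vspace V
    using assms(2) by (rule vspace.intro)
  have gE: "g \<in> carrier (End V)"
    using assms(5) by (rule V.GL_subset)
  have roots: "\<exists>a. poly p a = 0" if "degree p > 0" for p :: "'k poly"
    using alg_closed_imp_poly_has_root[OF that] .
  obtain B ev where B: "finite B" "V.basis B" and ev: "\<And>b. b \<in> B \<Longrightarrow> g b = ev b \<odot>\<^bsub>V\<^esub> b"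
    using V.semisimple_eigenbasis[OF roots assms(3) gE assms(6)] by blast
  obtain \<phi> where "coords V B \<phi>"
    and \<phi>: "\<And>v b. v \<in> carrier V \<Longrightarrow> b \<in> B \<Longrightarrow> \<phi> (g v) b = ev b * \<phi> v b"
    using V.eigenbasis_coords[OF B] gE ev by metis
  interpret C: coords V B \<phi>
    by fact
  have ev_nonzero: "ev b \<noteq> 0" if b: "b \<in> B" for b
  proof
    assume "ev b = 0"
    then have gb: "g b = \<zero>\<^bsub>V\<^esub>"
      using ev[OF b] b B(2) by (auto simp: V.basis_def)
    obtain h where h: "h \<in> carrier (End V)" "h \<otimes>\<^bsub>End V\<^esub> g = \<one>\<^bsub>End V\<^esub>"
      using assms(5) by (auto simp: GL_def units_of_def Units_def)
    have bc: "b \<in> carrier V"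
      using b B(2) by (auto simp: V.basis_def)
    have "h (g b) = b"
      using fun_cong[OF h(2), of b] bc by simp
    then have "b = \<zero>\<^bsub>V\<^esub>"
      using h(1) gb by simp
    then show False
      using V.vs_zero_lin_dep[of B] B(2) b by (auto simp: V.basis_def)
  qed
  have n1: "n \<ge> 1"
    using assms(1) by simp
  interpret K: klm V B \<phi> n g ev lam c \<rho>
    by unfold_locales
      (use gE \<phi> ev_nonzero assms(8-10) n1 V.rho_gc_values[OF assms(5,8), of _ n] in \<open>simp_all add: \<rho>\<close>)
  have W_eq: "W = K.quot.Q"
    unfolding W by (rule K.KLM_space_eq)
  have S_eq: "S = K.Sop"
    unfolding S by (rule ext) (simp add: K.Sop_def)
  have E_eq: "E = ev ` B - {1}"
    unfolding E using C.diagonal_spec[OF gE \<phi>] by simp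
  note dims = C.diagonal_dims[OF gE \<phi>]
  have N_eq: "N = card B"
    using assms(4) C.vdim_eq by simp
  have k1_eq: "k1 = card {b \<in> B. ev b = 1}"
    using assms(7) dims(2) by simp
  have m_eq: "m \<mu> = card {b \<in> B. ev b = \<mu>}" for \<mu>
    unfolding m by (rule dims(1))
  have l_eq: "l = card {b \<in> B. lam * ev b ^ n = 1}"
    unfolding l by (rule dims(3))
  have fin_E: "finite E"
    unfolding E_eq by (rule K.finite_E)
  have zero_E: "0 \<notin> E"
    unfolding E_eq by (rule K.zero_notin_E)
  have dim: "int (vdim W) = int n * (int N - int k1) - int l"
    unfolding W_eq N_eq k1_eq l_eq by (rule K.vdim_Q)

  have part2: "(\<forall>i\<in>{1..<n}. (S i \<ominus>\<^bsub>End W\<^esub> scalar_op W c) \<otimes>\<^bsub>End W\<^esub> (S i \<oplus>\<^bsub>End W\<^esub> scalar_op W (c * \<mu>))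
                      = \<zero>\<^bsub>End W\<^esub>)
       \<and> defines_hecke_rep n \<mu> W (\<lambda>i. inverse c \<odot>\<^bsub>End W\<^esub> S i)
       \<and> int (vdim W) = int n * int (m \<mu>) - int l
       \<and> (m \<mu> \<noteq> 0 \<longrightarrow>
            (\<forall>i\<in>{1..<n}. semisimple W (S i) \<and> spec W (S i) \<subseteq> {c, - c * \<mu>}
               \<and> ({c, - c * \<mu>} \<subseteq> spec W (S i) \<longleftrightarrow> (n - 1) * m \<mu> > l))
            \<and> ((n - 1) * m \<mu> > l \<longleftrightarrow> \<not> (n = 2 \<and> lam = inverse (\<mu> ^ 2))))"
    if \<mu>: "\<mu> \<noteq> 0" "\<mu> \<noteq> 1" "\<mu> \<noteq> - 1" "E \<subseteq> {\<mu>}" for \<mu>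
  proof (intro conjI ballI impI)
    note sub = \<mu>(4)[unfolded E_eq]
    show "(S i \<ominus>\<^bsub>End W\<^esub> scalar_op W c) \<otimes>\<^bsub>End W\<^esub> (S i \<oplus>\<^bsub>End W\<^esub> scalar_op W (c * \<mu>)) = \<zero>\<^bsub>End W\<^esub>" if "i \<in> {1..<n}" for i
      unfolding W_eq S_eq by (rule K.hecke_relation_single[OF sub that])
    show "defines_hecke_rep n \<mu> W (\<lambda>i. inverse c \<odot>\<^bsub>End W\<^esub> S i)"
      unfolding W_eq S_eq by (rule K.hecke_rep_single[OF sub])
    have "B = {b \<in> B. ev b = 1} \<union> {b \<in> B. ev b = \<mu>}"
      using sub by auto
    then have "card B = card {b \<in> B. ev b = 1} + card {b \<in> B. ev b = \<mu>}"
      using B(1) \<mu>(2) by (subst card_Un_disjoint[symmetric]) auto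
    then have "int N - int k1 = int (m \<mu>)"
      unfolding N_eq k1_eq m_eq by simp
    then show "int (vdim W) = int n * int (m \<mu>) - int l"
      using dim by simp
    assume m0: "m \<mu> \<noteq> 0"
    then have "{b \<in> B. ev b = \<mu>} \<noteq> {}"
      unfolding m_eq by (intro notI) simp
    then have E\<mu>: "ev ` B - {1} = {\<mu>}"
      using sub \<mu>(2) by blast
    (* lam * g ^ n = 1 holds on the whole eigenspace of \<mu> or on no vector of it, and not at all at the
       eigenvalue 1 because lam \<noteq> 1 *)
    have l\<mu>: "l = (if lam * \<mu> ^ n = 1 then m \<mu> else 0)"
    proof -
      have "{b \<in> B. lam * ev b ^ n = 1} = (if lam * \<mu> ^ n = 1 then {b \<in> B. ev b = \<mu>} else {})"
        using sub assms(10) by auto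
      then show ?thesis
        unfolding l_eq m_eq by simp
    qed
    have bound: "(n - 1) * m \<mu> > l \<longleftrightarrow> \<not> (n = 2 \<and> lam * \<mu> ^ 2 = 1)"
    proof (cases "n = 2")
      case True
      then show ?thesis
        using l\<mu> m0 by simp
    next
      case False
      then have "2 * m \<mu> \<le> (n - 1) * m \<mu>"
        using assms(1) by (intro mult_right_mono) auto
      moreover have "l < 2 * m \<mu>"
        using l\<mu> m0 by simp
      ultimately have "l < (n - 1) * m \<mu>"
        by (rule order.strict_trans2[rotated])
      then show ?thesis
        using False by simp
    qed
    have inv: "lam * \<mu> ^ 2 = 1 \<longleftrightarrow> lam = inverse (\<mu> ^ 2)"
      using \<mu>(1) by (auto simp: field_simps)
    show "(n - 1) * m \<mu> > l \<longleftrightarrow> \<not> (n = 2 \<and> lam = inverse (\<mu> ^ 2))"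
      unfolding bound inv ..
    fix i assume i: "i \<in> {1..<n}"
    note spec = K.spec_both_iff[OF E\<mu> \<mu>(3) i]
    show "semisimple W (S i)" "spec W (S i) \<subseteq> {c, - c * \<mu>}"
      unfolding W_eq S_eq by (fact spec)+
    show "{c, - c * \<mu>} \<subseteq> spec W (S i) \<longleftrightarrow> (n - 1) * m \<mu> > l"
      unfolding W_eq S_eq bound by (rule spec(3))
  qed

  have min_poly: "minimal_polynomial W (S i) = monic_lcm (local_min_poly n lam c ` E)" if "i \<in> {1..<n}" for i
    unfolding W_eq S_eq E_eq by (rule K.minimal_polynomial_Sop[OF that])

  have part3: "minimal_polynomial W (S i) = monic_lcm (hecke_poly c ` E)
          \<and> (quadratic_with_distinct_roots (minimal_polynomial W (S i))
               \<longleftrightarrow> (\<exists>\<mu>. E = {\<mu>} \<and> \<mu> \<noteq> -1))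
          \<and> (\<forall>\<mu>. E = {\<mu>} \<and> \<mu> \<noteq> -1 \<longrightarrow>
               {t. poly (minimal_polynomial W (S i)) t = 0} = {c, - c * \<mu>})"
    if n3: "n \<ge> 3" and E0: "E \<noteq> {}" and i: "i \<in> {1..<n}" for i
  proof -
    have eq: "minimal_polynomial W (S i) = monic_lcm (hecke_poly c ` E)"
      using min_poly[OF i] K.local_min_poly_ge3[OF n3] by simp
    have "{t. poly (minimal_polynomial W (S i)) t = 0} = {c, - c * \<mu>}" if "E = {\<mu>}" for \<mu>
      unfolding eq that using hecke_poly_roots[of c \<mu>] by (simp add: monic_lcm_singleton hecke_poly_monic)
    then show ?thesis
      using eq lcm_hecke_quadratic_iff[OF assms(8) fin_E E0] by auto
  qed

  have part5: "(\<forall>i\<in>{1..<n}.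
          minimal_polynomial W (S i) = [:-c, 1:] ^ 2
          \<and> \<not> (\<exists>a b. a \<noteq> b \<and>
                 (S i \<ominus>\<^bsub>End W\<^esub> scalar_op W a) \<otimes>\<^bsub>End W\<^esub> (S i \<ominus>\<^bsub>End W\<^esub> scalar_op W b) = \<zero>\<^bsub>End W\<^esub>))
       \<and> defines_hecke_rep n (-1) W (\<lambda>i. inverse c \<odot>\<^bsub>End W\<^esub> S i)"
    if E1: "E = {-1}"
  proof (intro conjI ballI)
    note E1' = E1[unfolded E_eq]
    fix i assume i: "i \<in> {1..<n}"
    have "lead_coeff ([:-c, 1:] ^ 2) = 1"
      by (simp only: lead_coeff_power) simp
    then show "minimal_polynomial W (S i) = [:-c, 1:] ^ 2"
      unfolding min_poly[OF i] E1 by (simp only: image_insert image_empty K.local_min_poly_minus_one monic_lcm_singleton)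
    show "\<not> (\<exists>a b. a \<noteq> b \<and>
        (S i \<ominus>\<^bsub>End W\<^esub> scalar_op W a) \<otimes>\<^bsub>End W\<^esub> (S i \<ominus>\<^bsub>End W\<^esub> scalar_op W b) = \<zero>\<^bsub>End W\<^esub>)"
      unfolding W_eq S_eq by (rule K.no_split_relation[OF E1' i])
  next
    show "defines_hecke_rep n (-1) W (\<lambda>i. inverse c \<odot>\<^bsub>End W\<^esub> S i)"
      unfolding W_eq S_eq using E1 unfolding E_eq by (intro K.hecke_rep_single) simp
  qed

  have part6: "S 1 = scalar_op W (- c * \<mu>)
       \<and> minimal_polynomial W (S 1) = [:c * \<mu>, 1:]
       \<and> (S 1 \<ominus>\<^bsub>End W\<^esub> scalar_op W c) \<otimes>\<^bsub>End W\<^esub> (S 1 \<oplus>\<^bsub>End W\<^esub> scalar_op W (c * \<mu>)) = \<zero>\<^bsub>End W\<^esub>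
       \<and> defines_hecke_rep 2 \<mu> W (\<lambda>i. inverse c \<odot>\<^bsub>End W\<^esub> S i)"
    if \<mu>: "n = 2" "E = {\<mu>}" "lam * \<mu> ^ 2 = 1" for \<mu>
  proof -
    note E' = \<mu>(2)[unfolded E_eq]
    have i: "1 \<in> {1..<n}"
      using \<mu>(1) by simp
    show ?thesis
      using K.resonant_scalar[OF \<mu>(1) E' \<mu>(3)] K.hecke_relation_single[OF equalityD1[OF E'] i]
        K.hecke_rep_single[OF equalityD1[OF E']]
      unfolding W_eq S_eq \<mu>(1) by blast
  qed

  have part4: "minimal_polynomial W (S 1) =
         monic_lcm ((\<lambda>\<nu>. [:c * \<nu>, 1:]) ` {\<nu>\<in>E. lam * \<nu> ^ 2 = 1}
                     \<union> hecke_poly c ` {\<nu>\<in>E. lam * \<nu> ^ 2 \<noteq> 1})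
       \<and> (quadratic_with_distinct_roots (minimal_polynomial W (S 1)) \<longleftrightarrow>
            (\<exists>\<mu>. E = {\<mu>} \<and> \<mu> \<noteq> -1 \<and> lam * \<mu> ^ 2 \<noteq> 1)
            \<or> (\<exists>\<nu>. E = {\<nu>, - \<nu>} \<and> lam = inverse (\<nu> ^ 2)))
       \<and> (\<forall>\<mu>. E = {\<mu>} \<and> \<mu> \<noteq> -1 \<and> lam * \<mu> ^ 2 \<noteq> 1 \<longrightarrow>
            {t. poly (minimal_polynomial W (S 1)) t = 0} = {c, - c * \<mu>})
       \<and> (\<forall>\<nu>. E = {\<nu>, - \<nu>} \<and> lam = inverse (\<nu> ^ 2) \<longrightarrow>
            {t. poly (minimal_polynomial W (S 1)) t = 0} = {c * \<nu>, - c * \<nu>}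
            \<and> (let T1 = inverse (c * \<nu>) \<odot>\<^bsub>End W\<^esub> S 1 in
                 (T1 \<ominus>\<^bsub>End W\<^esub> \<one>\<^bsub>End W\<^esub>) \<otimes>\<^bsub>End W\<^esub> (T1 \<oplus>\<^bsub>End W\<^esub> \<one>\<^bsub>End W\<^esub>) = \<zero>\<^bsub>End W\<^esub>)
            \<and> defines_hecke_rep 2 1 W (\<lambda>i. inverse (c * \<nu>) \<odot>\<^bsub>End W\<^esub> S i))"
    if n2: "n = 2" and E0: "E \<noteq> {}"
  proof -
    have i: "1 \<in> {1..<n}"
      using n2 by simp
    let ?P = "(\<lambda>\<nu>. [:c * \<nu>, 1:]) ` {\<nu>\<in>E. lam * \<nu> ^ 2 = 1} \<union> hecke_poly c ` {\<nu>\<in>E. lam * \<nu> ^ 2 \<noteq> 1}"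
    have eq: "minimal_polynomial W (S 1) = monic_lcm ?P"
      using min_poly[OF i] K.local_min_poly_image_2[OF n2] unfolding E_eq by simp
    note quad = lcm_resonant_quadratic_iff[OF assms(8,9,10) fin_E E0 zero_E]
    have one: "{t. poly (monic_lcm ?P) t = 0} = {c, - c * \<mu>}" if \<mu>: "E = {\<mu>}" "lam * \<mu> ^ 2 \<noteq> 1" for \<mu>
    proof -
      have R: "{x \<in> E. lam * x ^ 2 = 1} = {}" and U: "{x \<in> E. lam * x ^ 2 \<noteq> 1} = {\<mu>}"
        using \<mu> by auto
      have "monic_lcm ?P = hecke_poly c \<mu>"
        unfolding R U by (simp add: monic_lcm_singleton hecke_poly_monic)
      then show ?thesis
        by (simp only: hecke_poly_roots)
    qed
    have two: "{t. poly (monic_lcm ?P) t = 0} = {c * \<nu>, - c * \<nu>}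
            \<and> (let T1 = inverse (c * \<nu>) \<odot>\<^bsub>End W\<^esub> S 1 in
                 (T1 \<ominus>\<^bsub>End W\<^esub> \<one>\<^bsub>End W\<^esub>) \<otimes>\<^bsub>End W\<^esub> (T1 \<oplus>\<^bsub>End W\<^esub> \<one>\<^bsub>End W\<^esub>) = \<zero>\<^bsub>End W\<^esub>)
            \<and> defines_hecke_rep 2 1 W (\<lambda>i. inverse (c * \<nu>) \<odot>\<^bsub>End W\<^esub> S i)"
      if \<nu>: "E = {\<nu>, - \<nu>}" "lam = inverse (\<nu> ^ 2)" for \<nu>
    proof -
      have "\<nu> \<noteq> 0"
        using \<nu>(1) zero_E by auto
      then have t: "inverse (c * \<nu>) \<noteq> 0" and res: "lam * \<nu> ^ 2 = 1"
        using assms(8) \<nu>(2) by simp_all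
      have dvd: "local_min_poly n lam c \<mu> dvd [:- (1 / inverse (c * \<nu>)), 1:] * [:1 / inverse (c * \<nu>), 1:]"
        if "\<mu> \<in> ev ` B - {1}" for \<mu>
      proof -
        have "\<mu> = \<nu> \<or> \<mu> = - \<nu>"
          using that \<nu>(1) unfolding E_eq by auto
        then show ?thesis
          using n2 res by (auto simp: local_min_poly_def inverse_eq_divide simp del: mult_pCons_left mult_pCons_right)
      qed
      have "(inverse (c * \<nu>) \<odot>\<^bsub>End W\<^esub> S 1 \<ominus>\<^bsub>End W\<^esub> \<one>\<^bsub>End W\<^esub>) \<otimes>\<^bsub>End W\<^esub>
          (inverse (c * \<nu>) \<odot>\<^bsub>End W\<^esub> S 1 \<oplus>\<^bsub>End W\<^esub> \<one>\<^bsub>End W\<^esub>) = \<zero>\<^bsub>End W\<^esub>"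
        using K.scaled_hecke[OF t i, of 1] dvd unfolding W_eq S_eq by simp
      moreover have "defines_hecke_rep 2 1 W (\<lambda>i. inverse (c * \<nu>) \<odot>\<^bsub>End W\<^esub> S i)"
        using K.defines_hecke_rep_Sop[OF t, of 1] dvd unfolding W_eq S_eq n2 by blast
      moreover have "{t. poly (monic_lcm ?P) t = 0} = {c * \<nu>, - c * \<nu>}"
        unfolding quad(2)[OF \<nu>] two_linear_roots by auto
      ultimately show ?thesis
        by (simp add: Let_def)
    qed
    show ?thesis
      unfolding eq
      by (rule conjI[OF HOL.refl conjI[OF quad(1) conjI]])
        ((intro allI impI, elim conjE, rule one; assumption),
         (intro allI impI, elim conjE, rule two; assumption))
  qed

  show ?thesis
    by (rule conjI[OF dim conjI[OF _ conjI[OF _ conjI[OF _ conjI]]]])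
      ((intro allI impI, elim conjE, rule part2; assumption),
       (intro impI ballI, elim conjE, rule part3; assumption),
       (intro impI, elim conjE, rule part4; assumption),
       (intro impI, rule part5, assumption),
       (intro allI impI, elim conjE, rule part6; assumption))
qed

end
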